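(* Let $n,k$ be integers with $1\le k\le n/2$. The following (finite) sets are in bijection with one another: (a) Dyck paths of semilength $n$ with $k$ peaks and no singleton ascent; (b) Dyck paths of semilength $n$ with $k$ peaks and no singleton descent; (c) $321$-avoiding permutations of $[n]$ with exactly $k$ left-to-right maxima, all of which are descents; (d) $312$-avoiding permutations of $[n]$ with exactly $k$ left-to-right maxima, all of which are descents; (e) Riordan paths of length $n$ with exactly $k$ $\mathsf{D}$-steps (and thus $k$ $\mathsf{U}$-steps); (f) tableaux $T\in\mathrm{SYT}^{\equiv}_{\le 3}(n)$ with $\lambda_2(T)+\chi(T)=k$, where $\chi(T)=1$ if the last entry of row 1 of $T$ exceeds the last entry of row 2, and $\chi(T)=0$ otherwise; (g) standard Young tableaux of shape $(k,k,1^{n-2k})$; (h) derangements of $[n]$ having genus $0$ and exactly $k$ cycles.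
   Context: A Dyck path of semilength $n$ is a lattice path from $(0,0)$ to $(2n,0)$ with $n$ steps $\mathsf{U}=(1,1)$ and $n$ steps $\mathsf{D}=(1,-1)$ never going below the $x$-axis; a peak is an occurrence of consecutive steps $\mathsf{U}\mathsf{D}$. An ascent (resp. descent) of the path is a maximal run of consecutive $\mathsf{U}$-steps (resp. $\mathsf{D}$-steps); it is singleton if it has length $1$. For a permutation $\pi=\pi_1\cdots\pi_n$ of $[n]=\{1,\dots,n\}$, an entry $\pi_i$ is a left-to-right maximum if $\pi_i>\pi_j$ for all $j<i$; it is a descent if $i<n$ and $\pi_i>\pi_{i+1}$. A Motzkin path of length $n$ is a lattice path from $(0,0)$ to $(n,0)$ with steps $\mathsf{U}=(1,1)$, $\mathsf{H}=(1,0)$, $\mathsf{D}=(1,-1)$ never going below the $x$-axis; a Riordan path is a Motzkin path with no $\mathsf{H}$-step on the $x$-axis. $\mathrm{SYT}^{\equiv}_{\le 3}(n)$ is the set of standard Young tableaux $T$ with $n$ cells and at most three rows whose row lengths $\lambda_1\ge\lambda_2\ge\lambda_3\ge0$ all have the same parity (empty rows are included and counted as even); $\lambda_2(T)$ is the length of row 2. By convention the last entry of an empty row is $0$. $1^{m}$ denotes $m$ parts equal to $1$. A derangement is a permutation without fixed points. The genus $g$ of a permutation $\sigma$ of $[n]$ is defined by $\mathrm{cyc}(\sigma)+\mathrm{cyc}(\sigma^{-1}\zeta_n)=n+1-2g$, where $\zeta_n=(1\,2\,\cdots\,n)$ and $\mathrm{cyc}$ counts cycles (including fixed points). Equivalently,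 $\sigma$ has genus $0$ iff its cycles form a noncrossing partition of $[n]$ and each cycle, written starting from its smallest element, is increasing. *)

theory Defs
  imports
    "HOL-Library.Equipollence"
    "HOL-Combinatorics.Permutations"
    "HOL-Combinatorics.Cycles"
    "HOL-Combinatorics.Orbits"
begin

section \<open>Lattice paths\<close>

datatype step = Up | Horiz | Down

fun step_vec :: "step \<Rightarrow> int \<times> int" where
  "step_vec Up = (1, 1)"
| "step_vec Horiz = (1, 0)"
| "step_vec Down = (1, -1)"

text \<open>The lattice point reached after the first \<open>i\<close> steps, starting from the origin.\<close>

definition position :: "step list \<Rightarrow> nat \<Rightarrow> int \<times> int" where
  "position p i = (\<Sum>s\<leftarrow>take i p. (fst (step_vec s)), \<Sum>s\<leftarrow>take i p. (snd (step_vec s)))"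

definition weakly_above_axis :: "step list \<Rightarrow> bool" where
  "weakly_above_axis p \<longleftrightarrow> (\<forall>i\<le>length p. 0 \<le> snd (position p i))"

definition dyck_path :: "nat \<Rightarrow> step list \<Rightarrow> bool" where
  "dyck_path n p \<longleftrightarrow> set p \<subseteq> {Up, Down} \<and> count_list p Up = n \<and> count_list p Down = n \<and>
     position p (length p) = (2 * int n, 0) \<and> weakly_above_axis p"

definition num_peaks :: "step list \<Rightarrow> nat" where
  "num_peaks p = card {i. Suc i < length p \<and> p ! i = Up \<and> p ! Suc i = Down}"

text \<open>\<open>maximal_run s p i l\<close>: the steps of \<open>p\<close> with indices \<open>i, \<dots>, i + l - 1\<close> form a maximal
  run of consecutive steps equal to \<open>s\<close>. For \<open>s = Up\<close> this is an ascent and for \<open>s = Down\<close>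
  a descent of the path, of length \<open>l\<close>.\<close>

definition maximal_run :: "step \<Rightarrow> step list \<Rightarrow> nat \<Rightarrow> nat \<Rightarrow> bool" where
  "maximal_run s p i l \<longleftrightarrow> 0 < l \<and> i + l \<le> length p \<and> (\<forall>j\<in>{i..<i + l}. p ! j = s) \<and>
     (0 < i \<longrightarrow> p ! (i - 1) \<noteq> s) \<and> (i + l < length p \<longrightarrow> p ! (i + l) \<noteq> s)"

definition has_singleton_ascent :: "step list \<Rightarrow> bool" where
  "has_singleton_ascent p \<longleftrightarrow> (\<exists>i. maximal_run Up p i 1)"

definition has_singleton_descent :: "step list \<Rightarrow> bool" where
  "has_singleton_descent p \<longleftrightarrow> (\<exists>i. maximal_run Down p i 1)"

definition motzkin_path :: "nat \<Rightarrow> step list \<Rightarrow> bool" where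
  "motzkin_path n p \<longleftrightarrow> position p (length p) = (int n, 0) \<and> weakly_above_axis p"

definition riordan_path :: "nat \<Rightarrow> step list \<Rightarrow> bool" where
  "riordan_path n p \<longleftrightarrow> motzkin_path n p \<and>
     \<not> (\<exists>i<length p. p ! i = Horiz \<and> snd (position p i) = 0)"

section \<open>Permutations\<close>

text \<open>A permutation of \<open>{1..n}\<close> is a function \<open>\<pi> :: nat \<Rightarrow> nat\<close> with \<open>\<pi> permutes {1..n}\<close>;
  in particular it is the identity outside \<open>{1..n}\<close>. Its one-line notation is
  \<open>\<pi> 1, \<dots>, \<pi> n\<close>. Patterns are given as lists in one-line notation.\<close>

definition contains_pattern :: "nat \<Rightarrow> (nat \<Rightarrow> nat) \<Rightarrow> nat list \<Rightarrow> bool" where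
  "contains_pattern n \<pi> \<tau> \<longleftrightarrow>
     (\<exists>is. length is = length \<tau> \<and> sorted_wrt (<) is \<and> set is \<subseteq> {1..n} \<and>
        (\<forall>a<length \<tau>. \<forall>b<length \<tau>. \<pi> (is ! a) < \<pi> (is ! b) \<longleftrightarrow> \<tau> ! a < \<tau> ! b))"

abbreviation avoids_pattern :: "nat \<Rightarrow> (nat \<Rightarrow> nat) \<Rightarrow> nat list \<Rightarrow> bool" where
  "avoids_pattern n \<pi> \<tau> \<equiv> \<not> contains_pattern n \<pi> \<tau>"

text \<open>Left-to-right maxima and descents are represented by the positions at which they occur.\<close>

definition lr_maxima :: "nat \<Rightarrow> (nat \<Rightarrow> nat) \<Rightarrow> nat set" where
  "lr_maxima n \<pi> = {i \<in> {1..n}. \<forall>j\<in>{1..<i}. \<pi> j < \<pi> i}"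

definition descents :: "nat \<Rightarrow> (nat \<Rightarrow> nat) \<Rightarrow> nat set" where
  "descents n \<pi> = {i \<in> {1..<n}. \<pi> (Suc i) < \<pi> i}"

definition derangement :: "nat \<Rightarrow> (nat \<Rightarrow> nat) \<Rightarrow> bool" where
  "derangement n \<sigma> \<longleftrightarrow> \<sigma> permutes {1..n} \<and> (\<forall>i\<in>{1..n}. \<sigma> i \<noteq> i)"

definition cyc :: "nat \<Rightarrow> (nat \<Rightarrow> nat) \<Rightarrow> nat" where
  "cyc n \<sigma> = card (orbit \<sigma> ` {1..n})"

text \<open>\<open>zeta n\<close> is the cycle \<open>1 \<mapsto> 2 \<mapsto> \<cdots> \<mapsto> n \<mapsto> 1\<close>.\<close>

definition zeta :: "nat \<Rightarrow> nat \<Rightarrow> nat" where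
  "zeta n = cycle_of_list [1..<Suc n]"

text \<open>The order in which the product of \<open>inv \<sigma>\<close> and \<open>zeta n\<close> is taken is immaterial, since the two
  products are conjugate and hence have the same number of cycles.\<close>

definition has_genus :: "nat \<Rightarrow> (nat \<Rightarrow> nat) \<Rightarrow> int \<Rightarrow> bool" where
  "has_genus n \<sigma> g \<longleftrightarrow>
     int (cyc n \<sigma>) + int (cyc n (inv \<sigma> \<circ> zeta n)) = int n + 1 - 2 * g"

section \<open>Standard Young tableaux\<close>

text \<open>A tableau is the list of its nonempty rows, from top to bottom; rows are indexed from 0.\<close>

definition shape :: "nat list list \<Rightarrow> nat list" where
  "shape T = map length T"

definition standard_young_tableau :: "nat \<Rightarrow> nat list list \<Rightarrow> bool" where
  "standard_young_tableau n T \<longleftrightarrow>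
     sorted_wrt (\<ge>) (shape T) \<and> 0 \<notin> set (shape T) \<and>
     distinct (concat T) \<and> set (concat T) = {1..n} \<and>
     (\<forall>row\<in>set T. sorted_wrt (<) row) \<and>
     (\<forall>i j. Suc i < length T \<and> j < length (T ! Suc i) \<longrightarrow> T ! i ! j < T ! Suc i ! j)"

definition row_length :: "nat list list \<Rightarrow> nat \<Rightarrow> nat" where
  "row_length T i = (if i < length T then length (T ! i) else 0)"

definition row_last :: "nat list list \<Rightarrow> nat \<Rightarrow> nat" where
  "row_last T i = (if i < length T then last (T ! i) else 0)"

definition syt_le3_same_parity :: "nat \<Rightarrow> nat list list set" where
  "syt_le3_same_parity n = {T. standard_young_tableau n T \<and> length T \<le> 3 \<and>
     (\<forall>i<3. \<forall>j<3. even (row_length T i) \<longleftrightarrow> even (row_length T j))}"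

definition chi :: "nat list list \<Rightarrow> nat" where
  "chi T = (if row_last T 1 < row_last T 0 then 1 else 0)"

end

theory Submission
  imports Defs Complex_Main "HOL-Library.Multiset"
begin

text \<open>
  All eight families have
  \<open>N(n,k) = (n choose k) * (n - k - 1 choose (k - 1)) - (n choose (k - 1)) * (n - k choose k)\<close> elements,
  which is \<open>(n + 1 choose k) * (n - k - 1 choose (k - 1)) / (n + 1)\<close>, and finite sets of equal size are in
  bijection. The difference form of \<open>N(n,k)\<close> is the one that recursions produce: a ballot condition
  turns into one product of binomial coefficients minus another, and each verification reduces to
  Pascal's rule inside the region and to one identity on its boundary.

  Dyck paths and permutations. A Dyck path is a weakly increasing sequence \<open>c\<^sub>1, \<dots>, c\<^sub>n = n\<close> with
  \<open>c\<^sub>t \<ge> t\<close>, where \<open>c\<^sub>t\<close> is the number of up-steps before the \<open>t\<close>-th down-step; the running maxima of a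
  permutation form such a sequence as well. Peaks and left-to-right maxima are the distinct
  values; absence of singleton descents, and left-to-right maxima all being descents, both mean
  that no value occurs just once. Every sequence arises from exactly one permutation that avoids
  321 and from exactly one that avoids 312: exchanging the two smaller entries of a forbidden
  pattern keeps the running maxima and changes \<open>\<Sum> t \<pi>\<^sub>t\<close> monotonically, so an extremal permutation
  avoids the pattern, and the first place where two permutations with equal running maxima differ
  produces the pattern. Paths and sequences obey the same recursion on the last
  value (\<open>ballot_recursion\<close>). Reversal exchanges ascents with descents.

  Riordan paths are counted by numbers of up-, horizontal and down-steps, one last step at a time
  (\<open>card_rprefixes\<close>).

  Tableaux lose their largest entry at a corner (\<open>card_tableaux_Suc\<close>), which gives the count for
  shape \<open>(k, k, 1, \<dots>, 1)\<close>. For three rows the determinantal formula is a signed sum of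
  six multinomial coefficients. Summed over the shapes with a fixed second row and with the
  first row growing by two while the third shrinks by two, it telescopes to a difference of two
  Riordan prefix numbers. A tableau has \<open>\<chi> = 0\<close> when the entries after the last one of row 2 all
  lie in row 3; removing them gives a recursion in the third row, whose solution, summed over
  shapes, is \<open>N(n,k)\<close> when \<open>k\<close> and \<open>n\<close> have equal parity. The tableaux with \<open>\<chi> = 1\<close> are what is
  left of the telescoped sum (\<open>card_same_parity_tableaux\<close>).

  Derangements of genus zero. For a permutation of a finite set relative to a long cycle \<open>\<zeta>\<close>,
  deleting a point never increases the genus, and the ways to insert a point without raising
  it are indexed by one cycle of \<open>\<sigma>\<^sup>-\<^sup>1 \<zeta>\<close> (\<open>genus0_insert\<close>). Tracking the length of that cycle yields
  the Narayana numbers. Deleting all fixed points expresses a Narayana number as a binomial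
  transform of the wanted numbers, and Vandermonde's identity inverts it
  (\<open>card_genus0_derangements\<close>).
\<close>

section \<open>Binomial coefficients\<close>

definition ibinom :: "nat \<Rightarrow> int \<Rightarrow> int" where
  "ibinom n i = (if i < 0 then 0 else int (n choose nat i))"

text \<open>
  Letting the lower index be an arbitrary integer makes Pascal's rule hold without exceptions,
  so that differences of products of binomial coefficients can be expanded mechanically.
\<close>

lemma ibinom_Suc: "ibinom (Suc n) i = ibinom n i + ibinom n (i - 1)"
proof (cases "i \<le> 0")
  case False
  then have "nat i = Suc (nat (i - 1))" by simp
  then have "Suc n choose nat i = (n choose nat i) + (n choose nat (i - 1))"
    by (metis add.commute binomial_Suc_Suc)
  then show ?thesis using False by (simp add: ibinom_def)
qed (auto simp: ibinom_def)

lemma ibinom_0: "ibinom 0 i = (if i = 0 then 1 else 0)"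
  by (auto simp: ibinom_def)

lemma ibinom_int [simp]: "ibinom n (int k) = int (n choose k)"
  by (simp add: ibinom_def)

lemma ibinom_neg [simp]: "i < 0 \<Longrightarrow> ibinom n i = 0"
  by (simp add: ibinom_def)

lemma ibinom_big: "int n < i \<Longrightarrow> ibinom n i = 0"
  by (simp add: ibinom_def binomial_eq_0)

text \<open>
  Both sides are the multinomial coefficient of \<open>(a, b, c)\<close>, built up in different orders.
\<close>

lemma trinomial_swap12:
  "((a + b + c) choose a) * ((b + c) choose b) = ((a + b + c) choose b) * ((a + c) choose a)"
proof -
  have "real ((a + b + c) choose a) * real ((b + c) choose b) = real ((a + b + c) choose b) * real ((a + c) choose a)"
    by (simp add: binomial_fact)
  then show ?thesis by (metis of_nat_eq_iff of_nat_mult)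
qed

lemma trinomial_swap13:
  "((a + b + c) choose a) * ((b + c) choose b) = ((a + b + c) choose c) * ((a + b) choose b)"
proof -
  have "real ((a + b + c) choose a) * real ((b + c) choose b) = real ((a + b + c) choose c) * real ((a + b) choose b)"
    by (simp add: binomial_fact)
  then show ?thesis by (metis of_nat_eq_iff of_nat_mult)
qed

section \<open>Cycles of permutations\<close>

definition cyc_on :: "'a set \<Rightarrow> ('a \<Rightarrow> 'a) \<Rightarrow> nat" where
  "cyc_on S f = card (orbit f ` S)"

lemma permutes_self_in_orbit:
  assumes "finite S" "f permutes S"
  shows "x \<in> orbit f x"
proof -
  have "permutation f" unfolding permutation_permutes using assms by blast
  then show ?thesis by (rule permutation_self_in_orbit)
qed

lemma permutes_orbit_eq:
  assumes "finite S" "f permutes S" "y \<in> orbit f x"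
  shows "orbit f y = orbit f x"
  using orbit_cyclic_eq3[OF cyclic_on_orbit[OF assms(2,1)] assms(3)] .

lemma transpose_comp_permutes:
  assumes "f permutes S" "a \<in> S" "b \<in> S"
  shows "(transpose a b \<circ> f) permutes S"
  using assms by (simp add: permutes_compose permutes_swap_id)

lemma orbit_transpose_other:
  assumes "finite S" "f permutes S" "c \<notin> orbit f a" "c \<notin> orbit f b"
  shows "orbit (transpose a b \<circ> f) c = orbit f c"
proof (rule orbit_cong)
  show "c \<in> orbit f c" by (rule permutes_self_in_orbit[OF assms(1,2)])
next
  fix s assume s: "s \<in> orbit f c"
  then have "f s \<in> orbit f c" by (rule orbit.step)
  then have "c \<in> orbit f (f s)"
    using permutes_orbit_eq[OF assms(1,2), of "f s" c] permutes_self_in_orbit[OF assms(1,2), of c] by simp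
  then have "f s \<noteq> a" "f s \<noteq> b" using assms(3,4) by auto
  then show "(transpose a b \<circ> f) s = f s" by simp
qed

text \<open>
  As long as the orbit of \<open>a\<close> under the product avoids \<open>b\<close>, it runs inside the \<open>f\<close>-orbit of \<open>a\<close>.
  It closes up through a point sent to \<open>a\<close>, which \<open>f\<close> sends to \<open>b\<close>; since \<open>b\<close> is not in that orbit, the
  orbit must meet \<open>b\<close> after all. An orbit containing \<open>a\<close> and \<open>b\<close> is closed under \<open>f\<close>.
\<close>

lemma orbit_transpose_merge:
  assumes S: "finite S" "f permutes S" "a \<in> S" "b \<in> S" and b: "b \<notin> orbit f a"
  shows "orbit (transpose a b \<circ> f) a = orbit f a \<union> orbit f b"
proof -
  let ?g = "transpose a b \<circ> f"
  let ?A = "orbit ?g a"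
  have g: "?g permutes S" using transpose_comp_permutes[OF S(2-4)] .
  have aA: "a \<in> ?A" using permutes_self_in_orbit[OF S(1) g] .
  have selfb: "b \<in> orbit f b" and selfa: "a \<in> orbit f a"
    by (rule permutes_self_in_orbit[OF S(1,2)])+
  have bA: "b \<in> ?A"
  proof (rule ccontr)
    assume nb: "b \<notin> ?A"
    have sub: "y \<in> orbit f a" if "y \<in> ?A" for y
      using that
    proof induct
      case base
      have "?g a \<noteq> b" using nb orbit.base[of ?g a] by auto
      then have "f a \<noteq> a" by auto
      moreover have "f a \<noteq> b" using b orbit.base[of f a] by auto
      ultimately show ?case by (simp add: orbit.base)
    next
      case (step y)
      have "?g y \<noteq> b" using nb orbit.step[OF step(1)] by auto
      then have "f y \<noteq> a" by auto
      moreover have "f y \<noteq> b" using b orbit.step[OF step(2)] by auto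
      ultimately show ?case using step by (simp add: orbit.step)
    qed
    obtain y where y: "?g y = a" using permutes_surj[OF g] unfolding surj_def by metis
    then have "orbit ?g a = orbit ?g y"
      using permutes_orbit_eq[OF S(1) g orbit.base[of ?g y]] by simp
    then have "y \<in> ?A" using permutes_self_in_orbit[OF S(1) g, of y] by simp
    then have "f y \<in> orbit f a" by (intro orbit.step sub)
    moreover have "f y = b" using y by (auto simp: transpose_def split: if_splits)
    ultimately show False using b by simp
  qed
  have closed: "f y \<in> ?A" if "y \<in> ?A" for y
  proof -
    have "?g y \<in> ?A" using that by (rule orbit.step)
    then show ?thesis using aA bA by (cases "f y = a \<or> f y = b") auto
  qed
  have "orbit f c \<subseteq> ?A" if "c \<in> ?A" for c
  proof
    fix y assume "y \<in> orbit f c"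
    then show "y \<in> ?A" by induct (rule closed, rule that, rule closed)
  qed
  moreover have "?A \<subseteq> orbit f a \<union> orbit f b"
  proof
    fix y assume "y \<in> ?A"
    then show "y \<in> orbit f a \<union> orbit f b"
    proof induct
      case base
      show ?case using selfa selfb orbit.base[of f a] by (simp add: transpose_def)
    next
      case (step y)
      then have "f y \<in> orbit f a \<union> orbit f b" using orbit.step[of y f] by auto
      then show ?case using selfa selfb by (simp add: transpose_def)
    qed
  qed
  ultimately show ?thesis using aA bA by (meson Un_least subset_antisym)
qed

lemma cyc_on_transpose_merge:
  assumes S: "finite S" "f permutes S" "a \<in> S" "b \<in> S" and b: "b \<notin> orbit f a"
  shows "cyc_on S (transpose a b \<circ> f) + 1 = cyc_on S f"
proof -
  let ?g = "transpose a b \<circ> f"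
  let ?R = "orbit f ` (S - orbit f a - orbit f b)"
  note self = permutes_self_in_orbit[OF S(1,2)]
  note eq = permutes_orbit_eq[OF S(1,2)]
  have g: "?g permutes S" using transpose_comp_permutes[OF S(2-4)] .
  have A: "orbit ?g a = orbit f a \<union> orbit f b" by (rule orbit_transpose_merge[OF S b])
    have neq: "orbit f a \<noteq> orbit f b" using b self[of b] by metis
  have "orbit f ` S = insert (orbit f a) (insert (orbit f b) ?R)"
  proof
    show "orbit f ` S \<subseteq> insert (orbit f a) (insert (orbit f b) ?R)"
    proof
      fix X assume "X \<in> orbit f ` S"
      then obtain c where c: "c \<in> S" "X = orbit f c" by blast
      show "X \<in> insert (orbit f a) (insert (orbit f b) ?R)"
        using eq[of c a] eq[of c b] c
        by (cases "c \<in> orbit f a"; cases "c \<in> orbit f b") simp_all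
    qed
  qed (use S(3,4) in auto)
  moreover have nR: "X \<notin> ?R" if "a \<in> X \<or> b \<in> X" for X
  proof
    assume "X \<in> ?R"
    then obtain c where c: "c \<notin> orbit f a" "c \<notin> orbit f b" "X = orbit f c" by auto
    with that have "orbit f c = orbit f a \<or> orbit f c = orbit f b"
      using eq[of a c] eq[of b c] by metis
    with c self[of c] show False by auto
  qed
  then have "orbit f a \<notin> insert (orbit f b) ?R" "orbit f b \<notin> ?R"
    using neq self[of a] self[of b] by auto
  ultimately have 1: "cyc_on S f = card ?R + 2"
    unfolding cyc_on_def using S(1) by simp
  have "orbit ?g c = orbit f c" if "c \<in> S - orbit f a - orbit f b" for c
    using orbit_transpose_other[OF S(1,2), of c a b] that by simp
  then have "orbit ?g ` (S - orbit f a - orbit f b) = ?R" by (rule image_cong[OF refl])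
  moreover have eqg: "orbit ?g c = orbit f a \<union> orbit f b" if "c \<in> orbit f a \<union> orbit f b" for c
    using permutes_orbit_eq[OF S(1) g, of c a] that A by simp
  moreover have "orbit ?g ` S = orbit ?g ` (S \<inter> (orbit f a \<union> orbit f b)) \<union> orbit ?g ` (S - orbit f a - orbit f b)"
    unfolding image_Un[symmetric] by (rule arg_cong[where f = "image _"]) blast
  moreover have "orbit ?g ` (S \<inter> (orbit f a \<union> orbit f b)) = {orbit f a \<union> orbit f b}"
    (is "?I = _")
  proof
    show "?I \<subseteq> {orbit f a \<union> orbit f b}" using eqg by (intro subsetI) (elim imageE, simp)
    have "orbit ?g a \<in> ?I" using S(3) self[of a] by (intro imageI) simp
    then show "{orbit f a \<union> orbit f b} \<subseteq> ?I" using A by simp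
  qed
  ultimately have "orbit ?g ` S = insert (orbit f a \<union> orbit f b) ?R" by simp
  moreover have "orbit f a \<union> orbit f b \<notin> ?R" using self[of a] by (intro nR) simp
  ultimately have "cyc_on S ?g = card ?R + 1"
    unfolding cyc_on_def using S(1) by simp
  with 1 show ?thesis by simp
qed

text \<open>
  The transposition short-circuits the cycle of \<open>a\<close>: on reaching \<open>b\<close> after \<open>i\<close> steps, one is sent
  back to \<open>a\<close>. The length \<open>i\<close> of the new cycle is the statistic that is tracked when points are
  inserted into permutations of genus zero.
\<close>

lemma orbit_transpose_split:
  assumes S: "finite S" "f permutes S"
    and i: "0 < i" "i < card (orbit f a)" and b: "b = (f ^^ i) a"
  shows "orbit (transpose a b \<circ> f) a = (\<lambda>t. (f ^^ t) a) ` {..<i}"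
    and "card (orbit (transpose a b \<circ> f) a) = i"
    and "b \<notin> orbit (transpose a b \<circ> f) a"
proof -
  let ?g = "transpose a b \<circ> f"
  let ?d = "funpow_dist1 f a a"
  have aa: "a \<in> orbit f a" using permutes_self_in_orbit[OF S] .
  have inj: "inj_on (\<lambda>t. (f ^^ t) a) {0..<?d}" by (rule inj_on_funpow_dist1[OF aa])
  have "card (orbit f a) = ?d"
    using card_image[OF inj] orbit_conv_funpow_dist1[OF aa] by simp
  then have inj': "inj_on (\<lambda>t. (f ^^ t) a) {..i}"
    using i by (intro inj_on_subset[OF inj]) auto
  have neq: "(f ^^ t) a \<noteq> a" "(f ^^ t) a \<noteq> b" if "0 < t" "t < i" for t
    using inj_onD[OF inj', of t 0] inj_onD[OF inj', of t i] that b by auto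
  have iter: "(?g ^^ t) a = (f ^^ t) a" if "t < i" for t
    using that
  proof (induct t)
    case (Suc t)
    have IH: "(?g ^^ t) a = (f ^^ t) a" by (rule Suc.hyps) (use Suc.prems in simp)
    have "(?g ^^ Suc t) a = transpose a b ((f ^^ Suc t) a)"
      by (simp only: funpow.simps o_apply IH)
    then show ?case
      unfolding \<open>(?g ^^ Suc t) a = _\<close> using neq[of "Suc t"] Suc.prems by (intro transpose_apply_other) auto
  qed simp
  obtain i' where i': "i = Suc i'" using i by (cases i) auto
  have IH: "(?g ^^ i') a = (f ^^ i') a" using i' by (intro iter) simp
  have "(?g ^^ i) a = transpose a b ((f ^^ i) a)"
    unfolding i' by (simp only: funpow.simps o_apply IH)
  also have "\<dots> = a" unfolding b by simp
  finally have "(?g ^^ i) a = a" .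
  then have "orbit ?g a = {(?g ^^ m) a | m. m < i}"
    using i by (intro orbit_altdef_bounded) auto
  also have "\<dots> = (\<lambda>t. (?g ^^ t) a) ` {..<i}" unfolding image_def by auto
  also have "\<dots> = (\<lambda>t. (f ^^ t) a) ` {..<i}" by (rule image_cong[OF refl]) (simp only: iter lessThan_iff)
  finally show *: "orbit ?g a = (\<lambda>t. (f ^^ t) a) ` {..<i}" .
  have "inj_on (\<lambda>t. (f ^^ t) a) {..<i}" by (rule inj_on_subset[OF inj']) auto
  then show "card (orbit ?g a) = i" unfolding * by (simp add: card_image)
  show "b \<notin> orbit ?g a"
  proof
    assume "b \<in> orbit ?g a"
    then obtain t where "t < i" "b = (f ^^ t) a" unfolding * by auto
    then show False using inj_onD[OF inj', of i t] b by simp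
  qed
qed

lemma orbit_funpow_card:
  assumes S: "finite S" "f permutes S" and b: "b \<in> orbit f a" "b \<noteq> a"
  obtains i where "0 < i" "i < card (orbit f a)" "b = (f ^^ i) a"
proof -
  let ?d = "funpow_dist1 f a a"
  have aa: "a \<in> orbit f a" using permutes_self_in_orbit[OF S] .
  have inj: "inj_on (\<lambda>t. (f ^^ t) a) {0..<?d}" by (rule inj_on_funpow_dist1[OF aa])
  have "card (orbit f a) = ?d"
    using card_image[OF inj] orbit_conv_funpow_dist1[OF aa] by simp
  moreover obtain i where "i < ?d" "b = (f ^^ i) a"
    using b orbit_conv_funpow_dist1[OF aa] by auto
  moreover from this b have "i \<noteq> 0" by (metis funpow_0)
  ultimately show thesis using that by auto
qed

text \<open>
  A transposition is its own inverse, so splitting a cycle is merging two cycles read backwards.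
\<close>

lemma cyc_on_transpose_split:
  assumes S: "finite S" "f permutes S" "a \<in> S" "b \<in> S" and b: "b \<in> orbit f a" "b \<noteq> a"
  shows "cyc_on S (transpose a b \<circ> f) = cyc_on S f + 1"
proof -
  let ?g = "transpose a b \<circ> f"
  obtain i where i: "0 < i" "i < card (orbit f a)" "b = (f ^^ i) a"
    using orbit_funpow_card[OF S(1,2) b] .
  have nb: "b \<notin> orbit ?g a" by (rule orbit_transpose_split(3)[OF S(1,2) i])
  have g: "?g permutes S" using transpose_comp_permutes[OF S(2-4)] .
  have "transpose a b \<circ> ?g = f" by (simp add: fun_eq_iff)
  with cyc_on_transpose_merge[OF S(1) g S(3,4) nb] show ?thesis by simp
qed

lemma cyc_on_remove_fixed:
  assumes S: "finite S" "f permutes S" "x \<in> S" and x: "f x = x"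
  shows "cyc_on S f = cyc_on (S - {x}) f + 1"
proof -
  note self = permutes_self_in_orbit[OF S(1,2)]
  have ox: "orbit f x = {x}" using x by (simp add: orbit_eq_singleton_iff)
  have "orbit f ` S = insert {x} (orbit f ` (S - {x}))"
    using S(3) ox by (metis image_insert insert_Diff)
  moreover have "{x} \<notin> orbit f ` (S - {x})"
  proof
    assume "{x} \<in> orbit f ` (S - {x})"
    then obtain y where "y \<noteq> x" "orbit f y = {x}" by auto
    then show False using self[of y] by auto
  qed
  ultimately show ?thesis unfolding cyc_on_def using S(1) by simp
qed

text \<open>
  The permutation whose cycles are those of \<open>f\<close> with the point \<open>x\<close> cut out; \<open>x\<close> becomes fixed.
\<close>

definition delete :: "'a \<Rightarrow> ('a \<Rightarrow> 'a) \<Rightarrow> 'a \<Rightarrow> 'a" where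
  "delete x f = transpose x (f x) \<circ> f"

text \<open>
  Cutting out \<open>x\<close> splits off the singleton \<open>{x}\<close> from its cycle.
\<close>

lemma delete_props:
  assumes S: "finite S" "f permutes S" "x \<in> S" and x: "f x \<noteq> x"
  shows "delete x f permutes S - {x}"
    and "cyc_on (S - {x}) (delete x f) = cyc_on S f"
    and "orbit f x = insert x (orbit (delete x f) (f x))"
    and "x \<notin> orbit (delete x f) (f x)"
proof -
  have fx: "f x \<in> S" using S by (simp add: permutes_in_image)
  have g: "delete x f permutes S" unfolding delete_def by (rule transpose_comp_permutes[OF S(2,3) fx])
  have gx: "delete x f x = x" by (simp add: delete_def)
  have 1: "delete x f permutes S - {x}" using g gx by (metis Diff_iff permutes_superset singletonD)
  show "delete x f permutes S - {x}" by (rule 1)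
  have "cyc_on S (delete x f) = cyc_on S f + 1"
    unfolding delete_def using cyc_on_transpose_split[OF S fx orbit.base] x by simp
  with cyc_on_remove_fixed[OF S(1) g S(3) gx]
  show "cyc_on (S - {x}) (delete x f) = cyc_on S f" by simp
  have f: "transpose x (f x) \<circ> delete x f = f" by (simp add: fun_eq_iff delete_def)
  have ox: "orbit (delete x f) x = {x}" using gx by (simp add: orbit_eq_singleton_iff)
  show "orbit f x = insert x (orbit (delete x f) (f x))"
    using orbit_transpose_merge[OF S(1) g S(3) fx] ox x unfolding f by simp
  show "x \<notin> orbit (delete x f) (f x)"
    using permutes_orbit_subset[OF 1] fx x by blast
qed

section \<open>Permutations of genus zero\<close>

text \<open>
  With \<open>t = \<sigma>\<^sup>-\<^sup>1\<close> and \<open>z\<close> a cycle through all of \<open>S\<close>, this is the condition that \<open>\<sigma>\<close> has genus zero. Using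
  the inverse turns the insertion of a point into a multiplication by a transposition on the left of
  both \<open>t\<close> and \<open>t \<circ> z\<close>; using arbitrary finite sets spares any renumbering when points are
  deleted.
\<close>

definition genus0 :: "'a set \<Rightarrow> ('a \<Rightarrow> 'a) \<Rightarrow> ('a \<Rightarrow> 'a) set" where
  "genus0 S z = {t. t permutes S \<and> cyc_on S t + cyc_on S (t \<circ> z) = card S + 1}"

lemma delete_cyclic:
  assumes S: "finite S" "z permutes S" "cyclic_on z S" "x \<in> S" and x: "z x \<noteq> x"
  shows "delete x z permutes S - {x}" "cyclic_on (delete x z) (S - {x})"
proof -
  note d = delete_props[OF S(1,2,4) x]
  show "delete x z permutes S - {x}" by (rule d)
  have "orbit z x = S" using S by (simp add: orbit_cyclic_eq3)
  then have "S - {x} = orbit (delete x z) (z x)" using d(3,4) by blast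
  moreover have "z x \<in> S - {x}" using S x by (simp add: permutes_in_image)
  ultimately show "cyclic_on (delete x z) (S - {x})" by (metis cyclic_on_singleI)
qed

lemma extend_props:
  assumes S: "finite S" "z permutes S" "x \<in> S" and x: "z x \<noteq> x"
    and t: "t permutes S - {x}"
  shows "(t \<circ> z) permutes S"
    and "(t \<circ> z) x \<noteq> x"
    and "cyc_on S (t \<circ> z) = cyc_on (S - {x}) (t \<circ> delete x z)"
    and "z p = x \<Longrightarrow> card (orbit (t \<circ> z) x) = card (orbit (t \<circ> delete x z) p) + 1"
proof -
  have tx: "t x = x" using t by (simp add: permutes_not_in)
  have tS: "t permutes S" using t by (rule permutes_subset) blast
  show p: "(t \<circ> z) permutes S" using S(2) tS by (rule permutes_compose)
  have inj: "t a = t b \<longleftrightarrow> a = b" for a b using permutes_inj[OF t] by (simp add: inj_eq)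
  show nx: "(t \<circ> z) x \<noteq> x" using inj[of "z x" x] x tx by simp
  have d: "delete x (t \<circ> z) = t \<circ> delete x z"
    using tx inj by (auto simp: fun_eq_iff delete_def transpose_def) (metis tx inj)+
  note dp = delete_props[of S "t \<circ> z" x, OF S(1) p S(3) nx, unfolded d]
  show "cyc_on S (t \<circ> z) = cyc_on (S - {x}) (t \<circ> delete x z)" by (rule dp(2)[symmetric])
  assume zp: "z p = x"
  have "(t \<circ> delete x z) p = (t \<circ> z) x" using zp by (simp add: delete_def)
  then have "orbit (t \<circ> delete x z) ((t \<circ> z) x) = orbit (t \<circ> delete x z) p"
    using permutes_orbit_eq[OF _ dp(1) orbit.base[of _ p]] S(1) by simp
  with dp(3,4) have "orbit (t \<circ> z) x = insert x (orbit (t \<circ> delete x z) p)"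
    "x \<notin> orbit (t \<circ> delete x z) p" by metis+
  moreover have "finite (orbit (t \<circ> delete x z) p)"
    using finite_orbit[OF permutes_self_in_orbit[OF _ dp(1)]] S(1) by simp
  ultimately show "card (orbit (t \<circ> z) x) = card (orbit (t \<circ> delete x z) p) + 1" by simp
qed

text \<open>
  Inserting \<open>x\<close> into a cycle of \<open>t\<close> leaves the number of its cycles alone, whereas the cycle of \<open>x\<close> under
  \<open>t \<circ> z\<close> is split or merged with another one, according to the place of insertion.
\<close>

lemma insert_weight:
  assumes S: "finite S" "z permutes S" "x \<in> S" and x: "z x \<noteq> x"
    and t: "t permutes S - {x}" and b: "b \<in> S"
  shows "cyc_on S (transpose x b \<circ> t) = cyc_on (S - {x}) t + (if b = x then 1 else 0)"
    and "b \<in> orbit (t \<circ> z) x \<Longrightarrow> b \<noteq> x \<Longrightarrow>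
      cyc_on S (transpose x b \<circ> t \<circ> z) = cyc_on (S - {x}) (t \<circ> delete x z) + 1"
    and "b \<notin> orbit (t \<circ> z) x \<Longrightarrow>
      cyc_on S (transpose x b \<circ> t \<circ> z) + 1 = cyc_on (S - {x}) (t \<circ> delete x z)"
proof -
  have tx: "t x = x" using t by (simp add: permutes_not_in)
  have tS: "t permutes S" using t by (rule permutes_subset) blast
  have r: "cyc_on S t = cyc_on (S - {x}) t + 1"
    by (rule cyc_on_remove_fixed[OF S(1) tS S(3) tx])
  note e = extend_props[OF S x t]
  show "cyc_on S (transpose x b \<circ> t) = cyc_on (S - {x}) t + (if b = x then 1 else 0)"
  proof (cases "b = x")
    case False
    have "orbit t x = {x}" using tx by (simp add: orbit_eq_singleton_iff)
    with False cyc_on_transpose_merge[OF S(1) tS S(3) b] r show ?thesis by simp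
  qed (use r in simp)
  show "b \<in> orbit (t \<circ> z) x \<Longrightarrow> b \<noteq> x \<Longrightarrow>
      cyc_on S (transpose x b \<circ> t \<circ> z) = cyc_on (S - {x}) (t \<circ> delete x z) + 1"
    using cyc_on_transpose_split[OF S(1) e(1) S(3) b] e(3) by (simp add: o_assoc)
  show "b \<notin> orbit (t \<circ> z) x \<Longrightarrow>
      cyc_on S (transpose x b \<circ> t \<circ> z) + 1 = cyc_on (S - {x}) (t \<circ> delete x z)"
    using cyc_on_transpose_merge[OF S(1) e(1) S(3) b] e(3) by (simp add: o_assoc)
qed

lemma split_at_point:
  assumes S: "finite S" "x \<in> S" and s: "s permutes S"
  obtains t where "t permutes S - {x}" "s = transpose x (s x) \<circ> t"
proof
  have sx: "s x \<in> S" using S s by (simp add: permutes_in_image)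
  let ?t = "transpose x (s x) \<circ> s"
  have "?t permutes S" by (rule transpose_comp_permutes[OF s S(2) sx])
  moreover have "?t x = x" by simp
  ultimately show "?t permutes S - {x}" by (metis Diff_iff permutes_superset singletonD)
  show "s = transpose x (s x) \<circ> ?t" by (simp only: o_assoc transpose_comp_involutory id_o)
qed

lemma cyclic_moves:
  assumes "cyclic_on z S" "x \<in> S" "card S \<noteq> 1"
  shows "z x \<noteq> x"
  using assms by (metis eq_on_cyclic_on_iff1)

text \<open>
  A point that is deleted lowers the right-hand side by one and the left-hand side by at most
  one.
\<close>

lemma genus_nonneg:
  assumes "finite S" "z permutes S" "cyclic_on z S" "s permutes S"
  shows "cyc_on S s + cyc_on S (s \<circ> z) \<le> card S + 1"
  using assms
proof (induction "card S" arbitrary: S z s)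
  case 0
  then show ?case by (simp add: cyc_on_def)
next
  case (Suc n)
  show ?case
  proof (cases n)
    case 0
    then have "card S = 1" using Suc.hyps by simp
    then obtain a where "S = {a}" by (auto simp: card_1_singleton_iff)
    then show ?thesis by (simp add: cyc_on_def)
  next
    case (Suc n')
    obtain x where x: "x \<in> S" using Suc.hyps(2) by (metis card.empty ex_in_conv nat.distinct(1))
    have zx: "z x \<noteq> x" using cyclic_moves[OF Suc.prems(3) x] Suc Suc.hyps(2) by simp
    obtain t where t: "t permutes S - {x}" "s = transpose x (s x) \<circ> t"
      using split_at_point[OF Suc.prems(1) x Suc.prems(4)] .
    have b: "s x \<in> S" using x Suc.prems(4) by (simp add: permutes_in_image)
    have c: "card (S - {x}) = n" using Suc.hyps(2) x Suc.prems(1) by simp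
    have IH: "cyc_on (S - {x}) t + cyc_on (S - {x}) (t \<circ> delete x z) \<le> n + 1"
      using Suc.hyps(1)[OF c[symmetric] _ delete_cyclic[OF Suc.prems(1-3) x zx] t(1)] c Suc.prems(1) by simp
    note w = insert_weight[OF Suc.prems(1,2) x zx t(1) b, folded t(2)]
    show ?thesis
    proof (cases "s x = x")
      case True
      then have "s = t" using t(2) by simp
      then show ?thesis using w(1) True IH extend_props(3)[OF Suc.prems(1,2) x zx t(1)] Suc.hyps(2) by simp
    next
      case False
      then show ?thesis using w IH Suc.hyps(2) by (cases "s x \<in> orbit (t \<circ> z) x") auto
    qed
  qed
qed

text \<open>
  In the bound \<open>genus_nonneg\<close>, equality is preserved exactly when the insertion splits a cycle of \<open>t \<circ> z\<close>, or
  when \<open>x\<close> is inserted as a fixed point.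
\<close>

lemma genus0_insert:
  assumes S: "finite S" "z permutes S" "cyclic_on z S" "x \<in> S" and x: "z x \<noteq> x"
    and t: "t permutes S - {x}" and b: "b \<in> S"
  shows "transpose x b \<circ> t \<in> genus0 S z \<longleftrightarrow>
    t \<in> genus0 (S - {x}) (delete x z) \<and> b \<in> orbit (t \<circ> z) x"
proof -
  have tS: "t permutes S" using t by (rule permutes_subset) blast
  have p: "(transpose x b \<circ> t) permutes S" by (rule transpose_comp_permutes[OF tS S(4) b])
  note w = insert_weight[OF S(1,2,4) x t b]
  note e = extend_props[OF S(1,2,4) x t]
  have le: "cyc_on (S - {x}) t + cyc_on (S - {x}) (t \<circ> delete x z) \<le> card (S - {x}) + 1"
    using genus_nonneg[OF _ delete_cyclic[OF S x] t] S(1) by simp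
  have c: "card S = card (S - {x}) + 1" using card_Suc_Diff1[OF S(1,4)] by linarith
  have xo: "x \<in> orbit (t \<circ> z) x" by (rule permutes_self_in_orbit[OF S(1) e(1)])
  show ?thesis
  proof (cases "b = x")
    case True
    then show ?thesis unfolding genus0_def using xo w(1) e(3) c t tS by simp
  next
    case False
    then show ?thesis unfolding genus0_def
      using w(1,2,3) le c t p by (cases "b \<in> orbit (t \<circ> z) x") auto
  qed
qed

text \<open>
  By \<open>genus0_insert\<close> and \<open>extend_props\<close>, the cycle of \<open>x\<close> under \<open>t \<circ> z\<close> lists the admissible
  places for a further point that follows \<open>x\<close> in the long cycle.
\<close>

definition g0_exact :: "'a set \<Rightarrow> ('a \<Rightarrow> 'a) \<Rightarrow> 'a \<Rightarrow> nat \<Rightarrow> nat \<Rightarrow> ('a \<Rightarrow> 'a) set" where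
  "g0_exact S z x k v = {t \<in> genus0 S z. cyc_on S t = k \<and> card (orbit (t \<circ> z) x) = v}"

definition g0_atleast :: "'a set \<Rightarrow> ('a \<Rightarrow> 'a) \<Rightarrow> 'a \<Rightarrow> nat \<Rightarrow> nat \<Rightarrow> ('a \<Rightarrow> 'a) set" where
  "g0_atleast S z x k v = {t \<in> genus0 S z. cyc_on S t = k \<and> v \<le> card (orbit (t \<circ> z) x)}"

lemma finite_genus0: "finite S \<Longrightarrow> finite (genus0 S z)"
  unfolding genus0_def by (rule finite_subset[OF _ finite_permutations]) auto

lemma finite_g0_exact: "finite S \<Longrightarrow> finite (g0_exact S z x k v)" "finite S \<Longrightarrow> finite (g0_atleast S z x k v)"
  unfolding g0_exact_def g0_atleast_def by (simp_all add: finite_genus0)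

text \<open>
  A fixed point \<open>x\<close> lengthens the distinguished cycle by one. Otherwise \<open>x\<close> was inserted at some
  position of the distinguished cycle of \<open>t\<close>, and the new cycle ends at that position: every
  \<open>t\<close> whose cycle has length at least \<open>Suc v\<close> contributes once.
\<close>

lemma card_g0_exact_step:
  assumes S: "finite S" "z permutes S" "cyclic_on z S" "x \<in> S" and x: "z x \<noteq> x" and p: "z p = x"
  shows "card (g0_exact S z x (Suc k) (Suc v)) =
    card (g0_atleast (S - {x}) (delete x z) p (Suc k) (Suc v)) + card (g0_exact (S - {x}) (delete x z) p k v)"
proof -
  let ?S = "S - {x}" and ?z = "delete x z"
  let ?A = "g0_atleast ?S ?z p (Suc k) (Suc v)" and ?B = "g0_exact ?S ?z p k v"
  let ?m = "\<lambda>t. ((t \<circ> z) ^^ Suc v) x"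
  let ?f = "\<lambda>t. transpose x (?m t) \<circ> t"
  have perm: "t permutes ?S" if "t \<in> ?A \<union> ?B" for t
    using that by (auto simp: g0_exact_def g0_atleast_def genus0_def)
  have vA: "Suc v < card (orbit (t \<circ> z) x)" if "t \<in> ?A" for t
    using extend_props(4)[OF S(1,2,4) x perm p] that by (simp add: g0_atleast_def)
  have mA: "?m t \<noteq> x" "?m t \<in> orbit (t \<circ> z) x" "?m t \<in> S" if t: "t \<in> ?A" for t
  proof -
    have pt: "t permutes ?S" using perm that by simp
    note e = extend_props[OF S(1,2,4) x pt]
    have xo: "x \<in> orbit (t \<circ> z) x" by (rule permutes_self_in_orbit[OF S(1) e(1)])
    show mo: "?m t \<in> orbit (t \<circ> z) x" by (rule funpow_in_orbit[OF xo])
    then show "?m t \<in> S" using permutes_orbit_subset[OF e(1) S(4)] by blast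
    have "?m t \<notin> orbit (transpose x (?m t) \<circ> (t \<circ> z)) x"
      by (rule orbit_transpose_split(3)[OF S(1) e(1) _ vA[OF t] refl]) simp
    moreover have "x \<in> orbit (transpose x (?m t) \<circ> (t \<circ> z)) x"
      by (intro permutes_self_in_orbit[OF S(1)] transpose_comp_permutes e(1) S(4) \<open>?m t \<in> S\<close>)
    ultimately show "?m t \<noteq> x" by metis
  qed
  have fA: "?f t \<in> g0_exact S z x (Suc k) (Suc v)" if t: "t \<in> ?A" for t
  proof -
    have pt: "t permutes ?S" using perm that by simp
    note e = extend_props[OF S(1,2,4) x pt]
    have "?f t \<in> genus0 S z"
      using genus0_insert[OF S x pt mA(3)[OF t]] mA(2)[OF t] t by (simp add: g0_atleast_def)
    moreover have "cyc_on S (?f t) = Suc k"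
      using insert_weight(1)[OF S(1,2,4) x pt mA(3)[OF t]] mA(1)[OF t] t by (simp add: g0_atleast_def)
    moreover have "card (orbit (transpose x (?m t) \<circ> (t \<circ> z)) x) = Suc v"
      by (rule orbit_transpose_split(2)[OF S(1) e(1) _ vA[OF t] refl]) simp
    ultimately show ?thesis by (simp add: g0_exact_def o_assoc)
  qed
  have fB: "t \<in> g0_exact S z x (Suc k) (Suc v)" if t: "t \<in> ?B" for t
  proof -
    have pt: "t permutes ?S" using perm that by simp
    note e = extend_props[OF S(1,2,4) x pt]
    have xo: "x \<in> orbit (t \<circ> z) x" by (rule permutes_self_in_orbit[OF S(1) e(1)])
    have "t \<in> genus0 S z"
      using genus0_insert[OF S x pt S(4)] xo t by (simp add: g0_exact_def)
    moreover have "cyc_on S t = Suc k"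
      using insert_weight(1)[OF S(1,2,4) x pt S(4)] t by (simp add: g0_exact_def)
    moreover have "card (orbit (t \<circ> z) x) = Suc v"
      using e(4)[OF p] t by (simp add: g0_exact_def)
    ultimately show ?thesis by (simp add: g0_exact_def)
  qed
  have onto: "s \<in> ?f ` ?A \<union> ?B" if s: "s \<in> g0_exact S z x (Suc k) (Suc v)" for s
  proof -
    have ps: "s permutes S" using s by (simp add: g0_exact_def genus0_def)
    obtain t where t: "t permutes ?S" "s = transpose x (s x) \<circ> t"
      using split_at_point[OF S(1,4) ps] .
    note e = extend_props[OF S(1,2,4) x t(1)]
    have b: "s x \<in> S" using S(4) ps by (simp add: permutes_in_image)
    have tg: "t \<in> genus0 ?S ?z" "s x \<in> orbit (t \<circ> z) x"
      using genus0_insert[OF S x t(1) b] s unfolding t(2)[symmetric] by (auto simp: g0_exact_def)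
    have k: "Suc k = cyc_on ?S t + (if s x = x then 1 else 0)"
      using insert_weight(1)[OF S(1,2,4) x t(1) b] s unfolding t(2)[symmetric] by (simp add: g0_exact_def)
    show ?thesis
    proof (cases "s x = x")
      case True
      then have "s = t" using t(2) by simp
      then have "s \<in> ?B" using tg k True e(4)[OF p] s by (simp add: g0_exact_def)
      then show ?thesis by simp
    next
      case False
      obtain i where i: "0 < i" "i < card (orbit (t \<circ> z) x)" "s x = ((t \<circ> z) ^^ i) x"
        using orbit_funpow_card[OF S(1) e(1) tg(2) False] .
      have c: "card (orbit (transpose x (s x) \<circ> (t \<circ> z)) x) = i"
        by (rule orbit_transpose_split(2)[OF S(1) e(1) i])
      have "transpose x (s x) \<circ> (t \<circ> z) = s \<circ> z"
        unfolding o_assoc t(2)[symmetric] ..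
      with c have "card (orbit (s \<circ> z) x) = i" by metis
      then have iv: "i = Suc v" using s by (simp add: g0_exact_def)
      have "t \<in> ?A" using tg k False i(2) iv e(4)[OF p] by (simp add: g0_atleast_def)
      moreover have "s = ?f t" using t(2) i(3) unfolding iv by metis
      ultimately show ?thesis by blast
    qed
  qed
  have "g0_exact S z x (Suc k) (Suc v) = ?f ` ?A \<union> ?B"
    using fA fB onto by blast
  moreover have fx: "?f t x = ?m t" if "t \<in> ?A" for t
  proof -
    have "t x = x" using permutes_not_in[OF perm[OF UnI1[OF that]], of x] by simp
    then show ?thesis by (simp only: o_apply transpose_apply_first)
  qed
  have "?f ` ?A \<inter> ?B = {}"
  proof (rule equals0I)
    fix s assume s: "s \<in> ?f ` ?A \<inter> ?B"
    then have "s x = x" using permutes_not_in[OF perm[OF UnI2[OF IntD2[OF s]]], of x] by simp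
    moreover obtain t where "t \<in> ?A" "s = ?f t" using s by blast
    ultimately show False using fx[of t] mA(1)[of t] by metis
  qed
  moreover have "inj_on ?f ?A"
  proof (rule inj_onI)
    fix t u assume tu: "t \<in> ?A" "u \<in> ?A" "?f t = ?f u"
    then have "?m t = ?m u" using fx by metis
    with tu(3) have "transpose x (?m t) \<circ> (?f t) = transpose x (?m t) \<circ> (transpose x (?m t) \<circ> u)"
      by metis
    then show "t = u" by (simp only: o_assoc transpose_comp_involutory id_o)
  qed
  then have "card (?f ` ?A) = card ?A" by (rule card_image)
  moreover have "finite ?A" "finite ?B" using S(1) by (simp_all add: finite_g0_exact)
  ultimately show ?thesis by (simp only: card_Un_disjoint finite_imageI)
qed

text \<open>
  For \<open>v = 1\<close> this is the Narayana number. The case \<open>n < v\<close> is set apart because \<open>n - v\<close> is truncated.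
\<close>

definition g0_formula :: "nat \<Rightarrow> nat \<Rightarrow> nat \<Rightarrow> int" where
  "g0_formula n k v = (let j = int n - int k in if n < v then 0 else
     ibinom n j * ibinom (n - v) j - ibinom (n - 1) (j - 1) * ibinom (n - v + 1) (j + 1))"

lemma g0_formula_rec:
  assumes "1 \<le> n"
  shows "g0_formula (Suc n) (Suc k) (Suc v) =
    g0_formula n (Suc k) (Suc v) + (if v = 0 then 0 else g0_formula n k v - g0_formula n k (Suc v)) + g0_formula (Suc n) (Suc k) (Suc (Suc v))"
proof -
  obtain n' where n': "n = Suc n'" using assms by (cases n) auto
  define j where "j = int n - int k"
  have j: "int (Suc n) - int (Suc k) = j" "int n - int (Suc k) = j - 1" "int n - int k = j"
    by (simp_all add: j_def)
  have z: "g0_formula n k 0 - g0_formula n k 1 = 0"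
    by (simp add: g0_formula_def Let_def n' ibinom_Suc algebra_simps)
  have "g0_formula (Suc n) (Suc k) (Suc v) =
    g0_formula n (Suc k) (Suc v) + (g0_formula n k v - g0_formula n k (Suc v)) + g0_formula (Suc n) (Suc k) (Suc (Suc v))"
  proof -
    consider "n < v" | "v = n" | "v < n" by linarith
    then show ?thesis
    proof cases
      case 3
      then obtain w where w: "n = Suc (v + w)" using less_imp_Suc_add by blast
      have "Suc n - Suc v = Suc w" "n - Suc v = w" "n - v = Suc w" "Suc n - Suc (Suc v) = w"
        using w by simp_all
      moreover have "\<not> Suc n < Suc v" "\<not> n < Suc v" "\<not> n < v" "\<not> Suc n < Suc (Suc v)" using 3 by simp_all
      ultimately show ?thesis unfolding g0_formula_def Let_def j
        using n' by (simp add: ibinom_Suc algebra_simps)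
    next
      case 2
      then show ?thesis unfolding g0_formula_def Let_def j
        by (cases "j = 0") (simp_all add: ibinom_Suc ibinom_0 n')
    qed (simp add: g0_formula_def)
  qed
  with z show ?thesis by auto
qed

lemma card_g0_atleast_Suc:
  assumes "finite S"
  shows "card (g0_atleast S z x k v) = card (g0_exact S z x k v) + card (g0_atleast S z x k (Suc v))"
proof -
  have "g0_atleast S z x k v = g0_exact S z x k v \<union> g0_atleast S z x k (Suc v)"
    by (auto simp: g0_exact_def g0_atleast_def)
  moreover have "g0_exact S z x k v \<inter> g0_atleast S z x k (Suc v) = {}" by (auto simp: g0_exact_def g0_atleast_def)
  ultimately show ?thesis using assms by (simp add: card_Un_disjoint finite_g0_exact)
qed

lemma orbit_comp_bounds:
  assumes "finite S" "z permutes S" "x \<in> S" "t \<in> genus0 S z"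
  shows "1 \<le> card (orbit (t \<circ> z) x)" "card (orbit (t \<circ> z) x) \<le> card S"
proof -
  have p: "(t \<circ> z) permutes S" using assms by (simp add: genus0_def permutes_compose)
  have sub: "orbit (t \<circ> z) x \<subseteq> S" by (rule permutes_orbit_subset[OF p assms(3)])
  then show "card (orbit (t \<circ> z) x) \<le> card S" by (rule card_mono[OF assms(1)])
  show "1 \<le> card (orbit (t \<circ> z) x)"
    using finite_subset[OF sub assms(1)] orbit_nonempty[of "t \<circ> z" x] by (simp add: Suc_le_eq card_gt_0_iff)
qed

text \<open>
  The recursion of \<open>card_g0_exact_step\<close> determines the differences in \<open>v\<close>; the starting value is at
  \<open>v > card S\<close>, where there is nothing to count.
\<close>

lemma card_g0_atleast:
  assumes "finite S" "z permutes S" "cyclic_on z S" "x \<in> S" "1 \<le> v"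
  shows "int (card (g0_atleast S z x k v)) = g0_formula (card S) k v"
  using assms
proof (induction "card S" arbitrary: S z x k v)
  case 0
  then show ?case by auto
next
  case (Suc n)
  have cS: "card S = Suc n" using Suc.hyps by simp
  show ?case
  proof (cases "n = 0")
    case True
    then have Sx: "S = {x}" using cS Suc.prems(4) by (metis One_nat_def card_1_singletonE singletonD)
    have "t = id" if "t permutes S" for t using that Sx by simp
    then have g: "genus0 S z = {id}" using Suc.prems(2) unfolding genus0_def Sx cyc_on_def
      by (auto simp: permutes_id)
    have o: "orbit id x = {x}" by (simp add: orbit_eq_singleton_iff)
    have zid: "z = id" using Suc.prems(2) Sx by simp
    have "g0_atleast S z x k v = (if k = 1 \<and> v = 1 then {id} else {})"
      unfolding g0_atleast_def g using Suc.prems(5) o zid by (auto simp: Sx cyc_on_def)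
    moreover have "g0_formula 1 k v = (if k = 1 \<and> v = 1 then 1 else 0)"
    proof (cases "v = 1")
      case True
      have "k = 0 \<or> k = 1 \<or> 1 < k" by linarith
      then show ?thesis using True by (auto simp: g0_formula_def Let_def ibinom_def nat_diff_distrib)
    qed (use Suc.prems(5) in \<open>simp add: g0_formula_def\<close>)
    ultimately show ?thesis using cS True by simp
  next
    case False
    then have n1: "1 \<le> n" by simp
    have zx: "z x \<noteq> x" using cyclic_moves[OF Suc.prems(3,4)] cS False by simp
    obtain p where p: "z p = x" using permutes_surj[OF Suc.prems(2)] unfolding surj_def by metis
    have pS: "p \<in> S - {x}" using p zx Suc.prems(2,4) by (metis Diff_iff permutes_in_image singletonD)
    let ?S = "S - {x}" and ?z = "delete x z"
    note d = delete_cyclic[OF Suc.prems(1-4) zx]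
    have fS: "finite ?S" and cS': "card ?S = n" using Suc.prems(1,4) cS by simp_all
    have IH: "int (card (g0_atleast ?S ?z p k v)) = g0_formula n k v" if "1 \<le> v" for k v
      using Suc.hyps(1)[OF cS'[symmetric] fS d pS that] cS' by simp
    have exact: "int (card (g0_exact ?S ?z p k v)) = (if v = 0 then 0 else g0_formula n k v - g0_formula n k (Suc v))" for k v
    proof (cases "v = 0")
      case True
      have "g0_exact ?S ?z p k 0 = {}"
        using orbit_comp_bounds(1)[OF fS d(1) pS] by (fastforce simp: g0_exact_def)
      then show ?thesis using True by simp
    next
      case False
      then show ?thesis using IH[of v k] IH[of "Suc v" k] card_g0_atleast_Suc[OF fS, of ?z p k v] by simp
    qed
    show ?thesis
    proof (cases k)
      case 0
      have "orbit t ` S \<noteq> {}" for t :: "'a \<Rightarrow> 'a" using Suc.prems(4) by auto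
      then have "g0_atleast S z x k v = {}" using 0 Suc.prems(1)
        by (auto simp: g0_atleast_def cyc_on_def)
      moreover have "g0_formula (Suc n) 0 v = 0"
        using Suc.prems(5) by (auto simp: g0_formula_def Let_def ibinom_big)
      ultimately show ?thesis using 0 cS by simp
    next
      case (Suc K)
      have high: "int (card (g0_atleast S z x (Suc K) v)) = g0_formula (Suc n) (Suc K) v" if "Suc n < v" for v
      proof -
        have "g0_atleast S z x (Suc K) v = {}"
          using orbit_comp_bounds(2)[OF Suc.prems(1,2,4)] cS that by (fastforce simp: g0_atleast_def)
        then show ?thesis using that by (simp add: g0_formula_def)
      qed
      have st: "int (card (g0_atleast S z x (Suc K) (Suc v))) = g0_formula (Suc n) (Suc K) (Suc v)"
        if "int (card (g0_atleast S z x (Suc K) (Suc (Suc v)))) = g0_formula (Suc n) (Suc K) (Suc (Suc v))" for v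
        using that card_g0_atleast_Suc[OF Suc.prems(1), of z x "Suc K" "Suc v"]
          card_g0_exact_step[OF Suc.prems(1-4) zx p, of K v] IH[of "Suc v" "Suc K"] exact[of K v]
          g0_formula_rec[OF n1, of K v] by simp
      have "int (card (g0_atleast S z x (Suc K) (Suc v))) = g0_formula (Suc n) (Suc K) (Suc v)" for v
      proof (cases "Suc n < Suc v")
        case True
        then show ?thesis by (rule high)
      next
        case False
        then have "v \<le> Suc n" by simp
        then show ?thesis
        proof (induction rule: inc_induct)
          case base
          show ?case by (rule high) simp
        next
          case (step m)
          show ?case by (rule st[OF step.IH])
        qed
      qed
      then show ?thesis using Suc Suc.prems(5) cS by (metis Suc_le_D One_nat_def)
    qed
  qed
qed

section \<open>Derangements of genus zero\<close>

definition g0_fixing :: "'a set \<Rightarrow> ('a \<Rightarrow> 'a) \<Rightarrow> 'a set \<Rightarrow> nat \<Rightarrow> ('a \<Rightarrow> 'a) set" where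
  "g0_fixing S z F k = {t \<in> genus0 S z. cyc_on S t = k \<and> {y \<in> S. t y = y} = F}"

lemma finite_g0_fixing: "finite S \<Longrightarrow> finite (g0_fixing S z F k)"
  unfolding g0_fixing_def by (simp add: finite_genus0)

text \<open>
  A fixed point is an insertion that always preserves genus zero, so it can be deleted freely.
\<close>

lemma g0_fixing_remove:
  assumes S: "finite S" "z permutes S" "cyclic_on z S" "x \<in> S" and x: "z x \<noteq> x"
    and F: "x \<in> F"
  shows "g0_fixing S z F (Suc k) = g0_fixing (S - {x}) (delete x z) (F - {x}) k"
proof (intro set_eqI)
  fix t
  show "t \<in> g0_fixing S z F (Suc k) \<longleftrightarrow> t \<in> g0_fixing (S - {x}) (delete x z) (F - {x}) k"
  proof (cases "t permutes S - {x}")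
    case True
    have tx: "t x = x" using True by (simp add: permutes_not_in)
    have p: "(t \<circ> z) permutes S" by (rule extend_props(1)[OF S(1,2,4) x True])
    have "x \<in> orbit (t \<circ> z) x" by (rule permutes_self_in_orbit[OF S(1) p])
    then have "t \<in> genus0 S z \<longleftrightarrow> t \<in> genus0 (S - {x}) (delete x z)"
      using genus0_insert[OF S x True S(4)] by simp
    moreover have "cyc_on S t = cyc_on (S - {x}) t + 1"
      using insert_weight(1)[OF S(1,2,4) x True S(4)] by simp
    moreover have "{y \<in> S. t y = y} = F \<longleftrightarrow> {y \<in> S - {x}. t y = y} = F - {x}"
      using tx F S(4) by blast
    ultimately show ?thesis by (simp add: g0_fixing_def)
  next
    case False
    have "t \<notin> g0_fixing S z F (Suc k)"
    proof
      assume t: "t \<in> g0_fixing S z F (Suc k)"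
      then have "t permutes S" by (simp add: g0_fixing_def genus0_def)
      moreover have "t x = x" using t F by (auto simp: g0_fixing_def)
      ultimately have "t permutes S - {x}" by (metis Diff_iff permutes_superset singletonD)
      with False show False by simp
    qed
    then show ?thesis using False by (simp add: g0_fixing_def genus0_def)
  qed
qed

lemma g0_fixing_0:
  assumes "finite S" "x \<in> S"
  shows "g0_fixing S z F 0 = {}"
  using assms by (auto simp: g0_fixing_def cyc_on_def)

text \<open>
  Deleting all points of \<open>F\<close> leaves a derangement of genus zero with respect to some other long
  cycle. Its count will turn out to depend on \<open>card (S - F)\<close> only, so the existence of such a cycle is
  enough.
\<close>

lemma card_g0_fixing_reduce:
  assumes "finite F" "finite S" "z permutes S" "cyclic_on z S" "F \<subset> S"
  shows "\<exists>z'. z' permutes S - F \<and> cyclic_on z' (S - F) \<and>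
    (\<forall>k. card (g0_fixing S z F k) = (if k < card F then 0 else card (g0_fixing (S - F) z' {} (k - card F))))"
  using assms
proof (induction F arbitrary: S z rule: finite_induct)
  case empty
  then show ?case by auto
next
  case (insert x F)
  have x: "x \<in> S" using insert by auto
  obtain y where y: "y \<in> S" "y \<notin> insert x F" using insert by auto
  have "card {x, y} \<le> card S" using x y insert.prems(1) by (intro card_mono) auto
  then have "card S \<noteq> 1" using y by (auto simp: card_insert_if split: if_splits)
  then have zx: "z x \<noteq> x" using cyclic_moves[OF insert.prems(3) x] by simp
  note d = delete_cyclic[OF insert.prems(1-3) x zx]
  have sub: "F \<subset> S - {x}" using insert y by auto
  obtain z' where z': "z' permutes S - {x} - F" "cyclic_on z' (S - {x} - F)"
    "\<And>k. card (g0_fixing (S - {x}) (delete x z) F k) =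
      (if k < card F then 0 else card (g0_fixing (S - {x} - F) z' {} (k - card F)))"
    using insert.IH[OF _ d sub] insert.prems(1) by auto
  have e: "S - {x} - F = S - insert x F" by auto
  have "card (g0_fixing S z (insert x F) k) = (if k < card (insert x F) then 0
      else card (g0_fixing (S - insert x F) z' {} (k - card (insert x F))))" for k
  proof (cases k)
    case 0
    then show ?thesis using g0_fixing_0[OF insert.prems(1) x] insert.hyps by simp
  next
    case (Suc K)
    have "g0_fixing S z (insert x F) k = g0_fixing (S - {x}) (delete x z) F K"
      using g0_fixing_remove[OF insert.prems(1-3) x zx, of "insert x F" K] insert.hyps Suc by simp
    then show ?thesis using z'(3)[of K] insert.hyps Suc e by simp
  qed
  then show ?case using z' e by metis
qed

lemma g0_fixing_all:
  assumes "finite S" "z permutes S" "cyclic_on z S"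
  shows "g0_fixing S z S k = (if k = card S then {id} else {})"
proof -
  have id: "t = id" if "t permutes S" "{y \<in> S. t y = y} = S" for t
    using that by (metis (mono_tags, lifting) eq_id_iff mem_Collect_eq permutes_not_in)
  have o: "orbit id ` S = (\<lambda>x. {x}) ` S"
    by (rule image_cong) (simp_all add: orbit_eq_singleton_iff)
  have c: "cyc_on S id = card S" unfolding cyc_on_def o by (simp add: card_image)
  have "S \<noteq> {}" using assms(3) by (auto simp: cyclic_on_def)
  moreover have "orbit z ` S = (\<lambda>_. S) ` S"
    by (rule image_cong) (simp_all add: orbit_cyclic_eq3[OF assms(3)])
  ultimately have "orbit z ` S = {S}" by (simp add: image_constant_conv)
  then have "cyc_on S z = 1" by (simp add: cyc_on_def)
  then have "id \<in> genus0 S z" using c by (simp add: genus0_def permutes_id)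
  then show ?thesis using id c by (auto simp: g0_fixing_def genus0_def)
qed

lemma sum_Pow_card:
  fixes g :: "nat \<Rightarrow> 'b::semiring_1"
  assumes "finite S"
  shows "(\<Sum>F\<in>Pow S. g (card F)) = (\<Sum>i\<le>card S. of_nat (card S choose i) * g i)"
proof -
  have "(\<Sum>F\<in>Pow S. g (card F)) = (\<Sum>i\<le>card S. \<Sum>F\<in>{F \<in> Pow S. card F = i}. g (card F))"
    using assms by (intro sum.group[symmetric]) (auto intro: card_mono)
  also have "\<dots> = (\<Sum>i\<le>card S. of_nat (card S choose i) * g i)"
  proof (rule sum.cong[OF refl])
    fix i
    have "(\<Sum>F\<in>{F \<in> Pow S. card F = i}. g (card F)) = (\<Sum>F\<in>{F \<in> Pow S. card F = i}. g i)"
      by (rule sum.cong) auto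
    also have "\<dots> = of_nat (card {F. F \<subseteq> S \<and> card F = i}) * g i" by (simp add: Pow_def)
    finally show "(\<Sum>F\<in>{F \<in> Pow S. card F = i}. g (card F)) = of_nat (card S choose i) * g i"
      using n_subsets[OF assms] by simp
  qed
  finally show ?thesis .
qed

text \<open>
  For \<open>1 \<le> k < n\<close> this is \<open>(n + 1 choose k) * (n - k - 1 choose (k - 1)) / (n + 1)\<close>. The value \<open>1\<close> at \<open>n = k = 0\<close>
  stands for the identity permutation after deletion of all its points.
\<close>

definition riordan_number_real :: "nat \<Rightarrow> nat \<Rightarrow> real" where
  "riordan_number_real n k = (if n = 0 then of_bool (k = 0) else if 1 \<le> k \<and> k < n then
     fact n / (fact k * fact (n - k + 1)) * real (n - k - 1 choose (k - 1)) else 0)"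

lemma g0_formula_1:
  assumes "1 \<le> k" "k < n"
  shows "real_of_int (g0_formula n k 1) = fact n / (fact k * fact (n - k + 1)) * real (n - 1 choose (k - 1))"
proof -
  obtain m where m: "n = Suc (k + m)" using assms less_imp_Suc_add by blast
  obtain l where l: "k = Suc l" using assms by (cases k) auto
  have j: "int n - int k = int (Suc m)" "int (Suc m) - 1 = int m" "int (Suc m) + 1 = int (Suc (Suc m))" "n - 1 + 1 = n" "\<not> n < 1"
    using m by simp_all
  have "g0_formula n k 1 = int (n choose Suc m) * int (n - 1 choose Suc m) - int (n - 1 choose m) * int (n choose Suc (Suc m))"
    unfolding g0_formula_def Let_def j by (simp only: ibinom_int j if_False)
  then have "real_of_int (g0_formula n k 1) = real (n choose Suc m) * real (n - 1 choose Suc m) - real (n - 1 choose m) * real (n choose Suc (Suc m))"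
    by simp
  also have "\<dots> = fact n / (fact k * fact (n - k + 1)) * real (n - 1 choose (k - 1))"
  proof -
    define A B L M :: real where "A = fact n" and "B = fact (n - 1)" and "L = fact l" and "M = fact m"
    have pos: "L > 0" "M > 0" by (simp_all add: L_def M_def)
    have n: "n - 1 = Suc (l + m)" "n = Suc (Suc (l + m))" using m l by simp_all
    have b: "real (n choose Suc m) = A / (M * (real m + 1) * (L * (real l + 1)))"
      "real (n - 1 choose Suc m) = B / (M * (real m + 1) * L)"
      "real (n - 1 choose m) = B / (M * (L * (real l + 1)))"
      "real (n choose Suc (Suc m)) = A / (M * (real m + 1) * (real m + 2) * L)"
      "real (n - 1 choose (k - 1)) = B / (L * (M * (real m + 1)))"
      using n l by (simp_all add: binomial_fact A_def B_def L_def M_def Suc_diff_le algebra_simps del: binomial_Suc_Suc)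
    have f: "fact k = L * (real l + 1)" "fact (n - k + 1) = M * (real m + 1) * (real m + 2)"
      using n l by (simp_all add: L_def M_def algebra_simps)
    show ?thesis unfolding b f A_def[symmetric] using pos
      by (simp add: divide_simps) (simp add: algebra_simps)
  qed
  finally show ?thesis .
qed

text \<open>
  The summation index is the number of fixed points. It leaves \<open>n - k\<close> unchanged, and after cancelling
  factorials the sum is a Vandermonde convolution.
\<close>

lemma riordan_number_real_convolution:
  assumes "1 \<le> n"
  shows "(\<Sum>i\<le>n. real (n choose i) * (if k < i then 0 else riordan_number_real (n - i) (k - i))) = real_of_int (g0_formula n k 1)"
proof -
  consider "k = 0" | "n < k" | "k = n" | "1 \<le> k" "k < n" by linarith
  then show ?thesis
  proof cases
    case 1
    have "(\<Sum>i\<le>n. real (n choose i) * (if k < i then 0 else riordan_number_real (n - i) (k - i))) = 0"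
      using 1 assms by (intro sum.neutral) (auto simp: riordan_number_real_def)
    then show ?thesis using 1 assms by (simp add: g0_formula_def Let_def ibinom_big)
  next
    case 2
    have "(\<Sum>i\<le>n. real (n choose i) * (if k < i then 0 else riordan_number_real (n - i) (k - i))) = 0"
      using 2 by (intro sum.neutral) (auto simp: riordan_number_real_def)
    then show ?thesis using 2 by (simp add: g0_formula_def Let_def)
  next
    case 3
    have "(\<Sum>i\<le>n. real (n choose i) * (if k < i then 0 else riordan_number_real (n - i) (k - i))) = (\<Sum>i\<le>n. if i = n then 1 else 0)"
      using 3 by (intro sum.cong) (auto simp: riordan_number_real_def)
    then show ?thesis using 3 assms by (simp add: g0_formula_def Let_def ibinom_def)
  next
    case 4
    define m where "m = n - k"
    have m: "1 \<le> m" "n = k + m" using 4 by (auto simp: m_def)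
    have "(\<Sum>i\<le>n. real (n choose i) * (if k < i then 0 else riordan_number_real (n - i) (k - i)))
      = (\<Sum>i\<le>k - 1. real (n choose i) * riordan_number_real (n - i) (k - i))"
      using 4 by (intro sum.mono_neutral_cong_right) (auto simp: riordan_number_real_def)
    also have "\<dots> = (\<Sum>i\<le>k - 1. fact n / (fact k * fact (m + 1)) * (real (k choose i) * real (m - 1 choose (k - 1 - i))))"
    proof (rule sum.cong[OF refl])
      fix i assume "i \<in> {..k - 1}"
      then have i: "i < k" using 4 by auto
      have "riordan_number_real (n - i) (k - i) = fact (n - i) / (fact (k - i) * fact (m + 1)) * real (m - 1 choose (k - 1 - i))"
      proof -
        have "n - i \<noteq> 0" "1 \<le> k - i \<and> k - i < n - i" "n - i - (k - i) = m" "k - i - 1 = k - 1 - i"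
          using i m by auto
        then show ?thesis unfolding riordan_number_real_def by simp
      qed
      then show "real (n choose i) * riordan_number_real (n - i) (k - i) = fact n / (fact k * fact (m + 1)) * (real (k choose i) * real (m - 1 choose (k - 1 - i)))"
        using i 4 by (simp add: binomial_fact field_simps del: fact_Suc)
    qed
    also have "\<dots> = fact n / (fact k * fact (m + 1)) * real (\<Sum>i\<le>k - 1. (k choose i) * (m - 1 choose (k - 1 - i)))"
      by (simp add: sum_distrib_left)
    also have "(\<Sum>i\<le>k - 1. (k choose i) * (m - 1 choose (k - 1 - i))) = (n - 1 choose (k - 1))"
      using vandermonde[of k "m - 1" "k - 1"] m by simp
    finally show ?thesis using g0_formula_1[OF 4] by (simp add: m_def)
  qed
qed

text \<open>
  The permutations of genus zero with \<open>k\<close> cycles are counted by a Narayana number; sorted by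
  their set of fixed points, all classes but that of the derangements are known by induction.
  Hence the derangements supply the one missing term of \<open>riordan_number_real_convolution\<close>.
\<close>

theorem card_genus0_derangements:
  assumes "finite S" "z permutes S" "cyclic_on z S"
  shows "real (card (g0_fixing S z {} k)) = riordan_number_real (card S) k"
  using assms
proof (induction "card S" arbitrary: S z k rule: less_induct)
  case less
  let ?n = "card S"
  \<comment> \<open>the contribution of each set of \<open>i\<close> fixed points\<close>
  define h where "h i = (if k < i then 0 else riordan_number_real (?n - i) (k - i))" for i
  have "S \<noteq> {}" using less.prems(3) by (auto simp: cyclic_on_def)
  then obtain x where x: "x \<in> S" by auto
  have n: "1 \<le> ?n" using x less.prems(1) by (simp add: Suc_le_eq card_gt_0_iff) auto
  have h: "real (card (g0_fixing S z F k)) = h (card F)" if F: "F \<in> Pow S - {{}}" for F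
  proof (cases "F = S")
    case True
    then show ?thesis using g0_fixing_all[OF less.prems] by (auto simp: h_def riordan_number_real_def)
  next
    case False
    then have sub: "F \<subset> S" using F by auto
    have fF: "finite F" using F less.prems(1) finite_subset by auto
    have cF: "0 < card F" using F fF by (simp add: card_gt_0_iff)
    obtain z' where z': "z' permutes S - F" "cyclic_on z' (S - F)"
      "card (g0_fixing S z F k) = (if k < card F then 0 else card (g0_fixing (S - F) z' {} (k - card F)))"
      using card_g0_fixing_reduce[OF fF less.prems sub] by metis
    have c: "card (S - F) = ?n - card F" using F fF by (simp add: card_Diff_subset)
    then have "card (S - F) < ?n" using cF n by simp
    from less.hyps[OF this _ z'(1,2)] less.prems(1) c show ?thesis by (simp add: z'(3) h_def)
  qed
  have "g0_atleast S z x k 1 = (\<Union>F\<in>Pow S. g0_fixing S z F k)"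
    using orbit_comp_bounds(1)[OF less.prems(1,2) x] by (fastforce simp: g0_atleast_def g0_fixing_def)
  moreover have "card (\<Union>F\<in>Pow S. g0_fixing S z F k) = (\<Sum>F\<in>Pow S. card (g0_fixing S z F k))"
    using less.prems(1) by (intro card_UN_disjoint) (auto simp: finite_g0_fixing, auto simp: g0_fixing_def)
  ultimately have "(\<Sum>F\<in>Pow S. real (card (g0_fixing S z F k))) = real_of_int (g0_formula ?n k 1)"
    using card_g0_atleast[OF less.prems x, of 1 k] by (simp flip: of_nat_sum)
  also have "\<dots> = (\<Sum>i\<le>?n. real (?n choose i) * h i)"
    unfolding h_def by (rule riordan_number_real_convolution[OF n, symmetric])
  also have "\<dots> = (\<Sum>F\<in>Pow S. h (card F))" by (rule sum_Pow_card[OF less.prems(1), symmetric])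
  finally have eq: "(\<Sum>F\<in>Pow S. real (card (g0_fixing S z F k))) = (\<Sum>F\<in>Pow S. h (card F))" .
  have "finite (Pow S)" "{} \<in> Pow S" using less.prems(1) by auto
  note r = sum.remove[OF this]
  have "(\<Sum>F\<in>Pow S - {{}}. real (card (g0_fixing S z F k))) = (\<Sum>F\<in>Pow S - {{}}. h (card F))"
    by (rule sum.cong[OF refl h])
  with eq show ?case using r[of "\<lambda>F. real (card (g0_fixing S z F k))"] r[of "\<lambda>F. h (card F)"]
    by (simp add: h_def)
qed

lemma zeta_cyclic:
  assumes "1 \<le> n"
  shows "zeta n permutes {1..n}" "cyclic_on (zeta n) {1..n}"
proof -
  let ?c = "[1..<Suc n]"
  have s: "set ?c = {1..n}" by auto
  show "zeta n permutes {1..n}" unfolding zeta_def using cycle_permutes[of ?c] s by simp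
  have "(zeta n ^^ i) 1 = Suc i" if "i < n" for i
  proof -
    have "(zeta n ^^ i) 1 = map (zeta n ^^ i) ?c ! 0" using assms by (simp del: upt_Suc)
    also have "\<dots> = rotate i ?c ! 0" unfolding zeta_def by (subst cyclic_rotation) simp_all
    also have "\<dots> = Suc i" using that by (simp add: nth_rotate del: upt_Suc)
    finally show ?thesis .
  qed note it = this
  have self: "1 \<in> orbit (zeta n) 1"
    by (rule permutes_self_in_orbit[OF _ \<open>zeta n permutes {1..n}\<close>]) simp
  have "{1..n} = orbit (zeta n) 1"
  proof
    show "orbit (zeta n) 1 \<subseteq> {1..n}" using \<open>zeta n permutes {1..n}\<close> assms by (intro permutes_orbit_subset) auto
    show "{1..n} \<subseteq> orbit (zeta n) 1"
    proof
      fix y assume "y \<in> {1..n}"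
      then have "(zeta n ^^ (y - 1)) 1 = y" using it[of "y - 1"] by auto
      then show "y \<in> orbit (zeta n) 1" using funpow_in_orbit[OF self, of "y - 1"] by simp
    qed
  qed
  then show "cyclic_on (zeta n) {1..n}" by (rule cyclic_on_singleI[rotated]) (use assms in simp)
qed

text \<open>
  Inversion preserves cycles and fixed points and turns \<open>inv \<sigma> \<circ> \<zeta>\<close> into the product used in \<open>genus0\<close>.
\<close>

lemma card_derangements_genus0:
  fixes n k :: nat
  assumes "1 \<le> n"
  defines "H \<equiv> {s. derangement n s \<and> has_genus n s 0 \<and> cyc n s = k}"
  shows "finite H" "real (card H) = riordan_number_real n k"
proof -
  let ?S = "{1..n}"
  let ?F = "g0_fixing ?S (zeta n) {} k"
  have inv: "inv s \<in> ?F \<longleftrightarrow> s \<in> H" if s: "s permutes ?S" for s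
  proof -
    have perm: "permutation s" unfolding permutation_permutes using s by blast
    have "orbit (inv s) = orbit s" using orbit_inv_eq[OF perm] by (simp add: fun_eq_iff)
    then have c: "cyc_on ?S (inv s) = cyc n s" by (simp add: cyc_on_def cyc_def)
    have fp: "inv s y = y \<longleftrightarrow> s y = y" for y using permutes_inv_eq[OF s] by metis
    show ?thesis unfolding g0_fixing_def genus0_def H_def derangement_def has_genus_def mem_Collect_eq
      using c s permutes_inv[OF s] by (auto simp: fp cyc_on_def cyc_def)
  qed
  have sub: "H \<subseteq> {s. s permutes ?S}" by (auto simp: H_def derangement_def)
  then show fin: "finite H" by (rule finite_subset) (simp add: finite_permutations)
  have "bij_betw inv H ?F"
  proof (rule bij_betw_byWitness[where f' = inv])
    show "\<forall>a\<in>H. inv (inv a) = a" using sub permutes_inv_inv by blast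
    show "\<forall>a\<in>?F. inv (inv a) = a" by (auto simp: g0_fixing_def genus0_def permutes_inv_inv)
    show "inv ` H \<subseteq> ?F" using inv sub by blast
    show "inv ` ?F \<subseteq> H"
    proof
      fix s assume "s \<in> inv ` ?F"
      then obtain t where t: "t \<in> ?F" "s = inv t" by blast
      then have "t permutes ?S" by (simp add: g0_fixing_def genus0_def)
      then show "s \<in> H" using inv[of s] t by (simp add: permutes_inv permutes_inv_inv)
    qed
  qed
  then have "card H = card ?F" by (rule bij_betw_same_card)
  then show "real (card H) = riordan_number_real n k"
    using card_genus0_derangements[OF _ zeta_cyclic[OF assms(1)], of k] by simp
qed

section \<open>A recursion for ballot sequences with repeated values\<close>

text \<open>
  The common cardinality of all eight families.
\<close>

definition riordan_number :: "nat \<Rightarrow> nat \<Rightarrow> int" where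
  "riordan_number n k = int (n choose k) * int (n - k - 1 choose (k - 1)) - int (n choose (k - 1)) * int (n - k choose k)"

lemma riordan_number_real_eq:
  assumes "1 \<le> k" "2 * k \<le> n"
  shows "riordan_number_real n k = real_of_int (riordan_number n k)"
proof -
  obtain l where l: "k = Suc l" using assms by (cases k) auto
  obtain t where t: "n = 2 * k + t" using assms le_Suc_ex by blast
  define N where "N = (fact n :: real)"
  define m where "m = k + t"
  define L M T :: real where "L = fact l" and "M = fact (m - 1)" and "T = fact t"
  have m: "n - k = m" "n = k + m" "m = Suc (l + t)" using t l by (simp_all add: m_def)
  have pos: "L > 0" "M > 0" "T > 0" by (simp_all add: L_def M_def T_def)
  have b: "real (n choose k) = N / (L * (real l + 1) * (M * real m))"
    "real (n choose (k - 1)) = N / (L * (M * real m * (real m + 1)))"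
    "real (m - 1 choose (k - 1)) = M / (L * T)"
    "real (m choose k) = M * real m / (L * (real l + 1) * T)"
    using m l by (simp_all add: binomial_fact N_def L_def M_def T_def algebra_simps del: binomial_Suc_Suc)
  have f: "fact k = L * (real l + 1)" "fact (m + 1) = M * real m * (real m + 1)"
    using m l by (simp_all add: L_def M_def algebra_simps)
  have "riordan_number_real n k = N / (fact k * fact (m + 1)) * real (m - 1 choose (k - 1))"
    using assms m by (simp add: riordan_number_real_def N_def)
  moreover have "real_of_int (riordan_number n k) = real (n choose k) * real (m - 1 choose (k - 1)) - real (n choose (k - 1)) * real (m choose k)"
    using m by (simp add: riordan_number_def)
  moreover have "N / (fact k * fact (m + 1)) * real (m - 1 choose (k - 1)) =
    real (n choose k) * real (m - 1 choose (k - 1)) - real (n choose (k - 1)) * real (m choose k)"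
  proof -
    have "real m > 0" using m by simp
    then show ?thesis unfolding b f using pos
      by (simp add: divide_simps) (simp add: algebra_simps)
  qed
  ultimately show ?thesis by simp
qed

text \<open>
  For \<open>m \<le> Suc v\<close> this counts the sequences \<open>c\<^sub>1 \<le> \<dots> \<le> c\<^sub>m \<le> v\<close> with \<open>c\<^sub>t \<ge> t\<close> and \<open>k\<close> distinct values, each of which
  occurs at least twice; \<open>ballot_top_number\<close> counts those bounded by \<open>Suc v\<close> that attain this
  bound.
\<close>

definition ballot_number :: "nat \<Rightarrow> nat \<Rightarrow> nat \<Rightarrow> int" where
  "ballot_number m v k = (if m = 0 then of_bool (k = 0) else if k = 0 \<or> m < 2 * k then 0 else
     int (v choose k) * int (m - k - 1 choose (k - 1)) - int (v choose (k - 1)) * int (m - k choose k))"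

definition ballot_top_number :: "nat \<Rightarrow> nat \<Rightarrow> nat \<Rightarrow> int" where
  "ballot_top_number m v k = (if k = 0 \<or> m < 2 * k then 0 else
     int (v choose (k - 1)) * int (m - k - 1 choose (k - 1)) - ibinom v (int k - 2) * int (m - k choose k))"

text \<open>
  The boundary case: \<open>c\<^sub>m \<ge> m\<close> cannot hold if all values are below \<open>m\<close>.
\<close>

lemma ballot_number_diag: "ballot_number (Suc m) m k = 0"
proof (cases "k = 0 \<or> Suc m < 2 * k")
  case False
  then obtain l where l: "k = Suc l" by (cases k) auto
  obtain t where t: "Suc m = 2 * k + t" using False le_Suc_ex by (metis not_less)
  have "m = k + l + t" "Suc m - k - 1 = l + t" "Suc m - k = k + t" using t l by auto
  moreover have "int ((k + l + t choose k) * (l + t choose l)) = int ((k + l + t choose l) * (k + t choose k))"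
    using trinomial_swap12[of k l t] by (rule arg_cong)
  ultimately show ?thesis using False l by (simp add: ballot_number_def del: binomial_Suc_Suc)
qed (auto simp: ballot_number_def)

lemma ballot_number_rec: "1 \<le> m \<Longrightarrow> ballot_number m (Suc v) k = ballot_number m v k + ballot_top_number m v k"
proof (cases "k \<le> 1")
  case False
  then obtain l where l: "k = Suc (Suc l)" by (metis Suc_le_D not_less_eq_eq One_nat_def)
  have i: "int k - 2 = int l" using l by simp
  assume "1 \<le> m"
  then show ?thesis unfolding ballot_number_def ballot_top_number_def i using l by (simp add: algebra_simps)
qed (auto simp: ballot_number_def ballot_top_number_def le_Suc_eq)

lemma ballot_top_number_rec:
  assumes "1 \<le> m"
  shows "ballot_top_number m v k = ballot_top_number (m - 1) v k + (if 2 \<le> m \<and> 1 \<le> k then ballot_number (m - 2) v (k - 1) else 0)"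
proof (cases "k \<le> 1 \<or> m < 2 * k")
  case False
  then obtain l where l: "k = Suc (Suc l)" by (metis Suc_le_D not_less_eq_eq One_nat_def)
  have i: "int k - 2 = int l" using l by simp
  obtain t where t: "m = 2 * k + t" using False le_Suc_ex by (metis not_less)
  show ?thesis
  proof (cases t)
    case 0
    then show ?thesis unfolding ballot_top_number_def ballot_number_def i using l t by simp
  next
    case (Suc t')
    have "m - 1 - k - 1 = l + Suc t'" "m - 2 - (k - 1) - 1 = l + Suc t'" "m - k - 1 = Suc (l + Suc t')"
      "m - 1 - k = Suc (l + Suc t')" "m - k = Suc (Suc (l + Suc t'))" "m - 2 - (k - 1) = Suc (l + Suc t')"
      using t l Suc by simp_all
    moreover have "\<not> m < 2 * k" "\<not> m - 1 < 2 * k" "\<not> m - 2 < 2 * (k - 1)" "m - 2 \<noteq> 0" "2 \<le> m"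
      using t l Suc by simp_all
    ultimately show ?thesis unfolding ballot_top_number_def ballot_number_def i using l by (simp add: algebra_simps)
  qed
next
  case True
  then consider "k = 0" | "k = 1" | "m < 2 * k" by linarith
  then show ?thesis
    by cases (use assms in \<open>auto simp: ballot_top_number_def ballot_number_def\<close>)
qed

text \<open>
  \<open>Q m v k\<close> stands for the sequences described at \<open>ballot_number\<close> and \<open>E m v k\<close> for those with last value
  \<open>Suc v\<close>. If that value occurs three times or more, the last entry can be dropped; if it occurs
  exactly twice, both copies are dropped together with one distinct value.
\<close>

lemma ballot_recursion:
  fixes Q E :: "nat \<Rightarrow> nat \<Rightarrow> nat \<Rightarrow> nat"
  assumes Q0: "\<And>v k. Q 0 v k = of_bool (k = 0)"
    and Qlt: "\<And>m v k. v < m \<Longrightarrow> Q m v k = 0"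
    and QS: "\<And>m v k. 1 \<le> m \<Longrightarrow> Q m (Suc v) k = Q m v k + E m v k"
    and E0: "\<And>v k. E 0 v k = 0"
    and ES: "\<And>m v k. 1 \<le> m \<Longrightarrow> m \<le> Suc v \<Longrightarrow>
      E m v k = E (m - 1) v k + (if 2 \<le> m \<and> 1 \<le> k then Q (m - 2) v (k - 1) else 0)"
    and "m \<le> Suc v"
  shows "int (Q m v k) = ballot_number m v k" "m \<le> Suc v \<Longrightarrow> int (E m v k) = ballot_top_number m v k"
proof -
  have "(\<forall>v k. m \<le> Suc v \<longrightarrow> int (Q m v k) = ballot_number m v k) \<and> (\<forall>v k. m \<le> Suc v \<longrightarrow> int (E m v k) = ballot_top_number m v k)" for m
  proof (induction m rule: less_induct)
    case (less m)
    show ?case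
    proof (cases "m = 0")
      case True
      then show ?thesis by (auto simp: Q0 E0 ballot_number_def ballot_top_number_def)
    next
      case False
      then have m: "1 \<le> m" by simp
      have E: "int (E m v k) = ballot_top_number m v k" if "m \<le> Suc v" for v k
        using ES[OF m that, of k] ballot_top_number_rec[OF m, of v k] less[of "m - 1"] less[of "m - 2"] m that by auto
      have "int (Q m (m - 1 + d) k) = ballot_number m (m - 1 + d) k" for d k
      proof (induction d)
        case 0
        show ?case using Qlt[of "m - 1" m k] ballot_number_diag[of "m - 1" k] m by simp
      next
        case (Suc d)
        then show ?case using QS[OF m, of "m - 1 + d" k] ballot_number_rec[OF m, of "m - 1 + d" k] E[of "m - 1 + d" k] by simp
      qed
      then have "int (Q m v k) = ballot_number m v k" if "m \<le> Suc v" for v k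
        using that le_Suc_ex[of "m - 1" v] by fastforce
      with E show ?thesis by blast
    qed
  qed
  then show "int (Q m v k) = ballot_number m v k" "m \<le> Suc v \<Longrightarrow> int (E m v k) = ballot_top_number m v k" using assms(6) by blast+
qed

lemma ballot_number_riordan_number: "1 \<le> k \<Longrightarrow> 2 * k \<le> n \<Longrightarrow> ballot_number n n k = riordan_number n k"
  by (simp add: ballot_number_def riordan_number_def)

section \<open>Dyck paths\<close>

definition height :: "step list \<Rightarrow> int" where
  "height p = int (count_list p Up) - int (count_list p Down)"

lemma height_simps [simp]: "height [] = 0" "height (p @ [Up]) = height p + 1" "height (p @ [Down]) = height p - 1" "height (p @ [Horiz]) = height p"
  by (simp_all add: height_def)

lemma position_eq: "position p i = (int (length (take i p)), height (take i p))"
proof -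
  have "(\<Sum>s\<leftarrow>q. fst (step_vec s)) = int (length q)" "(\<Sum>s\<leftarrow>q. snd (step_vec s)) = height q" for q
  proof (induct q rule: rev_induct)
    case (snoc s q)
    { case 1 show ?case using snoc by (cases s) simp_all }
    { case 2 show ?case using snoc by (cases s) simp_all }
  qed simp_all
  then show ?thesis by (simp add: position_def)
qed

lemma weakly_above_snoc:
  "weakly_above_axis (p @ [s]) \<longleftrightarrow> weakly_above_axis p \<and> 0 \<le> height (p @ [s])"
  unfolding weakly_above_axis_def position_eq by (auto simp: le_Suc_eq)

lemma weakly_above_Nil [simp]: "weakly_above_axis []"
  by (simp add: weakly_above_axis_def position_eq)

lemma weakly_above_height: "weakly_above_axis p \<Longrightarrow> 0 \<le> height p"
  unfolding weakly_above_axis_def position_eq by auto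

lemma num_peaks_Nil [simp]: "num_peaks [] = 0"
  by (simp add: num_peaks_def)

lemma num_peaks_snoc:
  "num_peaks (p @ [s]) = num_peaks p + (if p \<noteq> [] \<and> last p = Up \<and> s = Down then 1 else 0)"
proof -
  let ?P = "{i. Suc i < length p \<and> p ! i = Up \<and> p ! Suc i = Down}"
  have fin: "finite ?P" by (rule finite_subset[of _ "{..<length p}"]) auto
  have "{i. Suc i < length (p @ [s]) \<and> (p @ [s]) ! i = Up \<and> (p @ [s]) ! Suc i = Down} =
    ?P \<union> (if p \<noteq> [] \<and> last p = Up \<and> s = Down then {length p - 1} else {})"
  proof (cases p rule: rev_cases)
    case (snoc q t)
    then show ?thesis by (auto simp: nth_append less_Suc_eq)
  qed simp
  then show ?thesis unfolding num_peaks_def using fin by auto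
qed

lemma has_singleton_descent_alt:
  "has_singleton_descent p \<longleftrightarrow> (\<exists>i<length p. p ! i = Down \<and>
     (0 < i \<longrightarrow> p ! (i - 1) \<noteq> Down) \<and> (Suc i < length p \<longrightarrow> p ! Suc i \<noteq> Down))"
  unfolding has_singleton_descent_def maximal_run_def by (auto simp: Suc_le_eq)

lemma singleton_descent_Up: "has_singleton_descent (p @ [Up]) = has_singleton_descent p"
proof -
  have "((p @ [Up]) ! i = Down \<and> (0 < i \<longrightarrow> (p @ [Up]) ! (i - 1) \<noteq> Down) \<and> (Suc i < length (p @ [Up]) \<longrightarrow> (p @ [Up]) ! Suc i \<noteq> Down))
    = (p ! i = Down \<and> (0 < i \<longrightarrow> p ! (i - 1) \<noteq> Down) \<and> (Suc i < length p \<longrightarrow> p ! Suc i \<noteq> Down))"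
    if "i < length p" for i using that by (auto simp: nth_append)
  then show ?thesis unfolding has_singleton_descent_alt by (auto simp: less_Suc_eq)
qed

lemma singleton_descent_UD: "has_singleton_descent (p @ [Up, Down])"
  unfolding has_singleton_descent_alt by (intro exI[of _ "Suc (length p)"]) (simp add: nth_append)

lemma singleton_descent_DDD:
  "has_singleton_descent (p @ [Down, Down, Down]) = has_singleton_descent (p @ [Down, Down])"
proof -
  let ?S = "\<lambda>q i. q ! i = Down \<and> (0 < i \<longrightarrow> q ! (i - 1) \<noteq> Down) \<and> (Suc i < length q \<longrightarrow> q ! Suc i \<noteq> Down)"
  let ?p = "p @ [Down, Down, Down]" and ?q = "p @ [Down, Down]"
  have "?S ?p i = ?S ?q i" if "i < length p" for i using that by (auto simp: nth_append)
  moreover have "\<not> ?S ?p i" if "length p \<le> i" "i < length ?p" for i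
  proof -
    from that consider "i = length p" | "i = length p + 1" | "i = length p + 2" by fastforce
    then show ?thesis by cases (simp_all add: nth_append)
  qed
  moreover have "\<not> ?S ?q i" if "length p \<le> i" "i < length ?q" for i
  proof -
    from that consider "i = length p" | "i = length p + 1" by fastforce
    then show ?thesis by cases (simp_all add: nth_append)
  qed
  ultimately show ?thesis unfolding has_singleton_descent_alt
    by (metis (no_types, lifting) not_le length_append trans_less_add1)
qed

lemma singleton_descent_UDD:
  "has_singleton_descent (p @ [Up, Down, Down]) = has_singleton_descent p"
proof -
  let ?S = "\<lambda>q i. q ! i = Down \<and> (0 < i \<longrightarrow> q ! (i - 1) \<noteq> Down) \<and> (Suc i < length q \<longrightarrow> q ! Suc i \<noteq> Down)"
  let ?p = "p @ [Up, Down, Down]"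
  have "?S ?p i = ?S p i" if "i < length p" for i using that by (auto simp: nth_append)
  moreover have "\<not> ?S ?p i" if "length p \<le> i" "i < length ?p" for i
  proof -
    from that consider "i = length p" | "i = length p + 1" | "i = length p + 2" by fastforce
    then show ?thesis by cases (simp_all add: nth_append)
  qed
  ultimately show ?thesis unfolding has_singleton_descent_alt
    by (metis (no_types, lifting) not_le length_append trans_less_add1)
qed

text \<open>
  Prefixes of Dyck paths are admitted, since these are what remains when final steps are removed.
\<close>

definition descent_words :: "nat \<Rightarrow> nat \<Rightarrow> nat \<Rightarrow> step list set" where
  "descent_words m v k = {p. set p \<subseteq> {Up, Down} \<and> count_list p Up = v \<and> count_list p Down = m \<and>
     weakly_above_axis p \<and> num_peaks p = k \<and> \<not> has_singleton_descent p}"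

definition descent_words_down :: "nat \<Rightarrow> nat \<Rightarrow> nat \<Rightarrow> step list set" where
  "descent_words_down m v k = {p \<in> descent_words m v k. p \<noteq> [] \<and> last p = Down}"

lemma length_updown: "set p \<subseteq> {Up, Down} \<Longrightarrow> length p = count_list p Up + count_list p Down"
  by (induct p) auto

lemma finite_descent_words: "finite (descent_words m v k)" "finite (descent_words_down m v k)"
proof -
  have "descent_words m v k \<subseteq> {p. set p \<subseteq> {Up, Down} \<and> length p = v + m}"
    by (auto simp: descent_words_def length_updown)
  then show "finite (descent_words m v k)"
    by (rule finite_subset) (simp add: finite_lists_length_eq)
  then show "finite (descent_words_down m v k)" by (simp add: descent_words_down_def)
qed

lemma no_Up_no_peak: "set p \<subseteq> {Up} \<Longrightarrow> num_peaks p = 0 \<and> \<not> has_singleton_descent p \<and> weakly_above_axis p"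
proof (induct p rule: rev_induct)
  case Nil
  then show ?case by (simp add: has_singleton_descent_alt)
next
  case (snoc s p)
  then have "s = Up" by simp
  then show ?case using snoc weakly_above_height[of p] by (simp add: num_peaks_snoc weakly_above_snoc singleton_descent_Up)
qed

lemma descent_words_0: "descent_words 0 v k = (if k = 0 then {replicate v Up} else {})"
proof -
  have uniq: "p = replicate v Up" if "set p \<subseteq> {Up, Down}" "count_list p Down = 0" "count_list p Up = v" for p
  proof -
    have "set p \<subseteq> {Up}" using that by (auto simp: count_list_0_iff)
    moreover have "length p = v" using length_updown[OF that(1)] that by simp
    ultimately show ?thesis by (metis insertE singleton_iff subsetD replicate_eqI empty_iff)
  qed
  have "count_list (replicate v Up) Up = v" "count_list (replicate v Up) Down = 0"
    by (induct v) auto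
  moreover have sub: "set (replicate v Up) \<subseteq> {Up}" by auto
  ultimately have "replicate v Up \<in> descent_words 0 v k \<longleftrightarrow> k = 0"
    using no_Up_no_peak[of "replicate v Up", OF sub] sub by (auto simp: descent_words_def)
  moreover have "p \<notin> descent_words 0 v k" if "p \<noteq> replicate v Up" for p
    using uniq[of p] that by (auto simp: descent_words_def)
  ultimately show ?thesis by (intro set_eqI) (metis empty_iff singleton_iff)
qed

lemma descent_words_lt: "v < m \<Longrightarrow> descent_words m v k = {}"
  using weakly_above_height by (fastforce simp: descent_words_def height_def)

lemma card_descent_words_Suc:
  assumes "1 \<le> m"
  shows "card (descent_words m (Suc v) k) = card (descent_words m v k) + card (descent_words_down m (Suc v) k)"
proof -
  have "descent_words m (Suc v) k = (\<lambda>p. p @ [Up]) ` descent_words m v k \<union> descent_words_down m (Suc v) k" (is "?L = ?R")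
  proof
    show "?L \<subseteq> ?R"
    proof
      fix p assume p: "p \<in> ?L"
      have "p \<noteq> []" using p assms by (auto simp: descent_words_def)
      then obtain q s where q: "p = q @ [s]" by (metis rev_exhaust)
      have "s = Up \<or> s = Down" using p q by (auto simp: descent_words_def)
      then show "p \<in> ?R"
      proof
        assume "s = Up"
        then have "q \<in> descent_words m v k"
          using p q by (auto simp: descent_words_def weakly_above_snoc num_peaks_snoc singleton_descent_Up)
        then show ?thesis using q \<open>s = Up\<close> by auto
      next
        assume "s = Down"
        then show ?thesis using p q by (auto simp: descent_words_down_def)
      qed
    qed
    show "?R \<subseteq> ?L"
      using weakly_above_height by (fastforce simp: descent_words_down_def descent_words_def weakly_above_snoc num_peaks_snoc singleton_descent_Up)
  qed
  moreover have "(\<lambda>p. p @ [Up]) ` descent_words m v k \<inter> descent_words_down m (Suc v) k = {}"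
    by (auto simp: descent_words_down_def)
  moreover have "card ((\<lambda>p. p @ [Up]) ` descent_words m v k) = card (descent_words m v k)"
    by (rule card_image) (simp add: inj_on_def)
  ultimately show ?thesis by (simp add: card_Un_disjoint finite_descent_words)
qed

lemma descent_words_down_end:
  assumes "p \<in> descent_words_down m v k"
  obtains r where "p = r @ [Down, Down]" "r \<noteq> []"
proof -
  have p: "p \<noteq> []" "last p = Down" "p \<in> descent_words m v k" using assms by (simp_all add: descent_words_down_def)
  then obtain q where q: "p = q @ [Down]" by (metis append_butlast_last_id)
  have "q \<noteq> []" using p(3) q by (auto simp: descent_words_def weakly_above_snoc)
  then obtain r s where r: "q = r @ [s]" by (metis rev_exhaust)
  have "s \<noteq> Up" using p(3) q r singleton_descent_UD[of r] by (auto simp: descent_words_def)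
  then have s: "s = Down" using p(3) q r by (auto simp: descent_words_def)
  have "0 \<le> height p" using p(3) weakly_above_height by (simp add: descent_words_def)
  then have "r \<noteq> []" using q r s by (auto simp: height_def)
  then show thesis using that q r s by simp
qed

text \<open>
  The final descent has length at least two. It is shortened by one step if it is longer than that,
  and otherwise removed together with the up-step before it. In terms of the sequence that lists the
  number of up-steps before each down-step, this drops one or two copies of the last value.
\<close>

lemma card_descent_words_down:
  assumes "1 \<le> m" "m \<le> Suc v"
  shows "card (descent_words_down m (Suc v) k) = card (descent_words_down (m - 1) (Suc v) k) +
    (if 2 \<le> m \<and> 1 \<le> k then card (descent_words (m - 2) v (k - 1)) else 0)"
proof -
  let ?A = "(\<lambda>p. p @ [Down]) ` descent_words_down (m - 1) (Suc v) k"
  let ?B = "if 2 \<le> m \<and> 1 \<le> k then (\<lambda>p. p @ [Up, Down, Down]) ` descent_words (m - 2) v (k - 1) else {}"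
  have eq: "descent_words_down m (Suc v) k = ?A \<union> ?B"
  proof
    show "descent_words_down m (Suc v) k \<subseteq> ?A \<union> ?B"
    proof
      fix p assume p: "p \<in> descent_words_down m (Suc v) k"
      then obtain r where r: "p = r @ [Down, Down]" "r \<noteq> []" by (rule descent_words_down_end)
      have pd: "p \<in> descent_words m (Suc v) k" using p by (simp add: descent_words_down_def)
      from r(2) obtain t u where t: "r = t @ [u]" by (metis rev_exhaust)
      have "u = Up \<or> u = Down" using pd r t by (auto simp: descent_words_def)
      then show "p \<in> ?A \<union> ?B"
      proof
        assume u: "u = Down"
        have "r @ [Down] \<in> descent_words_down (m - 1) (Suc v) k"
          using pd unfolding r t u
          using singleton_descent_DDD[of t] weakly_above_snoc[of "t @ [Down, Down]" Down] num_peaks_snoc[of "t @ [Down, Down]" Down]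
          by (auto simp: descent_words_def descent_words_down_def)
        then show ?thesis using r by auto
      next
        assume u: "u = Up"
        have "t \<in> descent_words (m - 2) v (k - 1) \<and> 2 \<le> m \<and> 1 \<le> k"
          using pd unfolding r t u
          using singleton_descent_UDD[of t] weakly_above_snoc[of "t @ [Up, Down]" Down]
            weakly_above_snoc[of "t @ [Up]" Down] weakly_above_snoc[of "t" Up]
            num_peaks_snoc[of "t @ [Up, Down]" Down] num_peaks_snoc[of "t @ [Up]" Down] num_peaks_snoc[of "t" Up]
          by (auto simp: descent_words_def)
        then show ?thesis using r t u by auto
      qed
    qed
    show "?A \<union> ?B \<subseteq> descent_words_down m (Suc v) k"
    proof
      fix p assume "p \<in> ?A \<union> ?B"
      then consider (A) q where "p = q @ [Down]" "q \<in> descent_words_down (m - 1) (Suc v) k"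
        | (B) q where "p = q @ [Up, Down, Down]" "q \<in> descent_words (m - 2) v (k - 1)" "2 \<le> m" "1 \<le> k"
        by (auto split: if_splits)
      then show "p \<in> descent_words_down m (Suc v) k"
      proof cases
        case A
        from A(2) obtain t where t: "q = t @ [Down, Down]" by (rule descent_words_down_end)
        have "0 \<le> height (q @ [Down])" using A(2) assms by (simp add: descent_words_down_def descent_words_def height_def)
        then show ?thesis using A(2) assms(1) unfolding A(1) t
          using singleton_descent_DDD[of t] weakly_above_snoc[of "t @ [Down, Down]" Down] num_peaks_snoc[of "t @ [Down, Down]" Down]
          by (auto simp: descent_words_def descent_words_down_def)
      next
        case B
        have "0 \<le> height q" using B weakly_above_height by (auto simp: descent_words_def)
        moreover have "0 \<le> height (q @ [Up, Down, Down])" using B assms by (simp add: descent_words_def height_def)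
        ultimately show ?thesis using B(2-4) unfolding B(1)
          using singleton_descent_UDD[of q] weakly_above_snoc[of "q @ [Up, Down]" Down]
            weakly_above_snoc[of "q @ [Up]" Down] weakly_above_snoc[of "q" Up] height_simps(2,3)[of q] height_simps(3)[of "q @ [Up]"]
            num_peaks_snoc[of "q @ [Up, Down]" Down] num_peaks_snoc[of "q @ [Up]" Down] num_peaks_snoc[of "q" Up]
          by (auto simp: descent_words_def descent_words_down_def)
      qed
    qed
  qed
  have dn: "last (butlast (butlast p)) = Down" if pA: "p \<in> ?A" for p
  proof -
    obtain q where q: "p = q @ [Down]" "q \<in> descent_words_down (m - 1) (Suc v) k" using pA by blast
    from q(2) obtain r where r: "q = r @ [Down, Down]" by (rule descent_words_down_end)
    then show ?thesis using q r by (simp add: butlast_append)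
  qed
  have up: "last (butlast (butlast p)) = Up" if "p \<in> ?B" for p
    using that by (auto simp: butlast_append split: if_splits)
  have "?A \<inter> ?B = {}"
  proof (rule equals0I)
    fix p assume "p \<in> ?A \<inter> ?B"
    then show False using dn[OF IntD1] up[OF IntD2] by (metis step.distinct(3))
  qed
  moreover have "card ?A = card (descent_words_down (m - 1) (Suc v) k)"
    by (rule card_image) (simp add: inj_on_def)
  moreover have "card ?B = (if 2 \<le> m \<and> 1 \<le> k then card (descent_words (m - 2) v (k - 1)) else 0)"
    by (auto intro!: card_image simp: inj_on_def)
  moreover have "finite ?A" "finite ?B" by (auto simp: finite_descent_words)
  ultimately show ?thesis unfolding eq by (simp only: card_Un_disjoint)
qed

lemma card_descent_words:
  assumes "1 \<le> k" "2 * k \<le> n"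
  shows "int (card (descent_words n n k)) = riordan_number n k"
proof -
  have "int (card (descent_words n n k)) = ballot_number n n k"
  proof (rule ballot_recursion(1)[where Q = "\<lambda>m v k. card (descent_words m v k)" and E = "\<lambda>m v k. card (descent_words_down m (Suc v) k)"])
    show "card (descent_words_down 0 (Suc v) k) = 0" for v k
      by (auto simp: descent_words_down_def descent_words_0)
    show "card (descent_words m (Suc v) k) = card (descent_words m v k) + card (descent_words_down m (Suc v) k)"
      if "1 \<le> m" for m v k using that by (rule card_descent_words_Suc)
    show "card (descent_words_down m (Suc v) k) = card (descent_words_down (m - 1) (Suc v) k) +
        (if 2 \<le> m \<and> 1 \<le> k then card (descent_words (m - 2) v (k - 1)) else 0)"
      if "1 \<le> m" "m \<le> Suc v" for m v k using that by (rule card_descent_words_down)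
  qed (simp_all add: descent_words_0 descent_words_lt)
  then show ?thesis using ballot_number_riordan_number[OF assms] by simp
qed

lemma dyck_path_alt:
  "dyck_path n p \<longleftrightarrow> set p \<subseteq> {Up, Down} \<and> count_list p Up = n \<and> count_list p Down = n \<and> weakly_above_axis p"
  unfolding dyck_path_def position_eq using length_updown[of p] by (auto simp: height_def)

lemma dyck_no_singleton_descent:
  "{p. dyck_path n p \<and> num_peaks p = k \<and> \<not> has_singleton_descent p} = descent_words n n k"
  by (auto simp: dyck_path_alt descent_words_def)

fun flip :: "step \<Rightarrow> step" where
  "flip Up = Down" | "flip Down = Up" | "flip Horiz = Horiz"

definition mirror :: "step list \<Rightarrow> step list" where
  "mirror p = rev (map flip p)"

lemma flip_flip [simp]: "flip (flip s) = s"
  by (cases s) simp_all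

lemma flip_eq_iff [simp]: "flip s = Up \<longleftrightarrow> s = Down" "flip s = Down \<longleftrightarrow> s = Up"
  by (cases s; simp)+

lemma mirror_mirror [simp]: "mirror (mirror p) = p"
  by (simp add: mirror_def rev_map comp_def)

lemma length_mirror [simp]: "length (mirror p) = length p"
  by (simp add: mirror_def)

lemma nth_mirror: "i < length p \<Longrightarrow> mirror p ! i = flip (p ! (length p - Suc i))"
  by (simp add: mirror_def rev_nth)

lemma count_mirror [simp]:
  "count_list (mirror p) Up = count_list p Down" "count_list (mirror p) Down = count_list p Up"
  by (induct p) (auto simp: mirror_def)

lemma set_mirror: "set (mirror p) = flip ` set p"
  by (simp add: mirror_def)

lemma weakly_above_mirror:
  assumes "weakly_above_axis p" "height p = 0"
  shows "weakly_above_axis (mirror p)"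
  unfolding weakly_above_axis_def position_eq
proof (intro allI impI)
  fix i assume "i \<le> length (mirror p)"
  let ?j = "length p - i"
  have "height (mirror q) = - height q" for q by (simp add: height_def)
  moreover have "take i (mirror p) = mirror (drop ?j p)"
    by (simp add: mirror_def take_rev drop_map)
  moreover have "height (take ?j p) + height (drop ?j p) = height (take ?j p @ drop ?j p)"
    unfolding height_def count_list_append by simp
  moreover have "0 \<le> height (take ?j p)"
    using assms(1) unfolding weakly_above_axis_def position_eq by simp
  ultimately show "0 \<le> snd (int (length (take i (mirror p))), height (take i (mirror p)))"
    using assms(2) by simp
qed

lemma dyck_path_mirror: "dyck_path n p \<Longrightarrow> dyck_path n (mirror p)"
  unfolding dyck_path_alt using weakly_above_mirror[of p] by (auto simp: set_mirror height_def)

lemma num_peaks_mirror: "num_peaks (mirror p) = num_peaks p"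
proof -
  have le: "num_peaks p \<le> num_peaks (mirror p)" for p
    unfolding num_peaks_def
  proof (rule card_inj_on_le[where f = "\<lambda>i. length p - Suc (Suc i)"])
    show "inj_on (\<lambda>i. length p - Suc (Suc i)) {i. Suc i < length p \<and> p ! i = Up \<and> p ! Suc i = Down}"
      by (auto simp: inj_on_def)
    show "(\<lambda>i. length p - Suc (Suc i)) ` {i. Suc i < length p \<and> p ! i = Up \<and> p ! Suc i = Down}
      \<subseteq> {i. Suc i < length (mirror p) \<and> mirror p ! i = Up \<and> mirror p ! Suc i = Down}"
      by (auto simp: nth_mirror Suc_diff_Suc)
    show "finite {i. Suc i < length (mirror p) \<and> mirror p ! i = Up \<and> mirror p ! Suc i = Down}"
      by (rule finite_subset[of _ "{..<length (mirror p)}"]) auto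
  qed
  from le[of p] le[of "mirror p"] show ?thesis by simp
qed

lemma has_singleton_ascent_alt:
  "has_singleton_ascent p \<longleftrightarrow> (\<exists>i<length p. p ! i = Up \<and>
     (0 < i \<longrightarrow> p ! (i - 1) \<noteq> Up) \<and> (Suc i < length p \<longrightarrow> p ! Suc i \<noteq> Up))"
  unfolding has_singleton_ascent_def maximal_run_def by (auto simp: Suc_le_eq)

lemma singleton_mirror: "has_singleton_ascent (mirror p) \<longleftrightarrow> has_singleton_descent p"
proof -
  have iso: "(mirror p ! (length p - Suc i) = Up \<and> (0 < length p - Suc i \<longrightarrow> mirror p ! (length p - Suc i - 1) \<noteq> Up) \<and>
      (Suc (length p - Suc i) < length p \<longrightarrow> mirror p ! Suc (length p - Suc i) \<noteq> Up))
    \<longleftrightarrow> (p ! i = Down \<and> (0 < i \<longrightarrow> p ! (i - 1) \<noteq> Down) \<and> (Suc i < length p \<longrightarrow> p ! Suc i \<noteq> Down))"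
    if "i < length p" for i
  proof -
    have "mirror p ! (length p - Suc i) = Up \<longleftrightarrow> p ! i = Down" using that by (simp add: nth_mirror Suc_diff_Suc)
    moreover have "(0 < length p - Suc i \<longrightarrow> mirror p ! (length p - Suc i - 1) \<noteq> Up) \<longleftrightarrow> (Suc i < length p \<longrightarrow> p ! Suc i \<noteq> Down)"
      using that by (auto simp: nth_mirror Suc_diff_Suc)
    moreover have "(Suc (length p - Suc i) < length p \<longrightarrow> mirror p ! Suc (length p - Suc i) \<noteq> Up) \<longleftrightarrow> (0 < i \<longrightarrow> p ! (i - 1) \<noteq> Down)"
      using that by (auto simp: nth_mirror Suc_diff_Suc)
    ultimately show ?thesis by (simp only:) blast
  qed
  show ?thesis
  proof
    assume "has_singleton_ascent (mirror p)"
    then obtain j where j: "j < length p" "mirror p ! j = Up" "0 < j \<longrightarrow> mirror p ! (j - 1) \<noteq> Up"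
      "Suc j < length p \<longrightarrow> mirror p ! Suc j \<noteq> Up"
      unfolding has_singleton_ascent_alt by auto
    moreover have "j = length p - Suc (length p - Suc j)" "length p - Suc j < length p" using j by auto
    ultimately show "has_singleton_descent p"
      unfolding has_singleton_descent_alt using iso[of "length p - Suc j"] by metis
  next
    assume "has_singleton_descent p"
    then obtain i where i: "i < length p" "p ! i = Down" "0 < i \<longrightarrow> p ! (i - 1) \<noteq> Down"
      "Suc i < length p \<longrightarrow> p ! Suc i \<noteq> Down"
      unfolding has_singleton_descent_alt by auto
    have "length p - Suc i < length p" using i by auto
    then show "has_singleton_ascent (mirror p)"
      unfolding has_singleton_ascent_alt length_mirror using iso[of i] i by metis
  qed
qed

lemma bij_mirror_dyck:
  "bij_betw mirror {p. dyck_path n p \<and> num_peaks p = k \<and> \<not> has_singleton_ascent p}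
     {p. dyck_path n p \<and> num_peaks p = k \<and> \<not> has_singleton_descent p}"
proof (rule bij_betw_byWitness[where f' = mirror])
  show "mirror ` {p. dyck_path n p \<and> num_peaks p = k \<and> \<not> has_singleton_ascent p}
    \<subseteq> {p. dyck_path n p \<and> num_peaks p = k \<and> \<not> has_singleton_descent p}"
  proof clarify
    fix p assume p: "dyck_path n p" "\<not> has_singleton_ascent p"
    have "\<not> has_singleton_descent (mirror p)" using singleton_mirror[of "mirror p"] p by simp
    then show "dyck_path n (mirror p) \<and> num_peaks (mirror p) = num_peaks p \<and> \<not> has_singleton_descent (mirror p)"
      using p dyck_path_mirror num_peaks_mirror by blast
  qed
qed (auto simp: dyck_path_mirror num_peaks_mirror singleton_mirror)

section \<open>Riordan paths\<close>

definition riordan_prefix :: "step list \<Rightarrow> bool" where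
  "riordan_prefix p \<longleftrightarrow> weakly_above_axis p \<and> \<not> (\<exists>i<length p. p ! i = Horiz \<and> snd (position p i) = 0)"

text \<open>
  All Motzkin prefixes without horizontal steps on the axis, sorted by their numbers of up-,
  horizontal and down-steps.
\<close>

definition rprefixes :: "nat \<Rightarrow> nat \<Rightarrow> nat \<Rightarrow> step list set" where
  "rprefixes u s d = {p. riordan_prefix p \<and> count_list p Up = u \<and> count_list p Horiz = s \<and> count_list p Down = d}"

lemma riordan_prefix_snoc:
  "riordan_prefix (p @ [s]) \<longleftrightarrow> riordan_prefix p \<and> 0 \<le> height (p @ [s]) \<and> (s = Horiz \<longrightarrow> height p \<noteq> 0)"
proof -
  have "(\<exists>i<length (p @ [s]). (p @ [s]) ! i = Horiz \<and> height (take i (p @ [s])) = 0) \<longleftrightarrow>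
    (\<exists>i<length p. p ! i = Horiz \<and> height (take i p) = 0) \<or> (s = Horiz \<and> height p = 0)"
    by (simp add: Ex_less_Suc nth_append disj_commute cong: conj_cong)
  then show ?thesis unfolding riordan_prefix_def weakly_above_snoc position_eq snd_conv by blast
qed

lemma length_steps: "length p = count_list p Up + count_list p Horiz + count_list p Down"
proof (induct p)
  case (Cons s p)
  then show ?case by (cases s) simp_all
qed simp

lemma finite_rprefixes: "finite (rprefixes u s d)"
proof -
  have "rprefixes u s d \<subseteq> {p. set p \<subseteq> {Up, Horiz, Down} \<and> length p = u + s + d}"
  proof
    fix p assume "p \<in> rprefixes u s d"
    then have "length p = u + s + d" using length_steps[of p] by (simp add: rprefixes_def)
    moreover have "t \<in> {Up, Horiz, Down}" for t by (cases t) simp_all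
    ultimately show "p \<in> {p. set p \<subseteq> {Up, Horiz, Down} \<and> length p = u + s + d}" by blast
  qed
  then show ?thesis by (rule finite_subset) (simp add: finite_lists_length_eq)
qed

lemma rprefixes_lt: "u < d \<Longrightarrow> rprefixes u s d = {}"
  by (auto simp: rprefixes_def riordan_prefix_def height_def dest!: weakly_above_height)

lemma rprefixes_Nil: "rprefixes 0 0 0 = {[]}"
proof -
  have "p = []" if "p \<in> rprefixes 0 0 0" for p using that length_steps[of p] by (simp add: rprefixes_def)
  moreover have "[] \<in> rprefixes 0 0 0" by (simp add: rprefixes_def riordan_prefix_def)
  ultimately show ?thesis by blast
qed

lemma card_rprefixes_rec:
  assumes "0 < u + s + d" "d \<le> u"
  shows "card (rprefixes u s d) = (if 0 < u then card (rprefixes (u - 1) s d) else 0)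
    + (if 0 < s \<and> d < u then card (rprefixes u (s - 1) d) else 0)
    + (if 0 < d then card (rprefixes u s (d - 1)) else 0)"
proof -
  let ?U = "if 0 < u then (\<lambda>p. p @ [Up]) ` rprefixes (u - 1) s d else {}"
  let ?H = "if 0 < s \<and> d < u then (\<lambda>p. p @ [Horiz]) ` rprefixes u (s - 1) d else {}"
  let ?D = "if 0 < d then (\<lambda>p. p @ [Down]) ` rprefixes u s (d - 1) else {}"
  have eq: "rprefixes u s d = (?U \<union> ?H) \<union> ?D"
  proof
    show "rprefixes u s d \<subseteq> (?U \<union> ?H) \<union> ?D"
    proof
      fix p assume p: "p \<in> rprefixes u s d"
      then have "p \<noteq> []" using assms by (auto simp: rprefixes_def)
      then obtain q t where q: "p = q @ [t]" by (metis rev_exhaust)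
      show "p \<in> (?U \<union> ?H) \<union> ?D"
      proof (cases t)
        case Up
        then have "q \<in> rprefixes (u - 1) s d \<and> 0 < u" using p q by (auto simp: rprefixes_def riordan_prefix_snoc)
        then show ?thesis using q Up by auto
      next
        case Horiz
        then have "q \<in> rprefixes u (s - 1) d \<and> 0 < s \<and> u \<noteq> d" using p q by (auto simp: rprefixes_def riordan_prefix_snoc height_def)
        then show ?thesis using q Horiz assms by auto
      next
        case Down
        then have "q \<in> rprefixes u s (d - 1) \<and> 0 < d" using p q by (auto simp: rprefixes_def riordan_prefix_snoc)
        then show ?thesis using q Down by auto
      qed
    qed
    show "(?U \<union> ?H) \<union> ?D \<subseteq> rprefixes u s d"
      using assms by (auto simp: rprefixes_def riordan_prefix_snoc height_def)
  qed
  have fin: "finite ?U" "finite ?H" "finite ?D" by (auto simp: finite_rprefixes)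
  have c: "card ?U = (if 0 < u then card (rprefixes (u - 1) s d) else 0)"
    "card ?H = (if 0 < s \<and> d < u then card (rprefixes u (s - 1) d) else 0)"
    "card ?D = (if 0 < d then card (rprefixes u s (d - 1)) else 0)"
    by (auto intro!: card_image simp: inj_on_def)
  have "?U \<inter> ?H = {}" "(?U \<union> ?H) \<inter> ?D = {}" by auto
  then have "card (rprefixes u s d) = card ?U + card ?H + card ?D"
    unfolding eq using fin by (simp only: card_Un_disjoint finite_UnI)
  then show ?thesis unfolding c .
qed

text \<open>
  For \<open>d \<le> u\<close> this is the size of \<open>rprefixes u s d\<close>. The upper index \<open>u + s - 1\<close> is truncated
  only for \<open>u = s = 0\<close>, where the coefficient is \<open>1\<close>, as it should be for the empty prefix.
\<close>

definition rcount :: "nat \<Rightarrow> nat \<Rightarrow> nat \<Rightarrow> int" where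
  "rcount u s d = int (u + s + d choose d) * int (u + s - 1 choose s) - ibinom (u + s + d) (int d - 1) * int (u + s choose s)"

lemma ibinom_pred: "ibinom n (int (Suc d) - 1) = int (n choose d)"
  by (simp add: ibinom_def)

text \<open>
  A prefix that ends on the axis ends with a down-step.
\<close>

lemma rcount_diag: "rcount (Suc d) s (Suc d) = rcount (Suc d) s d"
proof -
  have e: "Suc d + s + Suc d = Suc (Suc d + s + d)" "Suc d + s - 1 = s + d" by simp_all
  have "(Suc d + s + d choose Suc d) * (s + d choose s) = (Suc d + s + d choose d) * (Suc d + s choose s)"
    by (rule trinomial_swap13)
  then have "int (Suc d + s + d choose Suc d) * int (s + d choose s) = int (Suc d + s + d choose d) * int (Suc d + s choose s)"
    by (metis of_nat_mult)
  then show ?thesis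
    unfolding rcount_def e ibinom_Suc by (simp add: ibinom_pred algebra_simps del: binomial_Suc_Suc) (simp add: algebra_simps)
qed

text \<open>
  Above the axis each kind of last step is possible, so that only Pascal's rule is used.
\<close>

lemma rcount_interior:
  assumes "d < u"
  shows "rcount u s d = rcount (u - 1) s d + (if 0 < s then rcount u (s - 1) d else 0) + (if 0 < d then rcount u s (d - 1) else 0)"
proof (cases "u = 1")
  case True
  then show ?thesis using assms by (cases s) (auto simp: rcount_def)
next
  case False
  then obtain u' where u: "u = Suc (Suc u')" using assms by (metis One_nat_def less_nat_zero_code not0_implies_Suc)
  \<comment> \<open>the length without the last step; the abbreviations name the summands in Pascal's rule\<close>
  define N where "N = u - 1 + s + d"
  define P0 P1 P2 where "P0 = ibinom N (int d)" and "P1 = ibinom N (int d - 1)" and "P2 = ibinom N (int d - 2)"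
  define a b c where "a = int (Suc u' + s - 1 choose s)"
    and "b = (if s = 0 then 0 else int (Suc u' + s - 1 choose (s - 1)))"
    and "c = (if s = 0 then 0 else int (Suc u' + s choose (s - 1)))"
  have N: "u + s + d = Suc N" using u by (simp add: N_def)
  have ab: "int (u + s - 1 choose s) = a + b" "int (u + s choose s) = a + b + c"
    using u by (cases s; simp add: a_def b_def c_def)+
  have "rcount u s d = (P0 + P1) * (a + b) - (P1 + P2) * (a + b + c)"
    unfolding rcount_def N ab ibinom_int[symmetric, of "Suc N"] ibinom_Suc by (simp add: P0_def P1_def P2_def)
  moreover have "rcount (u - 1) s d = P0 * a - P1 * (a + b)"
  proof -
    have "u - 1 + s + d = N" "u - 1 + s - 1 = Suc u' + s - 1" "u - 1 + s = u + s - 1" using u by (simp_all add: N_def)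
    then show ?thesis unfolding rcount_def by (simp only: ab ibinom_int[symmetric, of N] P0_def P1_def a_def)
  qed
  moreover have "(if 0 < s then rcount u (s - 1) d else 0) = P0 * b - P1 * c"
  proof (cases s)
    case (Suc s')
    then have "u + (s - 1) + d = N" "u + (s - 1) - 1 = Suc u' + s - 1" "u + (s - 1) = Suc u' + s" using u by (simp_all add: N_def)
    then show ?thesis using Suc unfolding rcount_def by (simp add: P0_def P1_def b_def c_def)
  qed (simp add: b_def c_def)
  moreover have "(if 0 < d then rcount u s (d - 1) else 0) = P1 * (a + b) - P2 * (a + b + c)"
  proof (cases d)
    case (Suc d')
    have n: "u + s + (d - 1) = N" "int (d - 1) = int d - 1" using u Suc by (simp_all add: N_def)
    have "rcount u s (d - 1) = ibinom N (int (d - 1)) * (a + b) - ibinom N (int (d - 1) - 1) * (a + b + c)"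
      unfolding rcount_def n(1) ab ibinom_int by simp
    then show ?thesis using Suc unfolding n(2) by (simp add: P1_def P2_def)
  qed (simp add: P1_def P2_def)
  ultimately show ?thesis by (simp add: algebra_simps)
qed

lemma card_rprefixes: "d \<le> u \<Longrightarrow> int (card (rprefixes u s d)) = rcount u s d"
proof (induction "u + s + d" arbitrary: u s d rule: less_induct)
  case less
  show ?case
  proof (cases "u + s + d = 0")
    case True
    then show ?thesis by (simp add: rprefixes_Nil rcount_def)
  next
    case False
    note rec = card_rprefixes_rec[of u s d]
    show ?thesis
    proof (cases "d < u")
      case True
      then show ?thesis using rec less.hyps[of "u - 1" s d] less.hyps[of u "s - 1" d] less.hyps[of u s "d - 1"]
          rcount_interior[OF True, of s] by auto
    next
      case False
      then have ud: "u = d" using less.prems by simp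
      show ?thesis
      proof (cases d)
        case 0
        then show ?thesis using ud rec \<open>u + s + d \<noteq> 0\<close> by (simp add: rcount_def)
      next
        case (Suc d')
        then show ?thesis using ud rec rprefixes_lt[of "u - 1" d s] less.hyps[of u s "d - 1"] rcount_diag[of d' s] by simp
      qed
    qed
  qed
qed

lemma riordan_paths_eq:
  "2 * k \<le> n \<Longrightarrow> {p. riordan_path n p \<and> count_list p Down = k} = rprefixes k (n - 2 * k) k"
  unfolding riordan_path_def motzkin_path_def rprefixes_def riordan_prefix_def position_eq
  by (auto simp: height_def length_steps)

lemma card_riordan_paths:
  assumes "1 \<le> k" "2 * k \<le> n"
  shows "int (card (rprefixes k (n - 2 * k) k)) = riordan_number n k"
proof -
  obtain l where l: "k = Suc l" using assms by (cases k) auto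
  obtain t where t: "n = 2 * k + t" using assms le_Suc_ex by blast
  have "(l + t choose t) = (l + t choose l)" "(k + t choose t) = (k + t choose k)"
    by (subst binomial_symmetric; simp)+
  then show ?thesis using l t by (simp add: card_rprefixes rcount_def riordan_number_def ibinom_pred mult_2 add_ac del: binomial_Suc_Suc of_nat_Suc)
qed

section \<open>Running maxima of permutations\<close>

text \<open>
  The possible sequences of running maxima, with positions counted from \<open>0\<close> as in lists; the
  multiplicity condition encodes that each left-to-right maximum is a descent.
\<close>

definition maxlists :: "nat \<Rightarrow> nat \<Rightarrow> nat \<Rightarrow> nat list set" where
  "maxlists m v k = {cs. length cs = m \<and> sorted cs \<and> (\<forall>i<m. i < cs ! i) \<and> set cs \<subseteq> {..v} \<and>
     card (set cs) = k \<and> (\<forall>x\<in>set cs. 2 \<le> count_list cs x)}"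

definition maxlists_top :: "nat \<Rightarrow> nat \<Rightarrow> nat \<Rightarrow> nat list set" where
  "maxlists_top m v k = {cs \<in> maxlists m (Suc v) k. cs \<noteq> [] \<and> last cs = Suc v}"

lemma finite_maxlists: "finite (maxlists m v k)" "finite (maxlists_top m v k)"
proof -
  show f: "finite (maxlists m v k)" for v
    by (rule finite_subset[OF _ finite_lists_length_eq[of "{..v}" m]]) (auto simp: maxlists_def)
  show "finite (maxlists_top m v k)" using f by (simp add: maxlists_top_def)
qed

lemma maxlists_0: "maxlists 0 v k = (if k = 0 then {[]} else {})"
  by (auto simp: maxlists_def)

lemma maxlists_lt:
  assumes "v < m" shows "maxlists m v k = {}"
proof (rule equals0I)
  fix cs assume cs: "cs \<in> maxlists m v k"
  then have "m - 1 < cs ! (m - 1)" "cs ! (m - 1) \<in> set cs" using assms by (auto simp: maxlists_def)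
  moreover from this(2) cs have "cs ! (m - 1) \<le> v" by (auto simp: maxlists_def)
  ultimately show False using assms by simp
qed

lemma sorted_le_last: "sorted cs \<Longrightarrow> x \<in> set cs \<Longrightarrow> x \<le> last cs"
  by (induct cs rule: rev_induct) (auto simp: sorted_append)

lemma card_maxlists_Suc:
  assumes "1 \<le> m"
  shows "card (maxlists m (Suc v) k) = card (maxlists m v k) + card (maxlists_top m v k)"
proof -
  have "maxlists m (Suc v) k = maxlists m v k \<union> maxlists_top m v k"
  proof
    show "maxlists m (Suc v) k \<subseteq> maxlists m v k \<union> maxlists_top m v k"
    proof
      fix cs assume cs: "cs \<in> maxlists m (Suc v) k"
      then have ne: "cs \<noteq> []" and s: "sorted cs" and sub: "set cs \<subseteq> {..Suc v}" using assms by (auto simp: maxlists_def)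
      show "cs \<in> maxlists m v k \<union> maxlists_top m v k"
      proof (cases "last cs = Suc v")
        case False
        then have "last cs \<le> v" using last_in_set[OF ne] sub by (metis atMost_iff le_SucE subsetD)
        then have "set cs \<subseteq> {..v}" using sorted_le_last[OF s] by force
        then show ?thesis using cs by (simp add: maxlists_def)
      qed (use cs ne in \<open>simp add: maxlists_top_def\<close>)
    qed
    show "maxlists m v k \<union> maxlists_top m v k \<subseteq> maxlists m (Suc v) k" by (auto simp: maxlists_def maxlists_top_def)
  qed
  moreover have "maxlists m v k \<inter> maxlists_top m v k = {}"
    by (auto simp: maxlists_def maxlists_top_def dest: last_in_set)
  ultimately show ?thesis by (simp add: card_Un_disjoint finite_maxlists)
qed

lemma card_maxlists_top:
  assumes "1 \<le> m" "m \<le> Suc v"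
  shows "card (maxlists_top m v k) = card (maxlists_top (m - 1) v k) + (if 2 \<le> m \<and> 1 \<le> k then card (maxlists (m - 2) v (k - 1)) else 0)"
proof -
  let ?w = "Suc v"
  let ?A = "(\<lambda>q. q @ [?w]) ` maxlists_top (m - 1) v k"
  let ?B = "if 2 \<le> m \<and> 1 \<le> k then (\<lambda>q. q @ [?w, ?w]) ` maxlists (m - 2) v (k - 1) else {}"
  have eq: "maxlists_top m v k = ?A \<union> ?B"
  proof
    show "maxlists_top m v k \<subseteq> ?A \<union> ?B"
    proof
      fix cs assume cs: "cs \<in> maxlists_top m v k"
      then obtain q where q: "cs = q @ [?w]" unfolding maxlists_top_def by (metis (mono_tags, lifting) append_butlast_last_id mem_Collect_eq)
      have j: "length cs = m" "sorted cs" "\<forall>i<m. i < cs ! i" "set cs \<subseteq> {..?w}" "card (set cs) = k" "\<forall>x\<in>set cs. 2 \<le> count_list cs x"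
        using cs by (simp_all add: maxlists_top_def maxlists_def)
      have "2 \<le> count_list cs ?w" using j(6) q by simp
      then have wq: "?w \<in> set q" using q by (auto simp: count_notin intro: ccontr)
      have sq: "sorted q" using j(2) q by (simp add: sorted_append)
      have "last q = ?w"
      proof -
        have "?w \<le> last q" by (rule sorted_le_last[OF sq wq])
        moreover have "last q \<in> set cs" using q wq by (cases q) auto
        ultimately show ?thesis using j(4) by force
      qed
      then obtain r where r: "q = r @ [?w]" using wq by (metis append_butlast_last_id empty_iff empty_set)
      have iq: "i < q ! i" if "i < m - 1" for i
        using j(3)[rule_format, of i] that j(1) q by (auto simp: nth_append)
      have ir: "i < r ! i" if "i < m - 2" for i
        using iq[of i] that j(1) q r by (auto simp: nth_append)
      show "cs \<in> ?A \<union> ?B"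
      proof (cases "?w \<in> set r")
        case True
        then have "0 < count_list r ?w" using count_list_0_iff[of r ?w] by linarith
        then have cq: "2 \<le> count_list q ?w" using r by simp
        have "set q = set cs" using q wq by auto
        moreover have "2 \<le> count_list q x" if "x \<in> set q" for x
          using j(6)[rule_format, of x] that q cq by (cases "x = ?w") auto
        ultimately have "q \<in> maxlists_top (m - 1) v k"
          using j q r sq iq \<open>last q = ?w\<close> by (auto simp: maxlists_top_def maxlists_def)
        then show ?thesis using q by blast
      next
        case False
        have st: "set cs = insert ?w (set r)" using q r by auto
        then have k: "k = Suc (card (set r))" using j(5) False by simp
        have "set r \<subseteq> {..v}" using j(4) st False by (metis atMost_Suc insert_subset subset_insert)
        moreover have "2 \<le> count_list r x" if "x \<in> set r" for x
          using j(6)[rule_format, of x] that q r False by (cases "x = ?w") auto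
        moreover have "sorted r" using sq r by (simp add: sorted_append)
        ultimately have "r \<in> maxlists (m - 2) v (k - 1)" "2 \<le> m" "1 \<le> k"
          using j(1) q r k ir by (auto simp: maxlists_def)
        then show ?thesis using q r by auto
      qed
    qed
    show "?A \<union> ?B \<subseteq> maxlists_top m v k"
    proof
      fix cs assume "cs \<in> ?A \<union> ?B"
      then consider (A) q where "cs = q @ [?w]" "q \<in> maxlists_top (m - 1) v k"
        | (B) q where "cs = q @ [?w, ?w]" "q \<in> maxlists (m - 2) v (k - 1)" "2 \<le> m" "1 \<le> k"
        by (auto split: if_splits)
      then show "cs \<in> maxlists_top m v k"
      proof cases
        case A
        have j: "length q = m - 1" "sorted q" "\<forall>i<m - 1. i < q ! i" "set q \<subseteq> {..?w}" "card (set q) = k"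
          "\<forall>x\<in>set q. 2 \<le> count_list q x" "q \<noteq> []" "last q = ?w"
          using A(2) by (simp_all add: maxlists_top_def maxlists_def)
        have "?w \<in> set q" using j(7,8) last_in_set by metis
        then have "set cs = set q" using A(1) by auto
        moreover have "i < cs ! i" if "i < m" for i
          using j(1,3) that assms A(1) by (auto simp: nth_append)
        moreover have "sorted cs" using j(2,4) A(1) by (auto simp: sorted_append)
        moreover have "length cs = m" using j(1) A(1) assms(1) by simp
        moreover have "2 \<le> count_list cs x" if "x \<in> set q" for x
          using j(6) that A(1) by (auto intro: le_SucI)
        ultimately show ?thesis using j A(1) by (simp add: maxlists_top_def maxlists_def)
      next
        case B
        have j: "length q = m - 2" "sorted q" "\<forall>i<m - 2. i < q ! i" "set q \<subseteq> {..v}" "card (set q) = k - 1"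
          "\<forall>x\<in>set q. 2 \<le> count_list q x"
          using B(2) by (simp_all add: maxlists_def)
        have "?w \<notin> set q" using j(4) by auto
        have st: "set cs = insert ?w (set q)" using B(1) by auto
        then have "card (set cs) = k" using j(5) B(4) \<open>?w \<notin> set q\<close> by simp
        moreover have "i < cs ! i" if "i < m" for i
        proof (cases "i < m - 2")
          case True
          then show ?thesis using j(1,3) B(1) by (simp add: nth_append)
        next
          case False
          then have "i = m - 2 \<or> i = m - 1" using that by auto
          then have "cs ! i = ?w" using j(1) B(1,3) by (auto simp: nth_append)
          then show ?thesis using that assms by simp
        qed
        moreover have "sorted cs" using j(2,4) B(1) by (auto simp: sorted_append)
        moreover have "length cs = m" using j(1) B(1,3) by simp
        moreover have "2 \<le> count_list cs x" if "x \<in> set cs" for x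
          using j(6) that st B(1) \<open>?w \<notin> set q\<close> by (cases "x = ?w") (auto simp: count_list_append)
        moreover have "set cs \<subseteq> {..?w}" using st j(4) by auto
        ultimately show ?thesis using B(1) by (simp add: maxlists_top_def maxlists_def)
      qed
    qed
  qed
  have "?A \<inter> ?B = {}"
  proof (rule equals0I)
    fix cs assume "cs \<in> ?A \<inter> ?B"
    then obtain q r where "cs = q @ [?w]" "q \<in> maxlists_top (m - 1) v k" "cs = r @ [?w, ?w]" "r \<in> maxlists (m - 2) v (k - 1)"
      by (auto split: if_splits)
    then have "q = r @ [?w]" "2 \<le> count_list q ?w" "?w \<notin> set r"
      by (auto simp: maxlists_top_def maxlists_def dest: last_in_set)
    then show False by (simp add: count_notin)
  qed
  moreover have "card ?A = card (maxlists_top (m - 1) v k)"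
    by (rule card_image) (simp add: inj_on_def)
  moreover have "card ?B = (if 2 \<le> m \<and> 1 \<le> k then card (maxlists (m - 2) v (k - 1)) else 0)"
    by (auto intro!: card_image simp: inj_on_def)
  moreover have "finite ?A" "finite ?B" by (auto simp: finite_maxlists)
  ultimately show ?thesis unfolding eq by (simp only: card_Un_disjoint)
qed

lemma card_maxlists:
  assumes "1 \<le> k" "2 * k \<le> n"
  shows "int (card (maxlists n n k)) = riordan_number n k"
proof -
  have "int (card (maxlists n n k)) = ballot_number n n k"
  proof (rule ballot_recursion(1)[where Q = "\<lambda>m v k. card (maxlists m v k)" and E = "\<lambda>m v k. card (maxlists_top m v k)"])
    show "card (maxlists_top 0 v k) = 0" for v k by (simp add: maxlists_top_def maxlists_0)
    show "card (maxlists m (Suc v) k) = card (maxlists m v k) + card (maxlists_top m v k)"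
      if "1 \<le> m" for m v k using that by (rule card_maxlists_Suc)
    show "card (maxlists_top m v k) = card (maxlists_top (m - 1) v k) +
        (if 2 \<le> m \<and> 1 \<le> k then card (maxlists (m - 2) v (k - 1)) else 0)"
      if "1 \<le> m" "m \<le> Suc v" for m v k using that by (rule card_maxlists_top)
  qed (simp_all add: maxlists_0 maxlists_lt)
  then show ?thesis using ballot_number_riordan_number[OF assms] by simp
qed

lemma contains_pattern3_iff:
  assumes "length ps = 3"
  shows "contains_pattern n p ps \<longleftrightarrow> (\<exists>i j l. 1 \<le> i \<and> i < j \<and> j < l \<and> l \<le> n \<and>
    (\<forall>a<3. \<forall>b<3. p ([i, j, l] ! a) < p ([i, j, l] ! b) \<longleftrightarrow> ps ! a < ps ! b))" (is "_ \<longleftrightarrow> ?R")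
proof
  assume "contains_pattern n p ps"
  then obtain qs where q: "length qs = 3" "sorted_wrt (<) qs" "set qs \<subseteq> {1..n}"
    "\<forall>a<3. \<forall>b<3. p (qs ! a) < p (qs ! b) \<longleftrightarrow> ps ! a < ps ! b"
    unfolding contains_pattern_def assms by blast
  obtain i j l where "qs = [i, j, l]" using q(1) by (auto simp: numeral_3_eq_3 length_Suc_conv)
  then show ?R using q by (intro exI[of _ i] exI[of _ j] exI[of _ l]) auto
next
  assume ?R
  then obtain i j l where h: "1 \<le> i" "i < j" "j < l" "l \<le> n"
    "\<forall>a<3. \<forall>b<3. p ([i, j, l] ! a) < p ([i, j, l] ! b) \<longleftrightarrow> ps ! a < ps ! b" by blast
  have "sorted_wrt (<) [i, j, l]" "set [i, j, l] \<subseteq> {1..n}" "length [i, j, l] = 3" using h by auto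
  then show "contains_pattern n p ps"
    unfolding contains_pattern_def assms using h(5) by blast
qed

lemma all_less_3: "(\<forall>a<3. P a) \<longleftrightarrow> P 0 \<and> P 1 \<and> P (2::nat)"
  by (auto simp: numeral_3_eq_3 numeral_2_eq_2 less_Suc_eq)

lemma contains_321_iff:
  "contains_pattern n p [3, 2, 1] \<longleftrightarrow> (\<exists>i j l. 1 \<le> i \<and> i < j \<and> j < l \<and> l \<le> n \<and> p l < p j \<and> p j < p i)"
proof -
  have "(\<forall>a<3. \<forall>b<3. p ([i, j, l] ! a) < p ([i, j, l] ! b) \<longleftrightarrow> [3, 2, 1::nat] ! a < [3, 2, 1] ! b) \<longleftrightarrow> p l < p j \<and> p j < p i" for i j l
    unfolding all_less_3 by (simp add: numeral_2_eq_2) linarith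
  then show ?thesis by (subst contains_pattern3_iff) (simp_all del: One_nat_def)
qed

lemma contains_312_iff:
  "contains_pattern n p [3, 1, 2] \<longleftrightarrow> (\<exists>i j l. 1 \<le> i \<and> i < j \<and> j < l \<and> l \<le> n \<and> p j < p l \<and> p l < p i)"
proof -
  have "(\<forall>a<3. \<forall>b<3. p ([i, j, l] ! a) < p ([i, j, l] ! b) \<longleftrightarrow> [3, 1, 2::nat] ! a < [3, 1, 2] ! b) \<longleftrightarrow> p j < p l \<and> p l < p i" for i j l
    unfolding all_less_3 by (simp add: numeral_2_eq_2) linarith
  then show ?thesis by (subst contains_pattern3_iff) (simp_all del: One_nat_def)
qed

definition run_max :: "(nat \<Rightarrow> nat) \<Rightarrow> nat \<Rightarrow> nat" where
  "run_max p t = Max (p ` {1..t})"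

definition run_maxlist :: "nat \<Rightarrow> (nat \<Rightarrow> nat) \<Rightarrow> nat list" where
  "run_maxlist n p = map (run_max p) [1..<Suc n]"

lemma run_max_ge: "1 \<le> s \<Longrightarrow> s \<le> t \<Longrightarrow> p s \<le> run_max p t"
  unfolding run_max_def by (intro Max_ge) auto

lemma run_max_attained:
  assumes "1 \<le> t" obtains s where "1 \<le> s" "s \<le> t" "p s = run_max p t"
proof -
  have "run_max p t \<in> p ` {1..t}" unfolding run_max_def using assms by (intro Max_in) auto
  then show thesis using that by auto
qed

lemma run_max_le: "1 \<le> t \<Longrightarrow> (\<And>s. 1 \<le> s \<Longrightarrow> s \<le> t \<Longrightarrow> p s \<le> x) \<Longrightarrow> run_max p t \<le> x"
  using run_max_attained[of t p] by metis

lemma run_max_mono: "1 \<le> s \<Longrightarrow> s \<le> t \<Longrightarrow> run_max p s \<le> run_max p t"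
  by (intro run_max_le run_max_ge) auto

lemma run_maxlist_nth: "i < n \<Longrightarrow> run_maxlist n p ! i = run_max p (Suc i)"
  by (simp add: run_maxlist_def del: upt_Suc)

lemma length_run_maxlist: "length (run_maxlist n p) = n"
  by (simp add: run_maxlist_def)

lemma set_run_maxlist: "set (run_maxlist n p) = run_max p ` {1..n}"
  by (auto simp: run_maxlist_def simp del: upt_Suc)

lemma run_maxlist_eqD: "run_maxlist n p = run_maxlist n q \<Longrightarrow> 1 \<le> t \<Longrightarrow> t \<le> n \<Longrightarrow> run_max p t = run_max q t"
  using run_maxlist_nth[of "t - 1" n p] run_maxlist_nth[of "t - 1" n q] by simp

lemma lr_maxima_run_max:
  assumes "i \<in> lr_maxima n p" shows "run_max p i = p i"
  using assms by (intro antisym run_max_le run_max_ge) (auto simp: lr_maxima_def le_less)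

lemma run_max_at_lr_maximum:
  assumes p: "p permutes {1..n}" and t: "1 \<le> t" "t \<le> n"
  obtains i where "i \<in> lr_maxima n p" "i \<le> t" "p i = run_max p t"
proof -
  obtain i where i: "1 \<le> i" "i \<le> t" "p i = run_max p t" using run_max_attained[OF t(1)] .
  have "p j < p i" if "j \<in> {1..<i}" for j
  proof -
    have "p j \<noteq> p i" using permutes_inj[OF p] that by (auto simp: inj_eq)
    moreover have "p j \<le> p i" unfolding i(3) using that i by (intro run_max_ge) auto
    ultimately show ?thesis by simp
  qed
  then have "i \<in> lr_maxima n p" using i t by (simp add: lr_maxima_def)
  with that i show thesis by blast
qed

lemma count_list_ge_2:
  "2 \<le> count_list cs x \<longleftrightarrow> (\<exists>i j. i < j \<and> j < length cs \<and> cs ! i = x \<and> cs ! j = x)"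
proof -
  have c: "count_list cs x = card {i. i < length cs \<and> cs ! i = x}"
    by (simp add: count_list_eq_length_filter length_filter_conv_card eq_commute)
  let ?I = "{i. i < length cs \<and> cs ! i = x}"
  have fin: "finite ?I" by simp
  show ?thesis
  proof
    assume "2 \<le> count_list cs x"
    then have "\<not> card ?I \<le> Suc 0" unfolding c by simp
    then obtain i j where "i \<in> ?I" "j \<in> ?I" "i \<noteq> j" using card_le_Suc0_iff_eq[OF fin] by blast
    then show "\<exists>i j. i < j \<and> j < length cs \<and> cs ! i = x \<and> cs ! j = x"
      by (metis (mono_tags, lifting) linorder_neqE_nat mem_Collect_eq)
  next
    assume "\<exists>i j. i < j \<and> j < length cs \<and> cs ! i = x \<and> cs ! j = x"
    then obtain i j where ij: "i < j" "{i, j} \<subseteq> ?I" by auto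
    have "card {i, j} \<le> card ?I" by (rule card_mono[OF fin ij(2)])
    moreover have "card {i, j} = 2" using ij(1) by simp
    ultimately show "2 \<le> count_list cs x" unfolding c by simp
  qed
qed

text \<open>
  The distinct running maxima are the values at the left-to-right maxima, and the running maximum
  attained at a position \<open>i\<close> persists at \<open>i + 1\<close> exactly when \<open>i\<close> is a descent.
\<close>

lemma run_maxlist_in_maxlists_iff:
  assumes p: "p permutes {1..n}"
  shows "run_maxlist n p \<in> maxlists n n k \<longleftrightarrow> card (lr_maxima n p) = k \<and> lr_maxima n p \<subseteq> descents n p"
proof -
  let ?P = "lr_maxima n p"
  have inj: "p a = p b \<longleftrightarrow> a = b" for a b using permutes_inj[OF p] by (simp add: inj_eq)
  have rng: "1 \<le> p s \<and> p s \<le> n" if "1 \<le> s" "s \<le> n" for s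
    using permutes_in_image[OF p, of s] that by simp
  have P: "1 \<le> i \<and> i \<le> n" if "i \<in> ?P" for i using that by (simp add: lr_maxima_def)
  have srt: "sorted (run_maxlist n p)"
    unfolding sorted_iff_nth_mono by (auto simp: length_run_maxlist run_maxlist_nth intro: run_max_mono)
  have low: "i < run_maxlist n p ! i" if "i < n" for i
  proof -
    have "p ` {1..Suc i} \<subseteq> {1..run_max p (Suc i)}" using rng that by (auto intro: run_max_ge[unfolded One_nat_def])
    then have "card (p ` {1..Suc i}) \<le> card {1..run_max p (Suc i)}" by (intro card_mono) auto
    moreover have "card (p ` {1..Suc i}) = Suc i" by (subst card_image) (auto simp: inj_on_def inj)
    ultimately show ?thesis using that by (simp add: run_maxlist_nth)
  qed
  have up: "set (run_maxlist n p) \<subseteq> {..n}" unfolding set_run_maxlist using rng by (auto intro!: run_max_le)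
  have set: "set (run_maxlist n p) = p ` ?P"
  proof
    show "set (run_maxlist n p) \<subseteq> p ` ?P" unfolding set_run_maxlist
    proof
      fix x assume "x \<in> run_max p ` {1..n}"
      then obtain t where t: "1 \<le> t" "t \<le> n" "x = run_max p t" by auto
      obtain i where "i \<in> ?P" "p i = run_max p t" using run_max_at_lr_maximum[OF p t(1,2)] by blast
      then show "x \<in> p ` ?P" using t(3) by (metis image_eqI)
    qed
    show "p ` ?P \<subseteq> set (run_maxlist n p)" unfolding set_run_maxlist
    proof
      fix x assume "x \<in> p ` ?P"
      then obtain i where "i \<in> ?P" "x = p i" by blast
      then have "x = run_max p i" "i \<in> {1..n}" using lr_maxima_run_max[of i n p] P by auto
      then show "x \<in> run_max p ` {1..n}" by blast
    qed
  qed
  have crd: "card (set (run_maxlist n p)) = card ?P"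
    unfolding set by (rule card_image) (simp add: inj_on_def inj)
  have two: "2 \<le> count_list (run_maxlist n p) (p i) \<longleftrightarrow> i \<in> descents n p" if i: "i \<in> ?P" for i
  proof
    assume "i \<in> descents n p"
    then have d: "1 \<le> i" "i < n" "p (Suc i) < p i" by (simp_all add: descents_def)
    have "run_max p (Suc i) = run_max p i"
    proof (rule antisym)
      show "run_max p (Suc i) \<le> run_max p i"
      proof (rule run_max_le)
        fix s assume "1 \<le> s" "s \<le> Suc i"
        then show "p s \<le> run_max p i" using d run_max_ge[of s i p] lr_maxima_run_max[OF i] by (cases "s = Suc i") auto
      qed simp
    qed (use d in \<open>auto intro: run_max_mono\<close>)
    then have "run_maxlist n p ! (i - 1) = p i" "run_maxlist n p ! i = p i"
      using d lr_maxima_run_max[OF i] by (simp_all add: run_maxlist_nth)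
    then show "2 \<le> count_list (run_maxlist n p) (p i)"
      unfolding count_list_ge_2 using d by (intro exI[of _ "i - 1"] exI[of _ i]) (simp add: length_run_maxlist)
  next
    assume "2 \<le> count_list (run_maxlist n p) (p i)"
    then obtain a b where ab: "a < b" "b < n" "run_maxlist n p ! a = p i" "run_maxlist n p ! b = p i"
      unfolding count_list_ge_2 length_run_maxlist by blast
    have "run_max p (Suc a) = p i" "run_max p (Suc b) = p i" using ab by (simp_all add: run_maxlist_nth)
    moreover obtain s where s: "1 \<le> s" "s \<le> Suc a" "p s = run_max p (Suc a)" using run_max_attained[of "Suc a" p] by auto
    ultimately have "s = i" using inj by simp
    then have "i \<le> b" using s ab by simp
    then have "p (Suc i) \<le> p i" using run_max_ge[of "Suc i" "Suc b" p] \<open>run_max p (Suc b) = p i\<close> by simp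
    moreover have "p (Suc i) \<noteq> p i" using inj by simp
    ultimately show "i \<in> descents n p" using P[OF i] \<open>i \<le> b\<close> ab by (simp add: descents_def)
  qed
  have "(\<forall>x\<in>set (run_maxlist n p). 2 \<le> count_list (run_maxlist n p) x) \<longleftrightarrow> ?P \<subseteq> descents n p"
    unfolding set using two by auto
  then show ?thesis unfolding maxlists_def using srt low up crd by (simp add: length_run_maxlist)
qed

text \<open>
  Entries are chosen from left to right: a new maximum is taken over as it is, and at a repeated one
  any unused smaller value will do. There is one, because \<open>m\<close> entries cannot exhaust the
  \<open>cs ! m > m\<close> values up to the current maximum.
\<close>

lemma run_maxlist_extend:
  assumes cs: "length cs = n" "sorted cs" "\<forall>i<n. i < cs ! i" and "m \<le> n"
  shows "\<exists>f. inj_on f {1..m} \<and> (\<forall>t. 1 \<le> t \<and> t \<le> m \<longrightarrow> 1 \<le> f t \<and> run_max f t = cs ! (t - 1))"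
  using \<open>m \<le> n\<close>
proof (induction m)
  case 0
  then show ?case by (intro exI[of _ id]) simp
next
  case (Suc m)
  then obtain f where f: "inj_on f {1..m}" "\<And>t. 1 \<le> t \<Longrightarrow> t \<le> m \<Longrightarrow> 1 \<le> f t \<and> run_max f t = cs ! (t - 1)" by auto
  have cm: "m < cs ! m" using cs(3) Suc.prems by simp
  have fle: "f t \<le> cs ! m" if "1 \<le> t" "t \<le> m" for t
  proof -
    have "f t \<le> cs ! (m - 1)" using f(2)[of m] run_max_ge[of t m f] that by simp
    also have "\<dots> \<le> cs ! m" using cs Suc.prems by (intro sorted_nth_mono) auto
    finally show ?thesis .
  qed
  have "\<exists>y. 1 \<le> y \<and> y \<notin> f ` {1..m} \<and> y \<le> cs ! m \<and> (y = cs ! m \<or> cs ! m \<in> f ` {1..m})"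
  proof (cases "cs ! m \<in> f ` {1..m}")
    case False
    then show ?thesis using cm by (intro exI[of _ "cs ! m"]) auto
  next
    case True
    have "card (f ` {1..m}) = m" using card_image[OF f(1)] by simp
    then have "card (f ` {1..m}) < card {1..cs ! m}" using cm by simp
    then have "\<not> {1..cs ! m} \<subseteq> f ` {1..m}" using card_mono[of "f ` {1..m}" "{1..cs ! m}"] by auto
    then show ?thesis using True by auto
  qed
  then obtain y where y: "1 \<le> y" "y \<notin> f ` {1..m}" "y \<le> cs ! m" "y = cs ! m \<or> cs ! m \<in> f ` {1..m}" by blast
  let ?g = "f(Suc m := y)"
  have "inj_on ?g {1..Suc m}"
  proof -
    have "?g ` {1..m} = f ` {1..m}" by (rule image_cong) auto
    moreover have "inj_on ?g {1..m}" by (rule inj_on_fun_updI[OF f(1) y(2)])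
    moreover have "{1..Suc m} = insert (Suc m) {1..m}" "{1..m} - {Suc m} = {1..m}" by auto
    ultimately show ?thesis using y(2) by (simp only: inj_on_insert fun_upd_same not_False_eq_True simp_thms)
  qed
  moreover have "run_max ?g t = run_max f t" if "t \<le> m" for t
    unfolding run_max_def by (rule arg_cong[where f = Max], rule image_cong) (use that in auto)
  moreover have "run_max ?g (Suc m) = cs ! m"
  proof (rule antisym)
    show "run_max ?g (Suc m) \<le> cs ! m" using fle y(3) by (intro run_max_le) auto
    show "cs ! m \<le> run_max ?g (Suc m)"
      using y(4)
    proof
      assume "y = cs ! m"
      then show ?thesis using run_max_ge[of "Suc m" "Suc m" ?g] by simp
    next
      assume "cs ! m \<in> f ` {1..m}"
      then obtain s where "1 \<le> s" "s \<le> m" "cs ! m = f s" by auto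
      then show ?thesis using run_max_ge[of s "Suc m" ?g] by simp
    qed
  qed
  moreover have "1 \<le> ?g t" if "1 \<le> t" "t \<le> Suc m" for t using f(2) y(1) that by simp
  moreover have "run_max ?g t = cs ! (t - 1)" if "1 \<le> t" "t \<le> Suc m" for t
    using that f(2)[of t] calculation(2)[of t] calculation(3) by (cases "t = Suc m") simp_all
  ultimately show ?case by blast
qed

lemma run_maxlist_realised:
  assumes cs: "cs \<in> maxlists n n k"
  obtains p where "p permutes {1..n}" "run_maxlist n p = cs"
proof -
  have j: "length cs = n" "sorted cs" "\<forall>i<n. i < cs ! i" "set cs \<subseteq> {..n}" using cs by (auto simp: maxlists_def)
  obtain f where f: "inj_on f {1..n}" "\<And>t. 1 \<le> t \<Longrightarrow> t \<le> n \<Longrightarrow> 1 \<le> f t \<and> run_max f t = cs ! (t - 1)"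
    using run_maxlist_extend[OF j(1-3) le_refl] by blast
  have "f ` {1..n} \<subseteq> {1..n}"
  proof
    fix x assume "x \<in> f ` {1..n}"
    then obtain t where t: "1 \<le> t" "t \<le> n" "x = f t" by auto
    have "x \<le> cs ! (t - 1)" using f(2)[OF t(1,2)] run_max_ge[of t t f] t by simp
    also have "\<dots> \<le> n"
    proof -
      have "cs ! (t - 1) \<in> set cs" using j(1) t by (intro nth_mem) simp
      then show ?thesis using j(4) by blast
    qed
    finally show "x \<in> {1..n}" using f(2)[OF t(1,2)] t by simp
  qed
  then have bij: "bij_betw f {1..n} {1..n}" using f(1) by (simp add: bij_betw_def endo_inj_surj)
  define p where "p i = (if i \<in> {1..n} then f i else i)" for i
  have "bij_betw p {1..n} {1..n}" using bij bij_betw_cong[of "{1..n}" p f "{1..n}"] by (simp add: p_def)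
  then have "p permutes {1..n}" by (rule bij_imp_permutes) (auto simp: p_def)
  moreover have "run_max p t = run_max f t" if "t \<le> n" for t
    unfolding run_max_def by (rule arg_cong[where f = Max], rule image_cong) (use that in \<open>auto simp: p_def\<close>)
  then have "run_maxlist n p = cs" using f(2) j(1) by (intro nth_equalityI) (auto simp: length_run_maxlist run_maxlist_nth)
  ultimately show thesis using that by blast
qed

text \<open>
  Entries exceeded by an earlier one never influence a running maximum.
\<close>

lemma run_max_swap:
  assumes "1 \<le> i" "i < j" "j < l" "p j < p i" "p l < p i"
  shows "run_max (p \<circ> transpose j l) = run_max p"
proof -
  have le: "run_max q t \<le> run_max (q \<circ> transpose j l) t" if q: "q j < q i" "q l < q i" and t: "1 \<le> t" for q :: "nat \<Rightarrow> nat" and t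
  proof (rule run_max_le[OF t])
    fix s assume s: "1 \<le> s" "s \<le> t"
    let ?q = "q \<circ> transpose j l"
    have qi: "?q i = q i" using assms by simp
    show "q s \<le> run_max ?q t"
    proof (cases "s = j \<or> s = l")
      case True
      then have "q s < ?q i" using q qi by auto
      moreover have "?q i \<le> run_max ?q t" using True s assms by (intro run_max_ge) auto
      ultimately show ?thesis by simp
    next
      case False
      then have "?q s = q s" by simp
      then show ?thesis using run_max_ge[OF s, of ?q] by simp
    qed
  qed
  have inv: "p \<circ> transpose j l \<circ> transpose j l = p" by (simp add: fun_eq_iff)
  have "run_max (p \<circ> transpose j l) t = run_max p t" if t: "1 \<le> t" for t
    using le[OF assms(4,5) t] le[of "p \<circ> transpose j l", OF _ _ t] assms inv by (intro antisym) simp_all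
  moreover have "run_max (p \<circ> transpose j l) 0 = run_max p 0" by (simp add: run_max_def)
  ultimately show ?thesis by (metis One_nat_def Suc_leI ext neq0_conv)
qed

text \<open>
  This potential is monotone under the exchange of two entries out of order.
\<close>

definition weighted_sum :: "nat \<Rightarrow> (nat \<Rightarrow> nat) \<Rightarrow> int" where
  "weighted_sum n p = (\<Sum>t\<in>{1..n}. int t * int (p t))"

lemma weighted_sum_swap:
  assumes "1 \<le> j" "j < l" "l \<le> n"
  shows "weighted_sum n (p \<circ> transpose j l) = weighted_sum n p + (int l - int j) * (int (p j) - int (p l))"
proof -
  have s: "(\<Sum>t\<in>{1..n}. g t) = g j + g l + (\<Sum>t\<in>{1..n} - {j, l}. g t)" for g :: "nat \<Rightarrow> int"
  proof -
    have "(\<Sum>t\<in>{1..n}. g t) = (\<Sum>t\<in>{j, l}. g t) + (\<Sum>t\<in>{1..n} - {j, l}. g t)"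
      using assms by (subst sum.subset_diff[of "{j, l}"]) auto
    then show ?thesis using assms by simp
  qed
  have "(\<Sum>t\<in>{1..n} - {j, l}. int t * int ((p \<circ> transpose j l) t)) = (\<Sum>t\<in>{1..n} - {j, l}. int t * int (p t))"
    by (rule sum.cong) auto
  then show ?thesis unfolding weighted_sum_def s by (simp add: algebra_simps)
qed

lemma finite_has_maximal_int:
  fixes f :: "'a \<Rightarrow> int"
  assumes "finite S" "S \<noteq> {}"
  obtains x where "x \<in> S" "\<And>y. y \<in> S \<Longrightarrow> f y \<le> f x"
proof -
  have "Max (f ` S) \<in> f ` S" using assms by (intro Max_in) auto
  then obtain x where x: "x \<in> S" "f x = Max (f ` S)" by auto
  then have "f y \<le> f x" if "y \<in> S" for y using that assms by simp
  with x(1) that show thesis by blast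
qed

text \<open>
  In an occurrence of 321 or 312, the two entries after the first one can be exchanged without
  altering running maxima. This raises the potential for 321 and lowers it for 312, so a
  permutation of maximal, respectively minimal, potential has no such occurrence.
\<close>

lemma run_maxlist_realised_avoiding:
  assumes cs: "cs \<in> maxlists n n k"
  shows "\<exists>p. p permutes {1..n} \<and> avoids_pattern n p [3, 2, 1] \<and> run_maxlist n p = cs"
    and "\<exists>p. p permutes {1..n} \<and> avoids_pattern n p [3, 1, 2] \<and> run_maxlist n p = cs"
proof -
  let ?S = "{p. p permutes {1..n} \<and> run_maxlist n p = cs}"
  have fin: "finite ?S" by (rule finite_subset[OF _ finite_permutations[of "{1..n}"]]) auto
  have ne: "?S \<noteq> {}" using run_maxlist_realised[OF cs] by auto
  have swap: "p \<circ> transpose j l \<in> ?S"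
    if "p \<in> ?S" "1 \<le> i" "i < j" "j < l" "l \<le> n" "p j < p i" "p l < p i" for p i j l
  proof -
    have "(p \<circ> transpose j l) permutes {1..n}"
      using that by (intro permutes_compose permutes_swap_id) auto
    moreover have "run_maxlist n (p \<circ> transpose j l) = run_maxlist n p"
      unfolding run_maxlist_def using run_max_swap[of i j l p] that by simp
    ultimately show ?thesis using that by simp
  qed
  obtain p where p: "p \<in> ?S" "\<And>q. q \<in> ?S \<Longrightarrow> weighted_sum n q \<le> weighted_sum n p"
    using finite_has_maximal_int[OF fin ne, of "weighted_sum n"] by blast
  have "\<not> contains_pattern n p [3, 2, 1]"
  proof
    assume "contains_pattern n p [3, 2, 1]"
    then obtain i j l where h: "1 \<le> i" "i < j" "j < l" "l \<le> n" "p l < p j" "p j < p i"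
      unfolding contains_321_iff by blast
    have "weighted_sum n (p \<circ> transpose j l) \<le> weighted_sum n p"
      by (rule p(2)[OF swap[OF p(1) h(1-4,6) less_trans[OF h(5,6)]]])
    moreover have "0 < (int l - int j) * (int (p j) - int (p l))" using h by (intro mult_pos_pos) auto
    ultimately show False using weighted_sum_swap[of j l n p] h by simp
  qed
  with p(1) show "\<exists>p. p permutes {1..n} \<and> avoids_pattern n p [3, 2, 1] \<and> run_maxlist n p = cs" by blast
  \<comment> \<open>minimal potential, stated as maximality of its negative\<close>
  obtain p where p: "p \<in> ?S" "\<And>q. q \<in> ?S \<Longrightarrow> - weighted_sum n q \<le> - weighted_sum n p"
    using finite_has_maximal_int[OF fin ne, of "\<lambda>q. - weighted_sum n q"] by blast
  have "\<not> contains_pattern n p [3, 1, 2]"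
  proof
    assume "contains_pattern n p [3, 1, 2]"
    then obtain i j l where h: "1 \<le> i" "i < j" "j < l" "l \<le> n" "p j < p l" "p l < p i"
      unfolding contains_312_iff by blast
    have "- weighted_sum n (p \<circ> transpose j l) \<le> - weighted_sum n p"
      by (rule p(2)[OF swap[OF p(1) h(1-4) less_trans[OF h(5,6)] h(6)]])
    moreover have "0 < (int l - int j) * (int (p l) - int (p j))" using h by (intro mult_pos_pos) auto
    ultimately show False using weighted_sum_swap[of j l n p] h by (simp add: algebra_simps)
  qed
  with p(1) show "\<exists>p. p permutes {1..n} \<and> avoids_pattern n p [3, 1, 2] \<and> run_maxlist n p = cs" by blast
qed

text \<open>
  Both entries at the first difference lie below the current maximum, which stands earlier and is
  shared. The permutation with the smaller entry has the larger one further right, giving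
  312; the other one has the smaller entry further right, giving 321.
\<close>

lemma first_difference:
  assumes p: "p permutes {1..n}" and q: "q permutes {1..n}" and eq: "run_maxlist n p = run_maxlist n q"
    and t: "t \<in> {1..n}" "\<And>s. s < t \<Longrightarrow> p s = q s" "p t < q t"
  shows "contains_pattern n p [3, 1, 2]" "contains_pattern n q [3, 2, 1]"
proof -
  have t1: "1 \<le> t" "t \<le> n" using t by auto
  have c: "run_max p t = run_max q t" using run_maxlist_eqD[OF eq t1] .
  have injp: "p a = p b \<longleftrightarrow> a = b" for a b using permutes_inj[OF p] by (simp add: inj_eq)
  have injq: "q a = q b \<longleftrightarrow> a = b" for a b using permutes_inj[OF q] by (simp add: inj_eq)
  obtain i where i: "1 \<le> i" "i \<le> t" "p i = run_max p t" using run_max_attained[OF t1(1)] .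
  have "i \<noteq> t"
    using i c t(3) run_max_ge[of t t q] t1 by auto
  then have it: "i < t" "q i = run_max p t" using i t(2)[of i] by auto
  have "q t \<le> run_max p t" unfolding c using t1 by (intro run_max_ge) auto
  moreover have "q t \<noteq> q i" using it(1) injq[of t i] by simp
  then have "q t \<noteq> run_max p t" using it(2) by simp
  ultimately have qt: "q t < run_max p t" by simp
  have later: "\<exists>l. t < l \<and> l \<le> n \<and> a l = b t"
    if a: "a permutes {1..n}" and b: "b permutes {1..n}" and ab: "\<And>s. s < t \<Longrightarrow> a s = b s" "a t \<noteq> b t" for a b
  proof -
    obtain l where l: "a l = b t" using permutes_surj[OF a] unfolding surj_def by metis
    have "b t \<in> {1..n}" using permutes_in_image[OF b] t(1) by simp
    then have "l \<in> {1..n}" using permutes_in_image[OF a, of l] l by simp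
    moreover have "l \<noteq> t" using l ab(2) by auto
    moreover have "\<not> l < t"
    proof
      assume "l < t"
      then have "b l = b t" using ab(1) l by simp
      then show False using permutes_inj[OF b] \<open>l < t\<close> by (auto simp: inj_eq)
    qed
    ultimately show ?thesis using l by (intro exI[of _ l]) simp
  qed
  obtain l where "t < l" "l \<le> n" "p l = q t" using later[OF p q t(2)] t(3) by auto
  then show "contains_pattern n p [3, 1, 2]"
    unfolding contains_312_iff using i it t(3) qt by (intro exI[of _ i] exI[of _ t] exI[of _ l]) auto
  obtain l where "t < l" "l \<le> n" "q l = p t" using later[OF q p] t(2,3) by auto
  then show "contains_pattern n q [3, 2, 1]"
    unfolding contains_321_iff using i it t(3) qt by (intro exI[of _ i] exI[of _ t] exI[of _ l]) auto
qed

lemma run_maxlist_determines: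
  assumes p: "p permutes {1..n}" and q: "q permutes {1..n}" and eq: "run_maxlist n p = run_maxlist n q"
    and av: "avoids_pattern n p [3, 2, 1] \<and> avoids_pattern n q [3, 2, 1] \<or>
      avoids_pattern n p [3, 1, 2] \<and> avoids_pattern n q [3, 1, 2]"
  shows "p = q"
proof (rule ccontr)
  assume "p \<noteq> q"
  then obtain t0 where "p t0 \<noteq> q t0" by blast
  define t where "t = (LEAST t. p t \<noteq> q t)"
  have ne: "p t \<noteq> q t" unfolding t_def by (rule LeastI[of _ t0]) fact
  have lt: "p s = q s" if "s < t" for s using that not_less_Least unfolding t_def by blast
  have t: "t \<in> {1..n}"
  proof (rule ccontr)
    assume "t \<notin> {1..n}"
    then show False using ne permutes_not_in[OF p] permutes_not_in[OF q] by metis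
  qed
  show False
  proof (cases "p t < q t")
    case True
    then show False using first_difference[OF p q eq t lt] av by blast
  next
    case False
    then have "q t < p t" using ne by simp
    then show False using first_difference[OF q p eq[symmetric] t] lt av by metis
  qed
qed

lemma bij_run_maxlist:
  assumes "ps = [3, 2, 1] \<or> ps = [3, 1, 2]"
  shows "bij_betw (run_maxlist n) {p. p permutes {1..n} \<and> avoids_pattern n p ps \<and>
      card (lr_maxima n p) = k \<and> lr_maxima n p \<subseteq> descents n p} (maxlists n n k)" (is "bij_betw _ ?C _")
  unfolding bij_betw_def
proof
  show "inj_on (run_maxlist n) ?C"
    using assms by (intro inj_onI run_maxlist_determines[of _ n]) auto
  show "run_maxlist n ` ?C = maxlists n n k"
  proof
    show "run_maxlist n ` ?C \<subseteq> maxlists n n k" using run_maxlist_in_maxlists_iff by blast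
    show "maxlists n n k \<subseteq> run_maxlist n ` ?C"
    proof
      fix cs assume cs: "cs \<in> maxlists n n k"
      then obtain p where p: "p permutes {1..n}" "avoids_pattern n p ps" "run_maxlist n p = cs"
        using run_maxlist_realised_avoiding[OF cs] assms by auto
      then have "p \<in> ?C" using run_maxlist_in_maxlists_iff[OF p(1), of k] cs by auto
      then show "cs \<in> run_maxlist n ` ?C" using p(3) by blast
    qed
  qed
qed

section \<open>Standard Young tableaux, one cell at a time\<close>

text \<open>
  Comparing multisets replaces distinctness and the set of entries by one equation, which is easy to
  maintain when an entry is appended.
\<close>

lemma syt_iff:
  "standard_young_tableau n T \<longleftrightarrow>
    (\<forall>k. Suc k < length T \<longrightarrow> length (T ! Suc k) \<le> length (T ! k)) \<and> (\<forall>k<length T. T ! k \<noteq> []) \<and>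
    mset (concat T) = mset_set {1..n} \<and> (\<forall>k<length T. sorted_wrt (<) (T ! k)) \<and>
    (\<forall>i j. Suc i < length T \<and> j < length (T ! Suc i) \<longrightarrow> T ! i ! j < T ! Suc i ! j)"
proof -
  have 1: "sorted_wrt (\<ge>) (shape T) \<longleftrightarrow> (\<forall>k. Suc k < length T \<longrightarrow> length (T ! Suc k) \<le> length (T ! k))"
    by (subst sorted_wrt_iff_nth_Suc_transp) (auto simp: shape_def transp_def)
  have 2: "0 \<notin> set (shape T) \<longleftrightarrow> (\<forall>k<length T. T ! k \<noteq> [])"
    unfolding shape_def in_set_conv_nth by (auto simp: eq_commute[of 0])
  have 3: "distinct (concat T) \<and> set (concat T) = {1..n} \<longleftrightarrow> mset (concat T) = mset_set {1..n}"
  proof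
    assume "distinct (concat T) \<and> set (concat T) = {1..n}"
    then show "mset (concat T) = mset_set {1..n}" using mset_set_set[of "concat T"] by simp
  next
    assume m: "mset (concat T) = mset_set {1..n}"
    have s: "set (concat T) = {1..n}" using arg_cong[OF m, of set_mset] by simp
    moreover have "length (concat T) = n" using arg_cong[OF m, of size] by simp
    ultimately show "distinct (concat T) \<and> set (concat T) = {1..n}" by (metis card_atLeastAtMost card_distinct diff_Suc_1)
  qed
  have 4: "(\<forall>row\<in>set T. sorted_wrt (<) row) \<longleftrightarrow> (\<forall>k<length T. sorted_wrt (<) (T ! k))"
    by (simp add: all_set_conv_all_nth)
  show ?thesis unfolding standard_young_tableau_def 1 2 4 3[symmetric] by blast
qed

definition add_entry :: "nat \<Rightarrow> nat \<Rightarrow> nat list list \<Rightarrow> nat list list" where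
  "add_entry x i T = (if i < length T then T[i := T ! i @ [x]] else T @ [[x]])"

definition addable :: "nat list list \<Rightarrow> nat \<Rightarrow> bool" where
  "addable T i \<longleftrightarrow> i \<le> length T \<and> (i = 0 \<or> row_length T i < row_length T (i - 1))"

lemma syt_entries: "standard_young_tableau n T \<Longrightarrow> k < length T \<Longrightarrow> x \<in> set (T ! k) \<Longrightarrow> 1 \<le> x \<and> x \<le> n"
  unfolding standard_young_tableau_def by (metis UN_I atLeastAtMost_iff nth_mem set_concat)

lemma row_length_add_entry:
  "i \<le> length T \<Longrightarrow> row_length (add_entry x i T) = (row_length T)(i := Suc (row_length T i))"
  by (auto simp: row_length_def add_entry_def fun_eq_iff nth_append)

lemma row_last_add_entry:
  "i \<le> length T \<Longrightarrow> row_last (add_entry x i T) j = (if j = i then x else row_last T j)"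
  by (auto simp: row_last_def add_entry_def nth_append)

lemma mset_add_entry: "mset (concat (add_entry x i T)) = add_mset x (mset (concat T))"
proof (cases "i < length T")
  case True
  then have "T[i := T ! i @ [x]] = take i T @ (T ! i @ [x]) # drop (Suc i) T" by (rule upd_conv_take_nth_drop)
  moreover have "T = take i T @ T ! i # drop (Suc i) T" using True by (rule id_take_nth_drop)
  then have "mset (concat T) = mset (concat (take i T)) + mset (T ! i) + mset (concat (drop (Suc i) T))"
    by (metis concat.simps(2) concat_append mset_append union_assoc)
  ultimately show ?thesis using True by (simp add: add_entry_def)
qed (simp add: add_entry_def)

lemma mset_set_Suc: "mset_set {1..Suc n} = add_mset (Suc n) (mset_set {1..n})"
  by (simp add: atLeastAtMostSuc_conv)

lemma syt_add_entry:
  assumes T: "standard_young_tableau n T" and a: "addable T i"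
  shows "standard_young_tableau (Suc n) (add_entry (Suc n) i T)"
proof -
  note t = T[unfolded syt_iff]
  have len: "\<And>k. Suc k < length T \<Longrightarrow> length (T ! Suc k) \<le> length (T ! k)" using t by blast
  have ne: "\<And>k. k < length T \<Longrightarrow> T ! k \<noteq> []" using t by blast
  have srt: "\<And>k. k < length T \<Longrightarrow> sorted_wrt (<) (T ! k)" using t by blast
  have col: "\<And>i j. Suc i < length T \<Longrightarrow> j < length (T ! Suc i) \<Longrightarrow> T ! i ! j < T ! Suc i ! j" using t by blast
  have le: "x < Suc n" if "k < length T" "x \<in> set (T ! k)" for k x
    using syt_entries[OF T that] by simp
  have m: "mset (concat (add_entry (Suc n) i T)) = mset_set {1..Suc n}"
    unfolding mset_add_entry mset_set_Suc using t by simp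
  show ?thesis
  proof (cases "i < length T")
    case True
    let ?T = "T[i := T ! i @ [Suc n]]"
    have e: "add_entry (Suc n) i T = ?T" using True by (simp add: add_entry_def)
    have up: "length (T ! i) < length (T ! (i - 1))" if "0 < i"
      using a that True by (simp add: addable_def row_length_def split: if_splits)
    have "length (?T ! Suc k) \<le> length (?T ! k)" if "Suc k < length ?T" for k
    proof (cases "Suc k = i")
      case True
      then show ?thesis using up that by auto
    next
      case False
      then show ?thesis using len[of k] that by (cases "k = i") auto
    qed
    moreover have "?T ! k \<noteq> []" if "k < length ?T" for k
      using ne[of k] that by (cases "k = i") auto
    moreover have "sorted_wrt (<) (?T ! k)" if "k < length ?T" for k
      using srt[of k] le[of k] that by (cases "k = i") (auto simp: sorted_wrt_append)
    moreover have "?T ! k ! j < ?T ! Suc k ! j" if "Suc k < length ?T" "j < length (?T ! Suc k)" for k j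
    proof (cases "Suc k = i")
      case True
      have k: "k < length T" "?T ! k = T ! k" "?T ! Suc k = T ! i @ [Suc n]" using that True by auto
      show ?thesis
      proof (cases "j < length (T ! i)")
        case True
        then show ?thesis using col[of k j] that \<open>Suc k = i\<close> k by (simp add: nth_append)
      next
        case False
        then have "j = length (T ! i)" using that k by simp
        moreover have "length (T ! i) < length (T ! k)" using up \<open>Suc k = i\<close> by auto
        ultimately show ?thesis using k le[OF k(1), of "T ! k ! j"] by (simp add: nth_append)
      qed
    next
      case False
      then show ?thesis using col[of k j] len[of k] that by (cases "k = i") (auto simp: nth_append)
    qed
    ultimately show ?thesis unfolding syt_iff e using m[unfolded e] by blast
  next
    case False
    then have i: "i = length T" using a by (simp add: addable_def)
    let ?T = "T @ [[Suc n]]"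
    have e: "add_entry (Suc n) i T = ?T" using False by (simp add: add_entry_def)
    have "length (?T ! Suc k) \<le> length (?T ! k)" if "Suc k < length ?T" for k
      using len[of k] ne[of k] that by (cases "Suc k < length T") (auto simp: nth_append Suc_le_eq less_Suc_eq)
    moreover have "?T ! k \<noteq> []" if "k < length ?T" for k
      using ne[of k] that by (cases "k < length T") (auto simp: nth_append less_Suc_eq)
    moreover have "sorted_wrt (<) (?T ! k)" if "k < length ?T" for k
      using srt[of k] that by (cases "k < length T") (auto simp: nth_append less_Suc_eq)
    moreover have "?T ! k ! j < ?T ! Suc k ! j" if "Suc k < length ?T" "j < length (?T ! Suc k)" for k j
    proof (cases "Suc k < length T")
      case True
      then show ?thesis using col[of k j] that by (simp add: nth_append)
    next
      case False
      then have k: "Suc k = length T" using that by simp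
      then have "j = 0" using that by (simp add: nth_append)
      moreover have "T ! k ! 0 < Suc n" using le[of k "T ! k ! 0"] ne[of k] k by auto
      moreover have "k < length T" using k by simp
      ultimately show ?thesis using k by (simp add: nth_append)
    qed
    ultimately show ?thesis unfolding syt_iff e using m[unfolded e] by blast
  qed
qed

text \<open>
  The largest entry ends its row. The next row is not longer than what remains of that row, since
  the entry below the largest one would have to be larger still.
\<close>

lemma syt_remove_max:
  assumes U: "standard_young_tableau (Suc n) U"
  obtains T i where "standard_young_tableau n T" "addable T i" "U = add_entry (Suc n) i T"
proof -
  note t = U[unfolded syt_iff]
  have len: "\<And>k. Suc k < length U \<Longrightarrow> length (U ! Suc k) \<le> length (U ! k)" using t by blast
  have ne: "\<And>k. k < length U \<Longrightarrow> U ! k \<noteq> []" using t by blast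
  have srt: "\<And>k. k < length U \<Longrightarrow> sorted_wrt (<) (U ! k)" using t by blast
  have col: "\<And>i j. Suc i < length U \<Longrightarrow> j < length (U ! Suc i) \<Longrightarrow> U ! i ! j < U ! Suc i ! j" using t by blast
  have le: "x \<le> Suc n" if "k < length U" "x \<in> set (U ! k)" for k x
    using syt_entries[OF U that] by simp
  have "Suc n \<in> set (concat U)" using U by (simp add: standard_young_tableau_def del: set_concat)
  then obtain i where i: "i < length U" "Suc n \<in> set (U ! i)" by (auto simp: in_set_conv_nth) (metis nth_mem)
  have "last (U ! i) = Suc n"
  proof (rule antisym)
    show "last (U ! i) \<le> Suc n" using le[OF i(1)] ne[OF i(1)] by simp
    have "sorted (U ! i)" using srt[OF i(1)] by (rule strict_sorted_imp_sorted)
    then show "Suc n \<le> last (U ! i)" using i(2) by (rule sorted_le_last)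
  qed
  then obtain r where r: "U ! i = r @ [Suc n]" using ne[OF i(1)] by (metis append_butlast_last_id)
  have below: "length (U ! Suc i) \<le> length r" if s: "Suc i < length U"
  proof (rule ccontr)
    assume "\<not> length (U ! Suc i) \<le> length r"
    then have l: "length r < length (U ! Suc i)" by simp
    have "U ! i ! length r < U ! Suc i ! length r" by (rule col[OF s l])
    moreover have "U ! Suc i ! length r \<le> Suc n" using le[OF s] l by simp
    ultimately show False using r by simp
  qed
  show thesis
  proof (cases "r = []")
    case True
    have last: "length U = Suc i"
    proof (rule ccontr)
      assume "length U \<noteq> Suc i"
      then have "Suc i < length U" using i by simp
      then show False using below ne[of "Suc i"] True by simp
    qed
    let ?T = "butlast U"
    have U': "U = ?T @ [[Suc n]]" using last r True
      by (metis append_Nil append_butlast_last_id diff_Suc_1 last_conv_nth length_0_conv nat.simps(3))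
    then have e: "U = add_entry (Suc n) i ?T" using last by (simp add: add_entry_def)
    have nth: "?T ! k = U ! k" if "k < i" for k using that last by (simp add: nth_butlast)
    have col': "?T ! k ! j < ?T ! Suc k ! j" if "Suc k < length ?T" "j < length (?T ! Suc k)" for k j
    proof -
      have k: "k < i" "Suc k < i" "Suc k < length U" using that last by auto
      then show ?thesis using col[of k j] that unfolding nth[OF k(1)] nth[OF k(2)] by blast
    qed
    have "mset (concat U) = add_mset (Suc n) (mset (concat ?T))" by (subst e) (rule mset_add_entry)
    then have m: "mset (concat ?T) = mset_set {1..n}" using t unfolding mset_set_Suc by simp
    have len': "length (?T ! Suc k) \<le> length (?T ! k)" if "Suc k < length ?T" for k
      using len[of k] nth[of k] nth[of "Suc k"] that last by simp
    have ne': "?T ! k \<noteq> []" and srt': "sorted_wrt (<) (?T ! k)" if "k < length ?T" for k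
      using ne[of k] srt[of k] nth[of k] that last by simp_all
    have "standard_young_tableau n ?T" unfolding syt_iff
      using m len' ne' srt' col' by blast
    moreover have "addable ?T i"
      using last ne[of "i - 1"] by (auto simp: addable_def row_length_def nth_butlast)
    ultimately show thesis using e that by blast
  next
    case False
    let ?T = "U[i := r]"
    have e: "U = add_entry (Suc n) i ?T" using i r by (metis add_entry_def length_list_update list_update_id list_update_overwrite nth_list_update_eq)
    have "mset (concat U) = add_mset (Suc n) (mset (concat ?T))" by (subst e) (rule mset_add_entry)
    then have m: "mset (concat ?T) = mset_set {1..n}" using t unfolding mset_set_Suc by simp
    have "length (?T ! Suc k) \<le> length (?T ! k)" if "Suc k < length ?T" for k
    proof (cases "k = i")
      case True
      then show ?thesis using below that by simp
    next
      case False
      then show ?thesis using len[of k] that r by (cases "Suc k = i") auto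
    qed
    moreover have "?T ! k \<noteq> []" if "k < length ?T" for k
      using ne[of k] that False by (cases "k = i") auto
    moreover have "sorted_wrt (<) (?T ! k)" if "k < length ?T" for k
      using srt[of k] that r by (cases "k = i") (auto simp: sorted_wrt_append)
    moreover have "?T ! k ! j < ?T ! Suc k ! j" if "Suc k < length ?T" "j < length (?T ! Suc k)" for k j
    proof (cases "k = i")
      case True
      then have "j < length r" using that below by simp
      then show ?thesis using col[of k j] that True r by (simp add: nth_append)
    next
      case False
      then show ?thesis using col[of k j] that r by (cases "Suc k = i") (auto simp: nth_append)
    qed
    ultimately have "standard_young_tableau n ?T" unfolding syt_iff using m by blast
    moreover have "addable ?T i"
    proof (cases i)
      case (Suc i')
      then show ?thesis using i len[of i'] r by (simp add: addable_def row_length_def)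
    qed (simp add: addable_def)
    ultimately show thesis using e that by blast
  qed
qed

definition tableaux :: "nat \<Rightarrow> (nat \<Rightarrow> nat) \<Rightarrow> nat list list set" where
  "tableaux n f = {T. standard_young_tableau n T \<and> row_length T = f}"

lemma syt_0: "standard_young_tableau 0 T \<longleftrightarrow> T = []"
proof
  assume T: "standard_young_tableau 0 T"
  show "T = []"
  proof (cases T)
    case (Cons r T')
    then have "r \<noteq> []" "set r = {}" using T by (auto simp: standard_young_tableau_def shape_def)
    then show ?thesis by simp
  qed
qed (simp add: standard_young_tableau_def shape_def)

lemma finite_syt: "finite {T. standard_young_tableau n T}"
proof (induction n)
  case 0
  then show ?case by (simp add: syt_0)
next
  case (Suc n)
  let ?S = "{T. standard_young_tableau n T}"
  have "{T. standard_young_tableau (Suc n) T} \<subseteq> (\<Union>T\<in>?S. (\<lambda>i. add_entry (Suc n) i T) ` {..length T})"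
  proof
    fix U assume "U \<in> {T. standard_young_tableau (Suc n) T}"
    then obtain T i where "standard_young_tableau n T" "addable T i" "U = add_entry (Suc n) i T"
      using syt_remove_max by blast
    then show "U \<in> (\<Union>T\<in>?S. (\<lambda>i. add_entry (Suc n) i T) ` {..length T})" by (auto simp: addable_def)
  qed
  moreover have "finite (\<Union>T\<in>?S. (\<lambda>i. add_entry (Suc n) i T) ` {..length T})"
    using Suc by simp
  ultimately show ?case by (rule finite_subset)
qed

lemma finite_tableaux: "finite (tableaux n f)"
  by (rule finite_subset[OF _ finite_syt[of n]]) (auto simp: tableaux_def)

lemma row_length_pos_iff:
  "standard_young_tableau n T \<Longrightarrow> 0 < row_length T i \<longleftrightarrow> i < length T"
  by (auto simp: syt_iff row_length_def)

lemma row_length_antimono: "standard_young_tableau n T \<Longrightarrow> row_length T (Suc i) \<le> row_length T i"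
  by (auto simp: syt_iff row_length_def)

lemma add_entry_inj:
  assumes T: "standard_young_tableau n T" "i \<le> length T" and U: "standard_young_tableau n U" "i \<le> length U"
    and eq: "add_entry (Suc n) i T = add_entry (Suc n) i U"
  shows "T = U"
proof -
  have "row_length T i = row_length U i"
    using arg_cong[OF eq, of row_length] T U by (simp add: row_length_add_entry fun_eq_iff) (metis nat.inject)
  then have il: "i < length T \<longleftrightarrow> i < length U" using row_length_pos_iff T U by metis
  show ?thesis
  proof (cases "i < length T")
    case True
    then have u: "T[i := T ! i @ [Suc n]] = U[i := U ! i @ [Suc n]]" using eq il by (simp add: add_entry_def)
    then have l: "length T = length U" by (metis length_list_update)
    have "T ! k = U ! k" if "k < length T" for k
      using arg_cong[OF u, of "\<lambda>X. X ! k"] that l by (cases "k = i") auto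
    then show ?thesis using l by (simp add: list_eq_iff_nth_eq)
  qed (use eq il in \<open>simp add: add_entry_def\<close>)
qed

text \<open>
  Each tableau arises from one of size \<open>n\<close> by appending \<open>Suc n\<close> to a row. A row whose shortening
  destroys the shape contributes nothing, as there are no tableaux of the resulting row lengths.
  The predicate \<open>P\<close> allows for keeping track of \<open>chi\<close>.
\<close>

lemma card_tableaux_Suc:
  assumes f: "\<And>i. f (Suc i) \<le> f i" and fin: "finite {i. 0 < f i}"
  shows "card {T \<in> tableaux (Suc n) f. P T} =
    (\<Sum>i\<in>{i. 0 < f i}. card {T \<in> tableaux n (f(i := f i - 1)). P (add_entry (Suc n) i T)})"
proof -
  let ?A = "\<lambda>i. {T \<in> tableaux n (f(i := f i - 1)). P (add_entry (Suc n) i T)}"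
  have leT: "i \<le> length T" "addable T i" if T: "T \<in> ?A i" and i: "0 < f i" for T i
  proof -
    have s: "standard_young_tableau n T" "row_length T = f(i := f i - 1)" using T by (simp_all add: tableaux_def)
    have lt: "row_length T i < row_length T (i - 1)" if "0 < i"
    proof -
      have "f i \<le> f (i - 1)" using f[of "i - 1"] that by simp
      moreover have "i - 1 \<noteq> i" using that by simp
      ultimately show ?thesis using s(2) i by simp
    qed
    have "i \<le> length T"
    proof (cases "i = 0")
      case False
      then have "0 < row_length T (i - 1)" using lt by simp
      then show ?thesis using row_length_pos_iff[OF s(1), of "i - 1"] by simp
    qed simp
    then show "i \<le> length T" "addable T i" using lt by (auto simp: addable_def)
  qed
  have "{T \<in> tableaux (Suc n) f. P T} = (\<Union>i\<in>{i. 0 < f i}. add_entry (Suc n) i ` ?A i)" (is "?L = ?R")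
  proof
    show "?L \<subseteq> ?R"
    proof
      fix U assume U: "U \<in> ?L"
      then have "standard_young_tableau (Suc n) U" by (simp add: tableaux_def)
      then obtain T i where T: "standard_young_tableau n T" "addable T i" "U = add_entry (Suc n) i T"
        using syt_remove_max by blast
      have "f = (row_length T)(i := Suc (row_length T i))"
        using U T row_length_add_entry by (auto simp: tableaux_def addable_def)
      then have "0 < f i" "row_length T = f(i := f i - 1)" by auto
      then show "U \<in> ?R" using T U by (auto simp: tableaux_def)
    qed
    show "?R \<subseteq> ?L"
    proof
      fix U assume "U \<in> ?R"
      then obtain i T where T: "0 < f i" "T \<in> ?A i" "U = add_entry (Suc n) i T" by blast
      then show "U \<in> ?L"
        using leT[OF T(2,1)] syt_add_entry[of n T i] row_length_add_entry[of i T "Suc n"] by (auto simp: tableaux_def)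
    qed
  qed
  moreover have "card (\<Union>i\<in>{i. 0 < f i}. add_entry (Suc n) i ` ?A i) = (\<Sum>i\<in>{i. 0 < f i}. card (add_entry (Suc n) i ` ?A i))"
  proof (rule card_UN_disjoint[OF fin])
    show "\<forall>i\<in>{i. 0 < f i}. finite (add_entry (Suc n) i ` ?A i)" by (simp add: finite_tableaux)
    show "\<forall>i\<in>{i. 0 < f i}. \<forall>j\<in>{i. 0 < f i}. i \<noteq> j \<longrightarrow> add_entry (Suc n) i ` ?A i \<inter> add_entry (Suc n) j ` ?A j = {}"
    proof (intro ballI impI equals0I)
      fix i j U assume ij: "i \<in> {i. 0 < f i}" "j \<in> {i. 0 < f i}" "i \<noteq> j" and U: "U \<in> add_entry (Suc n) i ` ?A i \<inter> add_entry (Suc n) j ` ?A j"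
      then obtain T V where T: "T \<in> ?A i" "U = add_entry (Suc n) i T" and V: "V \<in> ?A j" "U = add_entry (Suc n) j V" by blast
      have "row_last U i = Suc n" using T(2) leT[OF T(1)] ij by (simp add: row_last_add_entry)
      moreover have "row_last U i = row_last V i" using V(2) leT[OF V(1)] ij by (simp add: row_last_add_entry)
      moreover have "row_last V i \<le> n"
      proof (cases "i < length V")
        case True
        have sV: "standard_young_tableau n V" using V(1) by (simp add: tableaux_def)
        then have "V ! i \<noteq> []" using True unfolding syt_iff by blast
        then have "last (V ! i) \<le> n" using syt_entries[OF sV True, of "last (V ! i)"] by simp
        then show ?thesis using True by (simp add: row_last_def)
      qed (simp add: row_last_def)
      ultimately show False by simp
    qed
  qed
  moreover have "card (add_entry (Suc n) i ` ?A i) = card (?A i)" if "i \<in> {i. 0 < f i}" for i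
  proof (rule card_image, rule inj_onI)
    fix T U assume "T \<in> ?A i" "U \<in> ?A i" "add_entry (Suc n) i T = add_entry (Suc n) i U"
    then show "T = U" using add_entry_inj[of n T i U] leT(1) that by (auto simp: tableaux_def)
  qed
  ultimately show ?thesis by simp
qed

lemma tableaux_not_antimono: "f i < f (Suc i) \<Longrightarrow> tableaux n f = {}"
  using row_length_antimono[of n _ i] by (auto simp: tableaux_def not_le[symmetric])

section \<open>Tableaux with two equal rows and a column\<close>

text \<open>
  The row lengths of the shape \<open>(a, b, 1, \<dots>, 1)\<close> with \<open>c\<close> rows of length one at the bottom.
\<close>

definition hook2 :: "nat \<Rightarrow> nat \<Rightarrow> nat \<Rightarrow> nat \<Rightarrow> nat" where
  "hook2 a b c i = (if i = 0 then a else if i = 1 then b else if i < c + 2 then 1 else 0)"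

definition hook2_count :: "nat \<Rightarrow> nat \<Rightarrow> nat \<Rightarrow> nat" where
  "hook2_count a b c = card (tableaux (a + b + c) (hook2 a b c))"

lemma hook2_count_antimono: "a < b \<Longrightarrow> hook2_count a b c = 0" "0 < c \<Longrightarrow> hook2_count a 0 c = 0"
proof -
  show "a < b \<Longrightarrow> hook2_count a b c = 0"
    unfolding hook2_count_def by (subst tableaux_not_antimono[of _ 0]) (auto simp: hook2_def)
  show "0 < c \<Longrightarrow> hook2_count a 0 c = 0"
    unfolding hook2_count_def by (subst tableaux_not_antimono[of _ 1]) (auto simp: hook2_def)
qed

lemma hook2_count_0: "hook2_count 0 0 0 = 1"
proof -
  have "tableaux 0 (hook2 0 0 0) = {[]}" by (auto simp: tableaux_def syt_0 row_length_def hook2_def fun_eq_iff)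
  then show ?thesis by (simp add: hook2_count_def)
qed

lemma hook2_count_rec:
  assumes "b \<le> a" "0 < c \<longrightarrow> 0 < b" "0 < a"
  shows "hook2_count a b c = hook2_count (a - 1) b c + (if 0 < b then hook2_count a (b - 1) c else 0) + (if 0 < c then hook2_count a b (c - 1) else 0)"
proof -
  let ?f = "hook2 a b c"
  define n where "n = a + b + c - 1"
  have n: "a + b + c = Suc n" "a - 1 + b + c = n" using assms by (simp_all add: n_def)
  have nb: "a + (b - 1) + c = n" if "0 < b" using that by (simp add: n_def)
  have nC: "a + b + (c - 1) = n" if "0 < c" using that by (simp add: n_def)
  have anti: "?f (Suc i) \<le> ?f i" for i using assms by (auto simp: hook2_def)
  have fin: "finite {i. 0 < ?f i}" by (rule finite_subset[of _ "{..c + 2}"]) (auto simp: hook2_def split: if_splits)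
  let ?g = "\<lambda>i. card (tableaux n (?f(i := ?f i - 1)))"
  have "hook2_count a b c = (\<Sum>i\<in>{i. 0 < ?f i}. ?g i)"
    unfolding hook2_count_def n using card_tableaux_Suc[of ?f n "\<lambda>_. True", OF anti fin] by simp
  also have "\<dots> = (\<Sum>i\<in>{0, 1, c + 2 - 1}. if 0 < ?f i then ?g i else 0)"
  proof (rule sum.mono_neutral_cong)
    show "finite {i. 0 < ?f i}" by (rule fin)
    fix i assume i: "i \<in> {i. 0 < ?f i} - {0, 1, c + 2 - 1}"
    then have "2 \<le> i" "i < c + 1" by (auto simp: hook2_def split: if_splits)
    then have "tableaux n (?f(i := ?f i - 1)) = {}"
      by (intro tableaux_not_antimono[of _ i]) (auto simp: hook2_def)
    then show "?g i = 0" by simp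
  qed auto
  also have "\<dots> = hook2_count (a - 1) b c + (if 0 < b then hook2_count a (b - 1) c else 0) + (if 0 < c then hook2_count a b (c - 1) else 0)"
  proof -
    have "?f(0 := ?f 0 - 1) = hook2 (a - 1) b c" "?f(1 := ?f 1 - 1) = hook2 a (b - 1) c"
      by (auto simp: hook2_def fun_eq_iff)
    moreover have "?f(c + 2 - 1 := ?f (c + 2 - 1) - 1) = hook2 a b (c - 1)" if "0 < c"
      using that by (auto simp: hook2_def fun_eq_iff)
    moreover have "?f 0 = a" "?f 1 = b" "0 < c \<Longrightarrow> ?f (c + 2 - 1) = 1" by (auto simp: hook2_def)
    ultimately show ?thesis using n nb nC assms(3) by (cases "0 < c") (simp_all add: hook2_count_def)
  qed
  finally show ?thesis .
qed

lemma hook2_count_row: "hook2_count a 0 0 = 1"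
  by (induction a) (simp_all add: hook2_count_0 hook2_count_rec)

text \<open>
  Giambelli's determinant for the Frobenius symbol \<open>(a-1, b-2 | c+1, 0)\<close>: each product of two
  binomial coefficients counts pairs of hook tableaux sharing out the entries.
\<close>

definition hook2_formula :: "nat \<Rightarrow> nat \<Rightarrow> nat \<Rightarrow> int" where
  "hook2_formula a b c = int (a + b + c choose (b - 1)) * int (a + c choose (c + 1)) - int (a + b + c choose a) * int (b + c - 1 choose (c + 1))"

lemma hook2_formula_rec:
  assumes "0 < a" "0 < b"
  shows "hook2_formula a b c = hook2_formula (a - 1) b c + (if 1 < b then hook2_formula a (b - 1) c else of_bool (c = 0)) + (if 0 < c then hook2_formula a b (c - 1) else 0)"
proof -
  obtain a' where a: "a = Suc a'" using assms by (cases a) auto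
  obtain b' where b: "b = Suc b'" using assms by (cases b) auto
  have sym: "(Suc (a' + b') choose Suc a') = (Suc (a' + b') choose b')"
    using binomial_symmetric[of b' "Suc (a' + b')"] by simp
  show ?thesis
  proof (cases b')
    case 0
    then show ?thesis unfolding hook2_formula_def a b by (cases c) (simp_all add: binomial_eq_0 algebra_simps)
  next
    case (Suc b'')
    show ?thesis
    proof (cases c)
      case 0
      have "(Suc (Suc (a' + b'')) choose Suc a') = (Suc (Suc (a' + b'')) choose Suc b'')" using sym Suc by simp
      then show ?thesis unfolding hook2_formula_def a b Suc 0 by (simp add: algebra_simps)
    next
      case (Suc c')
      then show ?thesis unfolding hook2_formula_def a b \<open>b' = Suc b''\<close> by (simp add: algebra_simps)
    qed
  qed
qed

lemma hook2_formula_wall: "0 < b \<Longrightarrow> hook2_formula (b - 1) b c = 0"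
  by (cases b) (simp_all add: hook2_formula_def)

lemma hook2_count_formula: "0 < b \<Longrightarrow> b \<le> a \<Longrightarrow> int (hook2_count a b c) = hook2_formula a b c"
proof (induction "a + b + c" arbitrary: a b c rule: less_induct)
  case less
  then have a: "0 < a" by simp
  have 1: "int (hook2_count (a - 1) b c) = hook2_formula (a - 1) b c"
  proof (cases "b = a")
    case True
    then show ?thesis using hook2_count_antimono(1)[of "a - 1" b c] hook2_formula_wall[OF less.prems(1), of c] a by simp
  qed (use less in auto)
  have 2: "int (if 0 < b then hook2_count a (b - 1) c else 0) = (if 1 < b then hook2_formula a (b - 1) c else of_bool (c = 0))"
  proof (cases "1 < b")
    case False
    then have "b = 1" using less.prems by simp
    then show ?thesis using hook2_count_antimono(2)[of c a] hook2_count_row[of a] by auto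
  qed (use less in auto)
  have 3: "int (if 0 < c then hook2_count a b (c - 1) else 0) = (if 0 < c then hook2_formula a b (c - 1) else 0)"
    using less by auto
  show ?case using hook2_count_rec[OF less.prems(2) _ a, of c] hook2_formula_rec[OF a less.prems(1), of c] 1 2 3 less.prems by simp
qed

text \<open>
  The two differences of products have the same value although their terms differ; adding the
  negative terms across leaves one instance of \<open>trinomial_swap13\<close>.
\<close>

lemma hook2_formula_riordan_number:
  assumes "1 \<le> k" "2 * k \<le> n"
  shows "hook2_formula k k (n - 2 * k) = riordan_number n k"
proof -
  obtain l where l: "k = Suc l" using assms by (cases k) auto
  obtain m where m: "n = 2 * k + m" using assms le_Suc_ex by blast
  have "(n choose l) * (Suc m + k choose Suc m) = (n choose k) * (l + Suc m choose Suc m)"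
    using trinomial_swap13[of l "Suc m" k] l m by (simp add: mult_2 add_ac del: binomial_Suc_Suc)
  then have e: "int (n choose l) * int (Suc m + k choose Suc m) = int (n choose k) * int (l + Suc m choose Suc m)"
    by (metis of_nat_mult)
  have s1: "(m + k choose k) = (m + k choose m)" "(l + m choose l) = (l + m choose m)"
    by (subst binomial_symmetric; simp)+
  have "hook2_formula k k (n - 2 * k) = int (n choose l) * int (m + k choose Suc m) - int (n choose k) * int (l + m choose Suc m)"
    using l m by (simp add: hook2_formula_def mult_2 add_ac del: binomial_Suc_Suc)
  moreover have "riordan_number n k = int (n choose k) * int (l + m choose m) - int (n choose l) * int (m + k choose m)"
    using l m s1 by (simp add: riordan_number_def mult_2 add_ac del: binomial_Suc_Suc)
  ultimately show ?thesis using e by (simp add: algebra_simps)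
qed

lemma syt_sum_row_length: "standard_young_tableau n T \<Longrightarrow> sum_list (map length T) = n"
proof -
  assume "standard_young_tableau n T"
  then have "mset (concat T) = mset_set {1..n}" unfolding syt_iff by blast
  from arg_cong[OF this, of size] show "sum_list (map length T) = n" by (simp add: length_concat)
qed

lemma shape_eq_iff:
  assumes "standard_young_tableau n T" "0 \<notin> set L"
  shows "shape T = L \<longleftrightarrow> row_length T = (\<lambda>i. if i < length L then L ! i else 0)"
proof
  assume "shape T = L"
  then show "row_length T = (\<lambda>i. if i < length L then L ! i else 0)"
    by (auto simp: shape_def row_length_def fun_eq_iff)
next
  assume eq: "row_length T = (\<lambda>i. if i < length L then L ! i else 0)"
  have "i < length T \<longleftrightarrow> i < length L" for i
  proof -
    have "0 < row_length T i \<longleftrightarrow> i < length L" unfolding eq using assms(2) nth_mem[of i L] by (cases "L ! i") auto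
    then show ?thesis using row_length_pos_iff[OF assms(1)] by simp
  qed
  then have l: "length T = length L" by (metis linorder_neq_iff)
  show "shape T = L"
  proof (rule nth_equalityI)
    fix i assume "i < length (shape T)"
    then show "shape T ! i = L ! i" using fun_cong[OF eq, of i] l by (simp add: shape_def row_length_def)
  qed (simp add: shape_def l)
qed

lemma card_two_row_hooks:
  assumes "1 \<le> k" "2 * k \<le> n"
  defines "G \<equiv> {T. standard_young_tableau n T \<and> shape T = [k, k] @ replicate (n - 2 * k) 1}"
  shows "finite G" "int (card G) = riordan_number n k"
proof -
  let ?L = "[k, k] @ replicate (n - 2 * k) 1"
  have L: "(\<lambda>i. if i < length ?L then ?L ! i else 0) = hook2 k k (n - 2 * k)"
    by (auto simp: fun_eq_iff hook2_def nth_append nth_Cons split: nat.splits)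
  have "G = tableaux n (hook2 k k (n - 2 * k))"
    unfolding G_def tableaux_def L[symmetric] using shape_eq_iff[of n _ ?L] assms(1) by auto
  moreover have "k + k + (n - 2 * k) = n" using assms by simp
  ultimately have "card G = hook2_count k k (n - 2 * k)" "finite G" by (simp_all add: hook2_count_def finite_tableaux)
  then show "finite G" "int (card G) = riordan_number n k" using hook2_count_formula[of k k "n - 2 * k"] hook2_formula_riordan_number[OF assms(1,2)] assms(1) by simp_all
qed

section \<open>Binomial formulas for tableaux with three rows\<close>

text \<open>
  The multinomial coefficient of \<open>(x, y, z)\<close>, vanishing as soon as one argument is negative. The
  factorization through \<open>y\<close> first is the one used to sum over shapes with fixed second row.
\<close>

definition multinom :: "int \<Rightarrow> int \<Rightarrow> int \<Rightarrow> int" where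
  "multinom x y z = ibinom (nat (x + y + z)) y * ibinom (nat (x + z)) z * of_bool (0 \<le> x + z)"

lemma ibinom_zero: "ibinom n 0 = 1"
  by (simp add: ibinom_def)

lemma multinom_eq: "x + y + z = int n \<Longrightarrow> x + z = int m \<Longrightarrow> multinom x y z = ibinom n y * ibinom m z"
  by (simp add: multinom_def)

lemma multinom_neg: "x < 0 \<or> y < 0 \<or> z < 0 \<Longrightarrow> multinom x y z = 0"
  by (auto simp: multinom_def ibinom_big)

lemma multinom_nat: "multinom (int a) (int b) (int c) = int ((a + b + c choose b) * (a + c choose c))"
  by (subst multinom_eq[of _ _ _ "a + b + c" "a + c"]) auto

lemma multinom_swap12: "multinom x y z = multinom y x z"
proof (cases "x < 0 \<or> y < 0 \<or> z < 0")
  case False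
  then obtain a b c where e: "x = int a" "y = int b" "z = int c" by (metis nonneg_int_cases not_less)
  have "(a + b + c choose b) * (a + c choose c) = (b + a + c choose a) * (b + c choose c)"
    using trinomial_swap12[of a b c] trinomial_swap13[of b a c] binomial_symmetric[of c "a + c"] binomial_symmetric[of c "b + c"]
    by (simp add: add_ac)
  then show ?thesis unfolding e multinom_nat by (rule arg_cong)
qed (auto simp: multinom_neg)

lemma multinom_swap13: "multinom x y z = multinom z y x"
proof (cases "x < 0 \<or> y < 0 \<or> z < 0")
  case False
  then obtain a b c where e: "x = int a" "y = int b" "z = int c" by (metis nonneg_int_cases not_less)
  have "(a + b + c choose b) * (a + c choose c) = (c + b + a choose b) * (c + a choose a)"
    using binomial_symmetric[of c "a + c"] by (simp add: add_ac)
  then show ?thesis unfolding e multinom_nat by (rule arg_cong)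
qed (auto simp: multinom_neg)

lemma multinom_swap23: "multinom x y z = multinom x z y"
  by (metis multinom_swap12 multinom_swap13)

lemma multinom_rec:
  assumes "x + y + z \<noteq> 0"
  shows "multinom x y z = multinom (x - 1) y z + multinom x (y - 1) z + multinom x y (z - 1)"
proof -
  consider "x < 0 \<or> y < 0 \<or> z < 0" | "0 \<le> x" "0 \<le> y" "0 \<le> z" by linarith
  then show ?thesis
  proof cases
    case 1
    then show ?thesis using multinom_neg[of x y z] multinom_neg[of "x - 1" y z] multinom_neg[of x "y - 1" z] multinom_neg[of x y "z - 1"] by auto
  next
    case 2
    define n where "n = nat (x + y + z - 1)"
    have n: "x + y + z = int (Suc n)" using 2 assms by (simp add: n_def)
    show ?thesis
    proof (cases "x + z = 0")
      case True
      then have "x = 0" "z = 0" using 2 by simp_all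
      then have "multinom x y z = ibinom (Suc n) y * ibinom 0 z" "multinom x (y - 1) z = ibinom n (y - 1) * ibinom 0 z"
        using n by (simp_all add: multinom_eq)
      moreover have "y = int (Suc n)" using \<open>x = 0\<close> \<open>z = 0\<close> n by simp
      moreover from this have "ibinom (Suc n) y = 1" by (simp only: ibinom_int binomial_n_n of_nat_1)
      moreover have "ibinom n (y - 1) = 1" using \<open>y = int (Suc n)\<close> by simp
      ultimately show ?thesis using \<open>x = 0\<close> \<open>z = 0\<close> by (simp add: multinom_neg ibinom_0)
    next
      case False
      define m where "m = nat (x + z - 1)"
      have m: "x + z = int (Suc m)" using 2 False by (simp add: m_def)
      have "multinom x y z = ibinom (Suc n) y * ibinom (Suc m) z" "multinom (x - 1) y z = ibinom n y * ibinom m z"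
        "multinom x (y - 1) z = ibinom n (y - 1) * ibinom (Suc m) z" "multinom x y (z - 1) = ibinom n y * ibinom m (z - 1)"
        using n m by (simp_all add: multinom_eq)
      then show ?thesis by (simp add: ibinom_Suc algebra_simps)
    qed
  qed
qed

text \<open>
  The determinantal formula for three rows: the six terms are the multinomial coefficients of the
  permuted row lengths (shifted by a staircase), with signs.
\<close>

definition syt3_formula :: "int \<Rightarrow> int \<Rightarrow> int \<Rightarrow> int" where
  "syt3_formula a b c = multinom a b c - multinom (a + 2) b (c - 2) - multinom a (b + 1) (c - 1) + multinom (a + 1) (b + 1) (c - 2)
     - multinom (a + 1) (b - 1) c + multinom (a + 2) (b - 1) (c - 1)"

lemma syt3_formula_rec:
  assumes "a + b + c \<noteq> 0"
  shows "syt3_formula a b c = syt3_formula (a - 1) b c + syt3_formula a (b - 1) c + syt3_formula a b (c - 1)"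
proof -
  note r = multinom_rec[of a b c] multinom_rec[of "a + 2" b "c - 2"] multinom_rec[of a "b + 1" "c - 1"] multinom_rec[of "a + 1" "b + 1" "c - 2"]
    multinom_rec[of "a + 1" "b - 1" c] multinom_rec[of "a + 2" "b - 1" "c - 1"]
  show ?thesis using r assms unfolding syt3_formula_def by (simp add: algebra_simps)
qed

text \<open>
  The formula is antisymmetric in the shifted row lengths, and here two of them coincide.
\<close>

lemma syt3_formula_wall1: "syt3_formula (b - 1) b c = 0"
proof -
  have e: "b - 1 + 2 = b + 1" "b - 1 + 1 = b" by simp_all
  show ?thesis
    using multinom_swap12[of "b - 1" b c] multinom_swap12[of "b + 1" b "c - 2"] multinom_swap12[of "b - 1" "b + 1" "c - 1"]
    unfolding syt3_formula_def e by simp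
qed

lemma syt3_formula_wall2: "syt3_formula a b (b + 1) = 0"
  using multinom_swap23[of a b "b + 1"] multinom_swap23[of "a + 2" b "b - 1"] multinom_swap23[of "a + 1" "b + 1" "b - 1"]
  unfolding syt3_formula_def by simp

lemma syt3_formula_wall3: "c < 0 \<Longrightarrow> syt3_formula a b c = 0"
  unfolding syt3_formula_def by (simp add: multinom_neg)

text \<open>
  The value of \<open>f(a, b, c) + f(a + 2, b, c - 2) + f(a + 4, b, c - 4) + \<dots>\<close>, where \<open>f\<close> is the number of tableaux
  with the given row lengths, provided that \<open>c \<le> b \<le> a\<close>. The case \<open>c = 0\<close> is set apart because \<open>c - 1\<close> is truncated.
\<close>

definition syt3_sum :: "nat \<Rightarrow> nat \<Rightarrow> nat \<Rightarrow> int" where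
  "syt3_sum a b c = int (a + b + c choose b) * int (a + c choose c)
     - (if c = 0 then 0 else int (a + b + c choose (b + 1)) * int (a + c - 2 choose (c - 1)))
     - ibinom (a + b + c) (int b - 1) * int (a + c choose c)"

text \<open>
  In the determinantal formula, grouped by the second argument of the multinomial coefficients, each
  pair of terms can be written as a difference of binomial coefficients two indices apart; this
  telescopes.
\<close>

lemma syt3_formula_sum:
  assumes "c = 0 \<or> 0 < a"
  shows "syt3_formula (int a) (int b) (int c) = syt3_sum a b c - (if c < 2 then 0 else syt3_sum (a + 2) b (c - 2))"
proof (cases "c = 0")
  case True
  have "syt3_formula (int a) (int b) 0 = multinom (int a) (int b) 0 - multinom (int a + 1) (int b - 1) 0"
    unfolding syt3_formula_def by (simp add: multinom_neg)
  also have "\<dots> = ibinom (a + b) (int b) - ibinom (a + b) (int b - 1)"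
    by (subst multinom_eq[of _ _ _ "a + b" a], simp, simp, subst multinom_eq[of _ _ _ "a + b" "a + 1"]) (simp_all add: ibinom_def)
  finally show ?thesis using True by (simp add: syt3_sum_def)
next
  case False
  define n where "n = a + b + c"
  define p where "p = a + c - 2"
  have ac: "a + c = Suc (Suc p)" using False assms by (simp add: p_def)
  have n: "int a + int b + int c = int n" by (simp add: n_def)
  have ac': "int a + int c = int (Suc (Suc p))" using ac by simp
  have t: "multinom (int a) (int b) (int c) = ibinom n (int b) * ibinom (Suc (Suc p)) (int c)"
    "multinom (int a + 2) (int b) (int c - 2) = ibinom n (int b) * ibinom (Suc (Suc p)) (int c - 2)"
    "multinom (int a) (int b + 1) (int c - 1) = ibinom n (int b + 1) * ibinom (Suc p) (int c - 1)"
    "multinom (int a + 1) (int b + 1) (int c - 2) = ibinom n (int b + 1) * ibinom (Suc p) (int c - 2)"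
    "multinom (int a + 1) (int b - 1) (int c) = ibinom n (int b - 1) * ibinom (Suc (Suc (Suc p))) (int c)"
    "multinom (int a + 2) (int b - 1) (int c - 1) = ibinom n (int b - 1) * ibinom (Suc (Suc (Suc p))) (int c - 1)"
    by (rule multinom_eq; use n ac' in linarith)+
  have syt3_sum: "syt3_sum a b c = ibinom n (int b) * ibinom (Suc (Suc p)) (int c) - ibinom n (int b + 1) * ibinom p (int c - 1)
      - ibinom n (int b - 1) * ibinom (Suc (Suc p)) (int c)"
  proof -
    have "ibinom n (int b + 1) = int (n choose (b + 1))" using ibinom_int[of n "b + 1"] by (simp only: of_nat_add of_nat_1)
    moreover have "ibinom p (int c - 1) = int (p choose (c - 1))" using ibinom_int[of p "c - 1"] False by (simp add: of_nat_diff)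
    ultimately show ?thesis using ac False unfolding syt3_sum_def n_def[symmetric] by (simp del: binomial_Suc_Suc)
  qed
  have tf2: "(if c < 2 then 0 else syt3_sum (a + 2) b (c - 2)) = ibinom n (int b) * ibinom (Suc (Suc p)) (int c - 2) - ibinom n (int b + 1) * ibinom p (int c - 3)
      - ibinom n (int b - 1) * ibinom (Suc (Suc p)) (int c - 2)"
  proof (cases "c < 2")
    case False
    then have e: "a + 2 + b + (c - 2) = n" "a + 2 + (c - 2) = Suc (Suc p)" "int (c - 2) = int c - 2" using ac by (simp_all add: n_def)
    have "syt3_sum (a + 2) b (c - 2) = ibinom n (int b) * ibinom (Suc (Suc p)) (int (c - 2)) - ibinom n (int b + 1) * ibinom p (int (c - 2) - 1)
      - ibinom n (int b - 1) * ibinom (Suc (Suc p)) (int (c - 2))"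
    proof (cases "c - 2 = 0")
      case True
      then show ?thesis unfolding syt3_sum_def e(1,2) by (simp add: ibinom_zero)
    next
      case False
      have "ibinom n (int b + 1) = int (n choose (b + 1))" using ibinom_int[of n "b + 1"] by (simp only: of_nat_add of_nat_1)
      moreover have "ibinom p (int (c - 2) - 1) = int (p choose (c - 2 - 1))" using ibinom_int[of p "c - 2 - 1"] False by (simp add: of_nat_diff)
      moreover have "ibinom (Suc (Suc p)) (int c - 2) = int (Suc (Suc p) choose (c - 2))"
        using ibinom_int[of "Suc (Suc p)" "c - 2"] e(3) by simp
      ultimately show ?thesis unfolding syt3_sum_def e(1,2) using False by (simp del: binomial_Suc_Suc)
    qed
    then show ?thesis using False unfolding e(3) by simp
  qed simp
  show ?thesis unfolding syt3_formula_def t syt3_sum tf2 by (simp add: ibinom_Suc algebra_simps del: ibinom_int)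
qed

text \<open>
  The number of tableaux with \<open>chi = 0\<close>, for \<open>0 < b\<close> and \<open>c \<le> b \<le> a\<close>. It sums the determinantal formula for row lengths
  \<open>(a, b - 1, i)\<close> over \<open>i \<le> c\<close>; grouped by the third argument, this is a hockey-stick summation.
\<close>

definition chi0_formula :: "nat \<Rightarrow> nat \<Rightarrow> nat \<Rightarrow> int" where
  "chi0_formula a b c = (let n = a + b + c; m = a + b in
     ibinom n (int c) * (ibinom (m - 1) (int b - 1) - ibinom (m - 1) (int b - 2))
     - ibinom n (int c - 1) * (ibinom m (int b) - ibinom m (int b - 2))
     + ibinom n (int c - 2) * (ibinom (m + 1) (int b) - ibinom (m + 1) (int b - 1)))"

lemma chi0_formula_rec:
  assumes "0 < b"
  shows "chi0_formula a b c = syt3_formula (int a) (int b - 1) (int c) + (if 0 < c then chi0_formula a b (c - 1) else 0)"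
proof -
  define N where "N = a + b + c - 1"
  define m where "m = a + b - 1"
  have N: "int a + (int b - 1) + int c = int N" "a + b + c = Suc N" using assms by (simp_all add: N_def)
  have m: "a + b = Suc m" using assms by (simp add: m_def)
  have sw: "multinom x y z = ibinom N z * ibinom k y" if "x + y + z = int N" "x + y = int k" for x y z k
    unfolding multinom_swap23[of x y z] by (rule multinom_eq) (use that in auto)
  have t: "multinom (int a) (int b - 1) (int c) = ibinom N (int c) * ibinom m (int b - 1)"
    "multinom (int a + 2) (int b - 1) (int c - 2) = ibinom N (int c - 2) * ibinom (Suc (Suc m)) (int b - 1)"
    "multinom (int a) (int b - 1 + 1) (int c - 1) = ibinom N (int c - 1) * ibinom (Suc m) (int b - 1 + 1)"
    "multinom (int a + 1) (int b - 1 + 1) (int c - 2) = ibinom N (int c - 2) * ibinom (Suc (Suc m)) (int b - 1 + 1)"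
    "multinom (int a + 1) (int b - 1 - 1) (int c) = ibinom N (int c) * ibinom m (int b - 1 - 1)"
    "multinom (int a + 2) (int b - 1 - 1) (int c - 1) = ibinom N (int c - 1) * ibinom (Suc m) (int b - 1 - 1)"
    by (rule sw; use N m in linarith)+
  define L where "L k = ibinom N (int c - k) * (ibinom m (int b - 1) - ibinom m (int b - 2))
     - ibinom N (int c - k - 1) * (ibinom (Suc m) (int b) - ibinom (Suc m) (int b - 2))
     + ibinom N (int c - k - 2) * (ibinom (Suc (Suc m)) (int b) - ibinom (Suc (Suc m)) (int b - 1))" for k
  have "syt3_formula (int a) (int b - 1) (int c) = L 0" unfolding syt3_formula_def t L_def by (simp add: algebra_simps)
  moreover have "chi0_formula a b c = L 0 + L 1"
    unfolding chi0_formula_def Let_def N(2) unfolding m L_def ibinom_Suc[of N] by (simp add: algebra_simps)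
  moreover have "(if 0 < c then chi0_formula a b (c - 1) else 0) = L 1"
  proof (cases "0 < c")
    case True
    then have e: "a + b + (c - 1) = N" "int (c - 1) = int c - 1" by (simp_all add: N_def)
    show ?thesis using True unfolding chi0_formula_def Let_def e unfolding m L_def by simp
  qed (simp add: L_def)
  ultimately show ?thesis by simp
qed

text \<open>
  The three products of \<open>syt3_sum\<close> become four when Pascal's rule is applied to the first one; these
  are two Riordan prefix numbers.
\<close>

lemma syt3_sum_rcount:
  "0 < a \<Longrightarrow> syt3_sum a b c = rcount a c b - (if c = 0 then 0 else rcount a (c - 1) (b + 1))"
proof (cases c)
  case 0
  then show ?thesis by (simp add: syt3_sum_def rcount_def)
next
  case (Suc c')
  assume "0 < a"
  then obtain a' where a: "a = Suc a'" by (cases a) auto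
  have "a + Suc c' + b = a + b + Suc c'" "a + c' + (b + 1) = a + b + Suc c'" "int (b + 1) - 1 = int b" by simp_all
  then show ?thesis unfolding syt3_sum_def rcount_def Suc using a by (simp add: algebra_simps)
qed

text \<open>
  Divided by \<open>K\<close>, the four products are polynomials of degree two. The identity carries the
  induction in \<open>skip_sum_chi0_high\<close>.
\<close>

lemma high_key:
  fixes a d :: nat
  defines "N \<equiv> a + 2 * d + 2" and "p \<equiv> a + d"
  shows "2 * ibinom (Suc N) (int d) * ibinom (Suc (Suc (Suc p))) (int d + 1) =
    ibinom N (int d + 1) * ibinom (Suc p) (int d) + ibinom N (int d - 1) * ibinom (Suc (Suc p)) (int d + 1)
    + ibinom (Suc (Suc N)) (int d + 1) * ibinom (Suc (Suc p)) (int d)"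
proof -
  \<comment> \<open>the common factor of the four products\<close>
  define K :: real where "K = fact N / (fact d * fact (Suc d) * fact (a + 2) * (real p + 3))"
  have d1: "int d + 1 = int (Suc d)" by simp
  have s: "N = a + 2 * d + 2" "p = a + d" by (simp_all add: N_def p_def)
  have 1: "real (Suc N choose d) * real (Suc (Suc (Suc p)) choose Suc d) = K * ((real N + 1) * (real p + 3))"
  proof -
    have "real (Suc N choose d) = fact (Suc N) / (fact d * fact (p + 3))" "real (p + 3 choose Suc d) = fact (p + 3) / (fact (Suc d) * fact (a + 2))"
      by (subst binomial_fact; simp add: s numeral_eq_Suc)+
    then have "real (Suc N choose d) * real (p + 3 choose Suc d) = fact (Suc N) / (fact d * fact (Suc d) * fact (a + 2))" by simp
    also have "\<dots> = K * ((real N + 1) * (real p + 3))"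
    proof -
      have "real p + 3 \<noteq> 0" by linarith
      then show ?thesis by (simp add: K_def divide_simps del: fact_Suc) (simp add: algebra_simps)
    qed
    finally show ?thesis by (simp add: numeral_eq_Suc)
  qed
  have 2: "real (N choose Suc d) * real (Suc p choose d) = K * ((real a + 2) * (real p + 3))"
  proof -
    have "real (N choose Suc d) = fact N / (fact (Suc d) * fact (p + 1))" "real (Suc p choose d) = fact (p + 1) / (fact d * fact (a + 1))"
      by (subst binomial_fact; simp add: s numeral_eq_Suc)+
    then have "real (N choose Suc d) * real (Suc p choose d) = fact N / (fact d * fact (Suc d) * fact (a + 1))" by simp
    moreover have "fact (a + 2) = (real a + 2) * fact (a + 1)" by simp
    moreover have "real p + 3 \<noteq> 0" "real a + 2 \<noteq> 0" by linarith+
    ultimately show ?thesis by (simp add: K_def divide_simps del: fact_Suc)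
  qed
  have 4: "real (Suc (Suc N) choose Suc d) * real (Suc (Suc p) choose d) = K * ((real N + 2) * (real N + 1))"
  proof -
    have b: "real (Suc (Suc N) choose Suc d) = fact (N + 2) / (fact (Suc d) * fact (p + 3))" "real (Suc (Suc p) choose d) = fact (p + 2) / (fact d * fact (a + 2))"
      by (subst binomial_fact; simp add: s numeral_eq_Suc)+
    have f: "fact (p + 3) = (real p + 3) * fact (p + 2)" "fact (N + 2) = (real N + 2) * (real N + 1) * fact N"
      by (simp_all add: numeral_eq_Suc algebra_simps)
    have "real p + 3 \<noteq> 0" by linarith
    then show ?thesis unfolding b f K_def by (simp add: divide_simps del: fact_Suc)
  qed
  have 3: "real_of_int (ibinom N (int d - 1)) * real (Suc (Suc p) choose Suc d) = K * (real d * (real a + 2))"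
  proof (cases d)
    case (Suc e)
    have z: "real_of_int (ibinom N (int d - 1)) = real (N choose e)" using Suc by (simp add: ibinom_def)
    have b: "real (N choose e) = fact N / (fact e * fact (p + 3))" "real (Suc (Suc p) choose Suc d) = fact (p + 2) / (fact (Suc d) * fact (a + 1))"
      by (subst binomial_fact; simp add: s Suc numeral_eq_Suc)+
    have f: "fact (p + 3) = (real p + 3) * fact (p + 2)" "fact (a + 2) = (real a + 2) * fact (a + 1)"
      by (simp_all add: numeral_eq_Suc algebra_simps)
    have fd: "(fact d :: real) = real d * fact e" using Suc by simp
    have "real p + 3 \<noteq> 0" "real a + 2 \<noteq> 0" "real d \<noteq> 0" using Suc by linarith+
    then show ?thesis unfolding z b f K_def fd by (simp add: divide_simps del: fact_Suc)
  qed (simp add: ibinom_def)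
  have "real_of_int (2 * ibinom (Suc N) (int d) * ibinom (Suc (Suc (Suc p))) (int d + 1)) =
    real_of_int (ibinom N (int d + 1) * ibinom (Suc p) (int d) + ibinom N (int d - 1) * ibinom (Suc (Suc p)) (int d + 1)
    + ibinom (Suc (Suc N)) (int d + 1) * ibinom (Suc (Suc p)) (int d))"
    unfolding d1 ibinom_int of_int_add of_int_mult of_int_of_nat_eq
    using 1 2 3 4 by (simp add: s del: binomial_Suc_Suc) (simp add: algebra_simps)
  then show ?thesis by linarith
qed

lemma ibinom_sym:
  assumes "i + j = int n" shows "ibinom n i = ibinom n j"
proof (cases "i < 0 \<or> j < 0")
  case False
  then obtain a b where "i = int a" "j = int b" by (metis nonneg_int_cases not_less)
  with assms have ab: "i = int a" "j = int b" "n = a + b" by simp_all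
  then show ?thesis using binomial_symmetric[of a "a + b"] by simp
qed (use assms in \<open>auto simp: ibinom_big\<close>)

lemma rcount_ibinom:
  assumes "0 < b + s"
  shows "rcount b s b = ibinom (s + 2 * b) (int b) * ibinom (b + s - 1) (int b - 1) - ibinom (s + 2 * b) (int b - 1) * ibinom (b + s) (int b)"
proof -
  have e: "b + s + b = s + 2 * b" by simp
  have "ibinom (b + s - 1) (int s) = ibinom (b + s - 1) (int b - 1)"
    by (rule ibinom_sym) (use assms in linarith)
  moreover have "ibinom (b + s) (int s) = ibinom (b + s) (int b)" by (rule ibinom_sym) simp
  ultimately show ?thesis unfolding rcount_def e by simp
qed

lemma syt3_sum_ibinom:
  assumes "0 < a + c"
  shows "syt3_sum a b c = ibinom (a + b + c) (int b) * ibinom (a + c) (int c) - (if c = 0 then 0 else ibinom (a + b + c) (int b + 1) * ibinom (a + c - 2) (int c - 1))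
     - ibinom (a + b + c) (int b - 1) * ibinom (a + c) (int c)"
proof (cases "c = 0")
  case False
  then have "ibinom (a + c - 2) (int c - 1) = int (a + c - 2 choose (c - 1))" "ibinom (a + b + c) (int b + 1) = int (a + b + c choose (b + 1))"
    using ibinom_int[of "a + c - 2" "c - 1"] ibinom_int[of "a + b + c" "b + 1"] by (simp_all add: of_nat_diff add_ac)
  then show ?thesis using False unfolding syt3_sum_def by simp
qed (simp add: syt3_sum_def ibinom_zero)

text \<open>
  After expansion by Pascal's rule, what remains is \<open>high_key\<close>.
\<close>

lemma high_rec:
  assumes "0 < b"
  shows "rcount b (a + 2) b - rcount b a b = syt3_sum (a + 2) (b - 1) (b - 1) + syt3_sum (a + 2) (b - 1) b - chi0_formula a b b"
proof -
  obtain d where b: "b = Suc d" using assms by (cases b) auto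
  define N where "N = a + 2 * d + 2"
  define p where "p = a + d"
  have i: "int b = int d + 1" "int b - 1 = int d" "int b - 2 = int d - 1" "int (b - 1) = int d" "b - 1 = d" using b by simp_all
  have r1: "rcount b (a + 2) b = ibinom (Suc (Suc N)) (int d + 1) * ibinom (Suc (Suc p)) (int d) - ibinom (Suc (Suc N)) (int d) * ibinom (Suc (Suc (Suc p))) (int d + 1)"
  proof -
    have e: "a + 2 + 2 * b = Suc (Suc N)" "b + (a + 2) - 1 = Suc (Suc p)" "b + (a + 2) = Suc (Suc (Suc p))"
      by (simp_all add: b N_def p_def)
    show ?thesis using rcount_ibinom[of b "a + 2"] unfolding e i by simp
  qed
  have r2: "rcount b a b = ibinom N (int d + 1) * ibinom p (int d) - ibinom N (int d) * ibinom (Suc p) (int d + 1)"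
  proof -
    have e: "a + 2 * b = N" "b + a - 1 = p" "b + a = Suc p" by (simp_all add: b N_def p_def)
    show ?thesis using rcount_ibinom[of b a] assms unfolding e i by simp
  qed
  have t1: "syt3_sum (a + 2) (b - 1) (b - 1) = ibinom N (int d) * ibinom (Suc (Suc p)) (int d) - ibinom N (int d + 1) * ibinom p (int d - 1)
      - ibinom N (int d - 1) * ibinom (Suc (Suc p)) (int d)"
  proof -
    have "a + 2 + d + d = N" "a + 2 + d = Suc (Suc p)" "a + 2 + d - 2 = p" by (simp_all add: N_def p_def)
    then show ?thesis using syt3_sum_ibinom[of "a + 2" d d] unfolding i by (cases "d = 0") simp_all
  qed
  have t2: "syt3_sum (a + 2) (b - 1) b = ibinom (Suc N) (int d) * ibinom (Suc (Suc (Suc p))) (int d + 1) - ibinom (Suc N) (int d + 1) * ibinom (Suc p) (int d)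
      - ibinom (Suc N) (int d - 1) * ibinom (Suc (Suc (Suc p))) (int d + 1)"
  proof -
    have "a + 2 + d + b = Suc N" "a + 2 + b = Suc (Suc (Suc p))" "a + 2 + b - 2 = Suc p" by (simp_all add: b N_def p_def)
    then show ?thesis using syt3_sum_ibinom[of "a + 2" b d] assms unfolding i by simp
  qed
  have l: "chi0_formula a b b = ibinom N (int d + 1) * (ibinom p (int d) - ibinom p (int d - 1))
     - ibinom N (int d) * (ibinom (Suc p) (int d + 1) - ibinom (Suc p) (int d - 1))
     + ibinom N (int d - 1) * (ibinom (Suc (Suc p)) (int d + 1) - ibinom (Suc (Suc p)) (int d))"
  proof -
    have "a + b + b = N" "a + b - 1 = p" "a + b = Suc p" "a + b + 1 = Suc (Suc p)" by (simp_all add: b N_def p_def)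
    then show ?thesis unfolding chi0_formula_def Let_def i(2,3) i(1) by simp
  qed
  note key = high_key[of a d, folded N_def p_def]
  have d2: "int d - 1 - 1 = int d - 2" "int d + 1 - 1 = int d" by simp_all
  have e: "ibinom (Suc N) x = ibinom N x + ibinom N (x - 1)" "ibinom (Suc p) x = ibinom p x + ibinom p (x - 1)"
    "ibinom (Suc (Suc N)) x = ibinom (Suc N) x + ibinom (Suc N) (x - 1)" "ibinom (Suc (Suc p)) x = ibinom (Suc p) x + ibinom (Suc p) (x - 1)"
    "ibinom (Suc (Suc (Suc p))) x = ibinom (Suc (Suc p)) x + ibinom (Suc (Suc p)) (x - 1)" for x
    by (rule ibinom_Suc)+
  show ?thesis unfolding r1 r2 t1 t2 l using key unfolding e d2
    by (simp add: algebra_simps del: ibinom_int)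
qed

lemma syt3_sum_sym: "0 < b \<Longrightarrow> 0 < a \<Longrightarrow> syt3_sum a b b = syt3_sum b b a"
  using binomial_symmetric[of b "a + b"] binomial_symmetric[of "b - 1" "a + b - 2"]
  by (simp add: syt3_sum_def add_ac)

text \<open>
  The prefix numbers extend formally to the line just below the axis, where they are the negatives
  of those on the axis. This reflection accounts for the tableaux with \<open>chi = 1\<close>.
\<close>

lemma syt3_sum_minus_rcount:
  assumes "0 < b" "2 \<le> s"
  shows "syt3_sum b b s - rcount b s b = rcount (b + 1) (s - 2) (b + 1)"
proof -
  obtain t where "s = 2 + t" using le_Suc_ex[OF assms(2)] by blast
  then have t: "s = Suc (Suc t)" by simp
  obtain d where b: "b = Suc d" using assms by (cases b) auto
  define n where "n = 2 * b + s"
  have n: "b + b + s = n" "b + 1 + (s - 2) + (b + 1) = n" "b + (s - 1) + (b + 1) = n" "b + s + b = n" using t by (simp_all add: n_def)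
  have k: "(n choose (b + 1)) * (t + 1 + b choose (t + 1)) = (n choose b) * (b + 1 + (t + 1) choose (t + 1))"
  proof -
    have "b + 1 + (t + 1) + b = n" using t by (simp add: n_def)
    then show ?thesis using trinomial_swap13[of "b + 1" "t + 1" b] by simp
  qed
  then have k: "int (n choose (b + 1)) * int (t + 1 + b choose (t + 1)) = int (n choose b) * int (b + 1 + (t + 1) choose (t + 1))"
    by (metis of_nat_mult)
  have x: "int (t + 1 + b choose (t + 1)) = int (b + t choose t) + int (b + t choose (t + 1))"
    "int (b + 1 + (t + 1) choose (t + 1)) = int (b + t + 1 choose t) + int (b + t + 1 choose (t + 1))"
    by (simp_all add: add_ac)
  have "syt3_sum b b s - rcount b s b = - rcount b (s - 1) (b + 1)" using syt3_sum_rcount[OF assms(1), of b s] assms by simp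
  also have "rcount b (s - 1) (b + 1) = int (n choose (b + 1)) * int (b + t choose (t + 1)) - int (n choose b) * int (b + t + 1 choose (t + 1))"
    unfolding rcount_def n by (simp add: t ibinom_def nat_add_distrib add_ac)
  also have "rcount (b + 1) (s - 2) (b + 1) = int (n choose (b + 1)) * int (b + t choose t) - int (n choose b) * int (b + t + 1 choose t)"
    unfolding rcount_def n by (simp add: t ibinom_def nat_add_distrib add_ac)
  then have "- (int (n choose (b + 1)) * int (b + t choose (t + 1)) - int (n choose b) * int (b + t + 1 choose (t + 1))) = rcount (b + 1) (s - 2) (b + 1)"
    using k unfolding x by (simp add: algebra_simps)
  finally show ?thesis .
qed

section \<open>Tableaux with three rows of equal parity\<close>

definition rows3 :: "nat \<Rightarrow> nat \<Rightarrow> nat \<Rightarrow> nat \<Rightarrow> nat" where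
  "rows3 a b c i = (if i = 0 then a else if i = 1 then b else if i = 2 then c else 0)"

lemma chi_add_entry:
  assumes T: "standard_young_tableau n T" and i: "i \<le> length T"
  shows "chi (add_entry (Suc n) i T) = (if i = 0 then 1 else if i = 1 then 0 else chi T)"
proof -
  have "row_last T j \<le> n" for j
  proof (cases "j < length T")
    case True
    then have "T ! j \<noteq> []" using T unfolding syt_iff by blast
    then have "last (T ! j) \<le> n" using syt_entries[OF T True, of "last (T ! j)"] by simp
    then show ?thesis using True by (simp add: row_last_def)
  qed (simp add: row_last_def)
  then have "\<not> Suc n < row_last T j" "row_last T j < Suc n" for j by (simp_all add: less_Suc_eq_le not_less le_SucI)
  then show ?thesis unfolding chi_def row_last_add_entry[OF i] by simp
qed

lemma card_rows3_Suc:
  assumes "b \<le> a" "c \<le> b"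
  shows "card {T \<in> tableaux (Suc n) (rows3 a b c). P T} =
    (if 0 < a then card {T \<in> tableaux n (rows3 (a - 1) b c). P (add_entry (Suc n) 0 T)} else 0)
    + (if 0 < b then card {T \<in> tableaux n (rows3 a (b - 1) c). P (add_entry (Suc n) 1 T)} else 0)
    + (if 0 < c then card {T \<in> tableaux n (rows3 a b (c - 1)). P (add_entry (Suc n) 2 T)} else 0)"
proof -
  let ?f = "rows3 a b c"
  have anti: "?f (Suc i) \<le> ?f i" for i using assms by (auto simp: rows3_def)
  have sub: "{i. 0 < ?f i} \<subseteq> {0, 1, 2}" by (auto simp: rows3_def split: if_splits)
  then have fin: "finite {i. 0 < ?f i}" by (rule finite_subset) simp
  let ?g = "\<lambda>i. card {T \<in> tableaux n (?f(i := ?f i - 1)). P (add_entry (Suc n) i T)}"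
  have "card {T \<in> tableaux (Suc n) ?f. P T} = (\<Sum>i\<in>{i. 0 < ?f i}. ?g i)"
    by (rule card_tableaux_Suc[OF anti fin])
  also have "\<dots> = (\<Sum>i\<in>{0, 1, 2}. if 0 < ?f i then ?g i else 0)"
    using sub by (intro sum.mono_neutral_cong_left) auto
  also have "\<dots> = (if 0 < ?f 0 then ?g 0 else 0) + (if 0 < ?f 1 then ?g 1 else 0) + (if 0 < ?f 2 then ?g 2 else 0)"
    by simp
  also have "?f(0 := ?f 0 - 1) = rows3 (a - 1) b c" by (auto simp: rows3_def fun_eq_iff)
  also have "?f(1 := ?f 1 - 1) = rows3 a (b - 1) c" by (auto simp: rows3_def fun_eq_iff)
  also have "?f(2 := ?f 2 - 1) = rows3 a b (c - 1)" by (auto simp: rows3_def fun_eq_iff)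
  also have "?f 0 = a" by (simp add: rows3_def)
  also have "?f 1 = b" by (simp add: rows3_def)
  also have "?f 2 = c" by (simp add: rows3_def)
  finally show ?thesis .
qed

definition syt3_count :: "nat \<Rightarrow> nat \<Rightarrow> nat \<Rightarrow> nat" where
  "syt3_count a b c = card (tableaux (a + b + c) (rows3 a b c))"

definition chi0_count :: "nat \<Rightarrow> nat \<Rightarrow> nat \<Rightarrow> nat" where
  "chi0_count a b c = card {T \<in> tableaux (a + b + c) (rows3 a b c). chi T = 0}"

lemma syt3_count_antimono: "a < b \<Longrightarrow> syt3_count a b c = 0" "b < c \<Longrightarrow> syt3_count a b c = 0"
proof -
  show "a < b \<Longrightarrow> syt3_count a b c = 0"
    unfolding syt3_count_def by (subst tableaux_not_antimono[of _ 0]) (auto simp: rows3_def)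
  show "b < c \<Longrightarrow> syt3_count a b c = 0"
    unfolding syt3_count_def by (subst tableaux_not_antimono[of _ 1]) (auto simp: rows3_def)
qed

lemma syt3_count_0: "syt3_count 0 0 0 = 1"
proof -
  have "tableaux 0 (rows3 0 0 0) = {[]}" by (auto simp: tableaux_def syt_0 row_length_def rows3_def fun_eq_iff)
  then show ?thesis by (simp add: syt3_count_def)
qed

lemma syt3_count_rec:
  assumes "b \<le> a" "c \<le> b" "0 < a"
  shows "syt3_count a b c = syt3_count (a - 1) b c + (if 0 < b then syt3_count a (b - 1) c else 0) + (if 0 < c then syt3_count a b (c - 1) else 0)"
proof -
  define n where "n = a + b + c - 1"
  have n: "a + b + c = Suc n" "a - 1 + b + c = n" using assms by (simp_all add: n_def)
  have nb: "a + (b - 1) + c = n" if "0 < b" using that by (simp add: n_def)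
  have nC: "a + b + (c - 1) = n" if "0 < c" using that by (simp add: n_def)
  have "syt3_count a b c = card (tableaux (Suc n) (rows3 a b c))" "syt3_count (a - 1) b c = card (tableaux n (rows3 (a - 1) b c))"
    unfolding syt3_count_def n by simp_all
  moreover have "syt3_count a (b - 1) c = card (tableaux n (rows3 a (b - 1) c))" if "0 < b" unfolding syt3_count_def nb[OF that] ..
  moreover have "syt3_count a b (c - 1) = card (tableaux n (rows3 a b (c - 1)))" if "0 < c" unfolding syt3_count_def nC[OF that] ..
  ultimately show ?thesis using card_rows3_Suc[OF assms(1,2), of n "\<lambda>_. True"] assms(3)
    by (cases "0 < b"; cases "0 < c") simp_all
qed

text \<open>
  The formula also holds on the line \<open>c = b + 1\<close> just outside the shapes, where both sides vanish.
  The sums over shapes with a shortened second row run into this line.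
\<close>

lemma syt3_count_formula: "b \<le> a \<Longrightarrow> c \<le> b + 1 \<Longrightarrow> int (syt3_count a b c) = syt3_formula (int a) (int b) (int c)"
proof (induction "a + b + c" arbitrary: a b c rule: less_induct)
  case less
  consider "c = b + 1" | "c \<le> b" "a = 0" | "c \<le> b" "0 < a" using less.prems by linarith
  then show ?case
  proof cases
    case 1
    then show ?thesis using syt3_count_antimono(2)[of b c a] syt3_formula_wall2[of "int a" "int b"] by (simp add: add.commute)
  next
    case 2
    then have "a = 0" "b = 0" "c = 0" using less.prems by simp_all
    moreover have "syt3_formula 0 0 0 = 1" by (simp add: syt3_formula_def multinom_neg) (simp add: multinom_def ibinom_def)
    ultimately show ?thesis by (simp add: syt3_count_0)
  next
    case 3
    have 1: "int (syt3_count (a - 1) b c) = syt3_formula (int a - 1) (int b) (int c)"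
    proof (cases "b = a")
      case True
      then show ?thesis using syt3_count_antimono(1)[of "a - 1" b c] syt3_formula_wall1[of "int b" "int c"] 3 by simp
    next
      case False
      then have "int (syt3_count (a - 1) b c) = syt3_formula (int (a - 1)) (int b) (int c)" using less 3 by (intro less.hyps) auto
      then show ?thesis using 3 by (simp add: of_nat_diff)
    qed
    have 2: "int (if 0 < b then syt3_count a (b - 1) c else 0) = syt3_formula (int a) (int b - 1) (int c)"
    proof (cases "0 < b")
      case True
      then have "int (syt3_count a (b - 1) c) = syt3_formula (int a) (int (b - 1)) (int c)" using less 3 by (intro less.hyps) auto
      then show ?thesis using True by (simp add: of_nat_diff)
    next
      case False
      then have "b = 0" "c = 0" using 3 by simp_all
      then show ?thesis by (simp add: syt3_formula_def multinom_neg)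
    qed
    have 4: "int (if 0 < c then syt3_count a b (c - 1) else 0) = syt3_formula (int a) (int b) (int c - 1)"
    proof (cases "0 < c")
      case True
      then have "int (syt3_count a b (c - 1)) = syt3_formula (int a) (int b) (int (c - 1))" using less 3 by (intro less.hyps) auto
      then show ?thesis using True by (simp add: of_nat_diff)
    qed (simp add: syt3_formula_wall3)
    show ?thesis using syt3_count_rec[OF less.prems(1) 3] 1 2 4 syt3_formula_rec[of "int a" "int b" "int c"] 3 by simp
  qed
qed

text \<open>
  With \<open>chi = 0\<close>, the largest entry lies in row 2, and then nothing is required of the remaining
  tableau, or in row 3, and then \<open>chi\<close> is the same after its removal.
\<close>

lemma chi0_count_rec:
  assumes "0 < b" "b \<le> a" "c \<le> b"
  shows "chi0_count a b c = syt3_count a (b - 1) c + (if 0 < c then chi0_count a b (c - 1) else 0)"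
proof -
  define n where "n = a + b + c - 1"
  have n: "a + b + c = Suc n" "a + (b - 1) + c = n" using assms by (simp_all add: n_def)
  have nC: "a + b + (c - 1) = n" if "0 < c" using that by (simp add: n_def)
  have len: "1 \<le> length T" if "T \<in> tableaux n (rows3 a b' c')" for T b' c'
  proof -
    have "0 < row_length T 0" using that assms by (simp add: tableaux_def rows3_def)
    then show ?thesis using that row_length_pos_iff[of n T 0] by (simp add: tableaux_def Suc_le_eq)
  qed
  have len2: "2 \<le> length T" if "T \<in> tableaux n (rows3 a b c')" for T c'
  proof -
    have "0 < row_length T 1" using that assms by (simp add: tableaux_def rows3_def)
    then show ?thesis using that row_length_pos_iff[of n T 1] by (simp add: tableaux_def)
  qed
  have e0: "{T \<in> tableaux n (rows3 (a - 1) b c). chi (add_entry (Suc n) 0 T) = 0} = {}"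
    by (auto simp: chi_add_entry tableaux_def)
  have e1: "{T \<in> tableaux n (rows3 a (b - 1) c). chi (add_entry (Suc n) 1 T) = 0} = tableaux n (rows3 a (b - 1) c)"
    using len by (auto simp: chi_add_entry tableaux_def)
  have e2: "{T \<in> tableaux n (rows3 a b (c - 1)). chi (add_entry (Suc n) 2 T) = 0} = {T \<in> tableaux n (rows3 a b (c - 1)). chi T = 0}"
    using len2[of _ "c - 1"] by (auto simp: chi_add_entry tableaux_def)
  show ?thesis unfolding chi0_count_def syt3_count_def n
    using card_rows3_Suc[OF assms(2,3), of n "\<lambda>T. chi T = 0"] assms(1) nC unfolding e0 e1 e2 by simp
qed

lemma chi0_count_formula: "0 < b \<Longrightarrow> b \<le> a \<Longrightarrow> c \<le> b \<Longrightarrow> int (chi0_count a b c) = chi0_formula a b c"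
proof (induction c)
  case 0
  then show ?case using chi0_count_rec[of b a 0] chi0_formula_rec[of b a 0] syt3_count_formula[of "b - 1" a 0] by (simp add: of_nat_diff)
next
  case (Suc c)
  then show ?case using chi0_count_rec[of b a "Suc c"] chi0_formula_rec[of b a "Suc c"] syt3_count_formula[of "b - 1" a "Suc c"] by (simp add: of_nat_diff)
qed

text \<open>
  The sum over the shapes with a fixed second row, in which the first row grows by two at the expense
  of the third. This step keeps the parities of all rows.
\<close>

definition skip_sum :: "(nat \<Rightarrow> nat \<Rightarrow> nat) \<Rightarrow> nat \<Rightarrow> nat \<Rightarrow> nat" where
  "skip_sum g a c = (\<Sum>i\<le>c div 2. g (a + 2 * i) (c - 2 * i))"

lemma skip_sum_rec: "skip_sum g a c = g a c + (if c < 2 then 0 else skip_sum g (a + 2) (c - 2))"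
proof (cases "c < 2")
  case False
  then have c: "c div 2 = Suc ((c - 2) div 2)" by simp
  have "skip_sum g a c = g a c + (\<Sum>i\<le>(c - 2) div 2. g (a + 2 * Suc i) (c - 2 * Suc i))"
    unfolding skip_sum_def c by (subst sum.atMost_Suc_shift) simp
  also have "(\<Sum>i\<le>(c - 2) div 2. g (a + 2 * Suc i) (c - 2 * Suc i)) = skip_sum g (a + 2) (c - 2)"
    unfolding skip_sum_def by (rule sum.cong) (simp_all add: diff_diff_add)
  finally show ?thesis using False by simp
qed (simp add: skip_sum_def)

lemma skip_sum_syt3_count:
  "b \<le> a \<Longrightarrow> c \<le> b + 1 \<Longrightarrow> c = 0 \<or> 0 < a \<Longrightarrow> int (skip_sum (\<lambda>a c. syt3_count a b c) a c) = syt3_sum a b c"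
proof (induction c arbitrary: a rule: less_induct)
  case (less c)
  have "int (syt3_count a b c) = syt3_sum a b c - (if c < 2 then 0 else syt3_sum (a + 2) b (c - 2))"
    using syt3_count_formula[OF less.prems(1,2)] syt3_formula_sum[of c a b] less.prems(3) by auto
  moreover have "int (skip_sum (\<lambda>a c. syt3_count a b c) (a + 2) (c - 2)) = syt3_sum (a + 2) b (c - 2)" if "\<not> c < 2"
    using less.prems that by (intro less.IH) auto
  ultimately show ?case using skip_sum_rec[of "\<lambda>a c. syt3_count a b c" a c] by auto
qed

lemma skip_sum_chi0_step:
  "0 < b \<Longrightarrow> b \<le> a \<Longrightarrow> c \<le> b \<Longrightarrow>
    int (skip_sum (\<lambda>a c. chi0_count a b c) a c) = syt3_sum a (b - 1) c + (if 0 < c then int (skip_sum (\<lambda>a c. chi0_count a b c) a (c - 1)) else 0)"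
proof (induction c arbitrary: a rule: less_induct)
  case (less c)
  let ?V = "skip_sum (\<lambda>a c. chi0_count a b c)"
  have p: "int (syt3_count a (b - 1) c) = syt3_sum a (b - 1) c - (if c < 2 then 0 else syt3_sum (a + 2) (b - 1) (c - 2))"
    using syt3_count_formula[of "b - 1" a c] syt3_formula_sum[of c a "b - 1"] less.prems by auto
  have IH: "int (?V (a + 2) (c - 2)) = syt3_sum (a + 2) (b - 1) (c - 2) + (if 0 < c - 2 then int (?V (a + 2) (c - 2 - 1)) else 0)" if "\<not> c < 2"
    using less.prems that by (intro less.IH) auto
  have r1: "?V a c = chi0_count a b c + (if c < 2 then 0 else ?V (a + 2) (c - 2))" by (rule skip_sum_rec)
  have r2: "?V a (c - 1) = chi0_count a b (c - 1) + (if c < 3 then 0 else ?V (a + 2) (c - 2 - 1))"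
  proof -
    have e: "c - 1 - 2 = c - 2 - 1" "c - 1 < 2 \<longleftrightarrow> c < 3" by auto
    show ?thesis using skip_sum_rec[of "\<lambda>a c. chi0_count a b c" a "c - 1"] unfolding e .
  qed
  have r3: "chi0_count a b c = syt3_count a (b - 1) c + (if 0 < c then chi0_count a b (c - 1) else 0)"
    by (rule chi0_count_rec[OF less.prems])
  consider "c = 0" | "c = 1" | "c = 2" | "3 \<le> c" by linarith
  then show ?case
    by cases (use p IH r1 r2 r3 in auto)
qed

text \<open>
  With the first two rows equally long at the start of the summation, the recursion for
  \<open>chi = 0\<close> has the same increments as the Riordan prefix numbers on the axis.
\<close>

lemma skip_sum_chi0_low: "0 < b \<Longrightarrow> c \<le> b \<Longrightarrow> int (skip_sum (\<lambda>a c. chi0_count a b c) b c) = rcount b c b"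
proof (induction c)
  case 0
  obtain d where d: "b = Suc d" using 0 by (cases b) auto
  show ?case using skip_sum_chi0_step[of b b 0] syt3_sum_rcount[of b d 0] rcount_diag[of d 0] d by simp
next
  case (Suc c)
  obtain d where d: "b = Suc d" using Suc by (cases b) auto
  show ?case using skip_sum_chi0_step[of b b "Suc c"] Suc syt3_sum_rcount[of b d "Suc c"] rcount_diag[of d "Suc c"] d by simp
qed

text \<open>
  If \<open>n\<close> exceeds three times the second row, the summation starts where the last two rows have
  equal length, and \<open>n\<close> is increased in steps of two. The induction starts from the case of
  \<open>skip_sum_chi0_low\<close> in which all three rows are equal at first.
\<close>

lemma skip_sum_chi0_high:
  assumes "0 < b"
  shows "int (skip_sum (\<lambda>a c. chi0_count a b c) (b + 2 * j) b) = rcount b (b + 2 * j) b"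
proof (induction j)
  case 0
  then show ?case using skip_sum_chi0_low[OF assms le_refl] by simp
next
  case (Suc j)
  let ?V = "skip_sum (\<lambda>a c. chi0_count a b c)"
  let ?a = "b + 2 * j"
  have a: "b + 2 * Suc j = ?a + 2" by simp
  have 1: "int (?V (?a + 2) b) = syt3_sum (?a + 2) (b - 1) b + int (?V (?a + 2) (b - 1))"
    using skip_sum_chi0_step[of b "?a + 2" b] assms by simp
  have 2: "int (?V (?a + 2) (b - 1)) = syt3_sum (?a + 2) (b - 1) (b - 1) + (if 2 \<le> b then int (?V (?a + 2) (b - 2)) else 0)"
    using skip_sum_chi0_step[of b "?a + 2" "b - 1"] assms by (auto simp: diff_diff_add numeral_2_eq_2)
  have 3: "int (?V ?a b) = chi0_formula ?a b b + (if 2 \<le> b then int (?V (?a + 2) (b - 2)) else 0)"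
    using skip_sum_rec[of "\<lambda>a c. chi0_count a b c" ?a b] chi0_count_formula[of b ?a b] assms by (auto simp: not_less)
  show ?case using high_rec[OF assms, of ?a] 1 2 3 Suc.IH unfolding a by simp
qed

definition parity_class :: "nat \<Rightarrow> nat \<Rightarrow> nat \<Rightarrow> nat list list set" where
  "parity_class n b x = {T \<in> syt_le3_same_parity n. row_length T 1 = b \<and> chi T = x}"

lemma row_length_rows3:
  assumes "standard_young_tableau n T" "length T \<le> 3"
  shows "row_length T = rows3 (row_length T 0) (row_length T 1) (row_length T 2)"
    and "row_length T 0 + row_length T 1 + row_length T 2 = n"
proof -
  show "row_length T = rows3 (row_length T 0) (row_length T 1) (row_length T 2)"
    using assms(2) by (auto simp: rows3_def row_length_def fun_eq_iff)
  consider "T = []" | r where "T = [r]" | r s where "T = [r, s]" | r s t where "T = [r, s, t]"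
    using assms(2) by (auto simp: numeral_3_eq_3 le_Suc_eq length_Suc_conv)
  then show "row_length T 0 + row_length T 1 + row_length T 2 = n"
    using syt_sum_row_length[OF assms(1)] by cases (simp_all add: row_length_def)
qed

lemma tableaux_rows3_length:
  assumes "T \<in> tableaux n (rows3 a b c)" shows "length T \<le> 3"
proof (rule ccontr)
  assume "\<not> length T \<le> 3"
  then have "0 < row_length T 3" using row_length_pos_iff[of n T 3] assms by (simp add: tableaux_def)
  then show False using assms by (simp add: tableaux_def rows3_def)
qed

lemma same_parity_iff:
  "T \<in> syt_le3_same_parity n \<longleftrightarrow> standard_young_tableau n T \<and> length T \<le> 3 \<and>
    (even (row_length T 0) = even (row_length T 1)) \<and> (even (row_length T 1) = even (row_length T 2))"
  unfolding syt_le3_same_parity_def all_less_3 by auto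

text \<open>
  Among the shapes with second row \<open>b\<close> and equal parities there is one with shortest first row:
  there, the first row or the third row is as long as the second one.
\<close>

lemma card_parity_class:
  assumes n: "n = a0 + b + c0" and le: "b \<le> a0" "c0 \<le> b" and extreme: "a0 = b \<or> c0 = b"
    and par: "even a0 = even b" "even c0 = even b"
  shows "card (parity_class n b x) = skip_sum (\<lambda>a c. card {T \<in> tableaux (a + b + c) (rows3 a b c). chi T = x}) a0 c0"
proof -
  let ?A = "\<lambda>i. {T \<in> tableaux n (rows3 (a0 + 2 * i) b (c0 - 2 * i)). chi T = x}"
  have "parity_class n b x = (\<Union>i\<in>{..c0 div 2}. ?A i)"
  proof
    show "parity_class n b x \<subseteq> (\<Union>i\<in>{..c0 div 2}. ?A i)"
    proof
      fix T assume T: "T \<in> parity_class n b x"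
      let ?a = "row_length T 0" and ?c = "row_length T 2"
      have s: "standard_young_tableau n T" "length T \<le> 3" "row_length T 1 = b" "chi T = x"
        "even ?a = even b" "even b = even ?c"
        using T[unfolded parity_class_def mem_Collect_eq same_parity_iff] by (elim conjE, simp)+
      have r: "row_length T = rows3 ?a b ?c" "?a + b + ?c = n" using row_length_rows3[OF s(1,2)] s(3) by simp_all
      have "b \<le> ?a" "?c \<le> b" using row_length_antimono[OF s(1), of 0] row_length_antimono[OF s(1), of 1] s(3)
        by (simp_all add: numeral_2_eq_2)
      then have "a0 \<le> ?a" "?c \<le> c0" using extreme r(2) n by auto
      moreover have "even (?a - a0)" using s(5) par calculation(1) by auto
      then obtain i where i: "?a - a0 = 2 * i" by (rule evenE)
      ultimately have "?a = a0 + 2 * i" "?c = c0 - 2 * i" "i \<le> c0 div 2" using r(2) n by auto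
      then show "T \<in> (\<Union>i\<in>{..c0 div 2}. ?A i)" using r s by (auto simp: tableaux_def intro!: bexI[of _ i])
    qed
    show "(\<Union>i\<in>{..c0 div 2}. ?A i) \<subseteq> parity_class n b x"
    proof
      fix T assume "T \<in> (\<Union>i\<in>{..c0 div 2}. ?A i)"
      then obtain i where i: "i \<le> c0 div 2" "T \<in> tableaux n (rows3 (a0 + 2 * i) b (c0 - 2 * i))" "chi T = x" by auto
      have r: "row_length T 0 = a0 + 2 * i" "row_length T 1 = b" "row_length T 2 = c0 - 2 * i" "standard_young_tableau n T"
        using i(2) by (auto simp: tableaux_def rows3_def)
      then show "T \<in> parity_class n b x"
        using tableaux_rows3_length[OF i(2)] i par by (auto simp: parity_class_def same_parity_iff)
    qed
  qed
  moreover have "card (\<Union>i\<in>{..c0 div 2}. ?A i) = (\<Sum>i\<in>{..c0 div 2}. card (?A i))"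
  proof (rule card_UN_disjoint)
    show "\<forall>i\<in>{..c0 div 2}. finite (?A i)" by (simp add: finite_tableaux)
    show "\<forall>i\<in>{..c0 div 2}. \<forall>j\<in>{..c0 div 2}. i \<noteq> j \<longrightarrow> ?A i \<inter> ?A j = {}"
    proof (intro ballI impI equals0I)
      fix i j T assume "i \<noteq> j" "T \<in> ?A i \<inter> ?A j"
      then have "rows3 (a0 + 2 * i) b (c0 - 2 * i) 0 = rows3 (a0 + 2 * j) b (c0 - 2 * j) 0"
        by (auto simp: tableaux_def)
      then show False using \<open>i \<noteq> j\<close> by (simp add: rows3_def)
    qed
  qed simp
  moreover have "(\<Sum>i\<in>{..c0 div 2}. card (?A i)) = skip_sum (\<lambda>a c. card {T \<in> tableaux (a + b + c) (rows3 a b c). chi T = x}) a0 c0"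
    unfolding skip_sum_def
  proof (rule sum.cong[OF refl])
    fix i assume "i \<in> {..c0 div 2}"
    then have "a0 + 2 * i + b + (c0 - 2 * i) = n" using n by auto
    then show "card (?A i) = card {T \<in> tableaux (a0 + 2 * i + b + (c0 - 2 * i)) (rows3 (a0 + 2 * i) b (c0 - 2 * i)). chi T = x}" by simp
  qed
  ultimately show ?thesis by simp
qed

lemma extreme_rows:
  fixes n b :: nat
  assumes "2 * b \<le> n" "even n = even b"
  obtains a0 c0 where "n = a0 + b + c0" "b \<le> a0" "c0 \<le> b" "a0 = b \<or> c0 = b" "even a0 = even b" "even c0 = even b"
    "a0 = b \<and> c0 = n - 2 * b \<or> c0 = b \<and> a0 = n - 2 * b"
proof (cases "n \<le> 3 * b")
  case True
  show thesis by (rule that[of b "n - 2 * b"]) (use assms True in auto)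
next
  case False
  show thesis by (rule that[of "n - 2 * b" b]) (use assms False in auto)
qed

lemma rcount_riordan_number:
  assumes "1 \<le> k" "2 * k \<le> n"
  shows "rcount k (n - 2 * k) k = riordan_number n k"
  using card_riordan_paths[OF assms] card_rprefixes[of k k "n - 2 * k"] by simp

lemma card_parity_class_0:
  assumes "1 \<le> k" "2 * k \<le> n" "even n = even k"
  shows "int (card (parity_class n k 0)) = riordan_number n k"
proof -
  obtain a0 c0 where e: "n = a0 + k + c0" "k \<le> a0" "c0 \<le> k" "a0 = k \<or> c0 = k" "even a0 = even k" "even c0 = even k"
    "a0 = k \<and> c0 = n - 2 * k \<or> c0 = k \<and> a0 = n - 2 * k" using extreme_rows[OF assms(2,3)] .
  have "card (parity_class n k 0) = skip_sum (\<lambda>a c. chi0_count a k c) a0 c0"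
    unfolding chi0_count_def by (rule card_parity_class[OF e(1-6)])
  moreover have "int (skip_sum (\<lambda>a c. chi0_count a k c) a0 c0) = rcount k (n - 2 * k) k"
    using e(7)
  proof
    assume "a0 = k \<and> c0 = n - 2 * k"
    then show ?thesis using skip_sum_chi0_low[of k c0] e(3) assms(1) by auto
  next
    assume h: "c0 = k \<and> a0 = n - 2 * k"
    have "even (a0 - k)" using e(2,5) by simp
    then obtain j where "a0 - k = 2 * j" by (rule evenE)
    then have "a0 = k + 2 * j" using e(2) by simp
    then show ?thesis using skip_sum_chi0_high[of k j] assms(1) h by simp
  qed
  ultimately show ?thesis using rcount_riordan_number[OF assms(1,2)] by simp
qed

lemma chi_le: "chi T = 0 \<or> chi T = 1"
  by (simp add: chi_def)

text \<open>
  These tableaux are the complement of those with \<open>chi = 0\<close>. An empty second row is special, as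
  its last entry counts as \<open>0\<close>; then the only tableau is a single row.
\<close>

lemma card_parity_class_1:
  assumes "2 * (b + 1) \<le> n" "even n = even b"
  shows "int (card (parity_class n b 1)) = riordan_number n (b + 1)"
proof -
  have b2: "2 * b \<le> n" using assms by simp
  obtain a0 c0 where e: "n = a0 + b + c0" "b \<le> a0" "c0 \<le> b" "a0 = b \<or> c0 = b" "even a0 = even b" "even c0 = even b"
    "a0 = b \<and> c0 = n - 2 * b \<or> c0 = b \<and> a0 = n - 2 * b" using extreme_rows[OF b2 assms(2)] .
  let ?xi = "\<lambda>a c. card {T \<in> tableaux (a + b + c) (rows3 a b c). chi T = 1}"
  have c: "card (parity_class n b 1) = skip_sum ?xi a0 c0" by (rule card_parity_class[OF e(1-6)])
  show ?thesis
  proof (cases "b = 0")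
    case True
    then have a0: "a0 = n" "c0 = 0" using e by auto
    obtain n' where n': "n = Suc n'" using assms by (cases n) auto
    have "{T \<in> tableaux n' (rows3 n' 0 0). chi (add_entry (Suc n') 0 T) = 1} = tableaux n' (rows3 n' 0 0)"
      by (auto simp: chi_add_entry tableaux_def)
    then have "?xi n 0 = syt3_count n' 0 0"
      using card_rows3_Suc[of 0 n 0 n' "\<lambda>T. chi T = 1"] True n' by (simp add: syt3_count_def)
    also have "int (syt3_count n' 0 0) = 1"
      using syt3_count_formula[of 0 n' 0] syt3_formula_sum[of 0 n' 0] by (simp add: syt3_sum_def)
    finally have "int (?xi n 0) = 1" .
    moreover have "riordan_number n 1 = 1" using assms by (simp add: riordan_number_def of_nat_diff)
    ultimately show ?thesis using c a0 True by (simp add: skip_sum_def)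
  next
    case False
    have "syt3_count a b c = chi0_count a b c + ?xi a c" for a c
    proof -
      let ?S = "tableaux (a + b + c) (rows3 a b c)"
      have "?S = {T \<in> ?S. chi T = 0} \<union> {T \<in> ?S. chi T = 1}" using chi_le by auto
      moreover have "card ({T \<in> ?S. chi T = 0} \<union> {T \<in> ?S. chi T = 1}) = card {T \<in> ?S. chi T = 0} + card {T \<in> ?S. chi T = 1}"
        by (rule card_Un_disjoint) (auto simp: finite_tableaux)
      ultimately show ?thesis unfolding syt3_count_def chi0_count_def by metis
    qed
    then have "skip_sum (\<lambda>a c. syt3_count a b c) a0 c0 = skip_sum (\<lambda>a c. chi0_count a b c) a0 c0 + skip_sum ?xi a0 c0"
      by (simp add: skip_sum_def sum.distrib)
    moreover have "int (skip_sum (\<lambda>a c. syt3_count a b c) a0 c0) = syt3_sum a0 b c0"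
      using e(2,3) False by (intro skip_sum_syt3_count) auto
    moreover have "int (skip_sum (\<lambda>a c. chi0_count a b c) a0 c0) = rcount b (n - 2 * b) b"
    proof -
      have "card (parity_class n b 0) = skip_sum (\<lambda>a c. chi0_count a b c) a0 c0"
        unfolding chi0_count_def by (rule card_parity_class[OF e(1-6)])
      then show ?thesis using card_parity_class_0[of b n] rcount_riordan_number[of b n] b2 assms(2) False by simp
    qed
    moreover have "syt3_sum a0 b c0 = syt3_sum b b (n - 2 * b)"
      using e(7) syt3_sum_sym[of b a0] False e(2) by auto
    moreover have "syt3_sum b b (n - 2 * b) - rcount b (n - 2 * b) b = rcount (b + 1) (n - 2 * b - 2) (b + 1)"
      using assms(1) False by (intro syt3_sum_minus_rcount) auto
    moreover have "rcount (b + 1) (n - 2 * b - 2) (b + 1) = riordan_number n (b + 1)"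
      using rcount_riordan_number[of "b + 1" n] assms(1) by (simp add: diff_diff_add)
    ultimately show ?thesis using c by simp
  qed
qed

lemma card_same_parity_tableaux:
  assumes "1 \<le> k" "2 * k \<le> n"
  defines "F \<equiv> {T \<in> syt_le3_same_parity n. row_length T 1 + chi T = k}"
  shows "finite F" "int (card F) = riordan_number n k"
proof -
  show "finite F" by (rule finite_subset[OF _ finite_syt[of n]]) (auto simp: F_def syt_le3_same_parity_def)
  have par: "even n = even (row_length T 1)" if "T \<in> syt_le3_same_parity n" for T
    using that row_length_rows3(2)[of n T] unfolding same_parity_iff by (metis even_add)
  show "int (card F) = riordan_number n k"
  proof (cases "even n = even k")
    case True
    have "T \<in> F \<longleftrightarrow> T \<in> parity_class n k 0" for T
      using par[of T] chi_le[of T] True by (auto simp: F_def parity_class_def)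
    then have "F = parity_class n k 0" by blast
    then show ?thesis using card_parity_class_0[OF assms(1,2) True] by simp
  next
    case False
    obtain b where b: "k = b + 1" using assms(1) by (metis add.commute le_Suc_ex plus_1_eq_Suc)
    have "T \<in> F \<longleftrightarrow> T \<in> parity_class n b 1" for T
      using par[of T] chi_le[of T] False b by (auto simp: F_def parity_class_def)
    then have "F = parity_class n b 1" by blast
    then show ?thesis using card_parity_class_1[of b n] False assms(2) b by simp
  qed
qed

section \<open>The eight families\<close>

theorem theorem4p2:
  fixes n k :: nat
  assumes "1 \<le> k" and "2 * k \<le> n"
  shows "let
      A = {p. dyck_path n p \<and> num_peaks p = k \<and> \<not> has_singleton_ascent p};
      B = {p. dyck_path n p \<and> num_peaks p = k \<and> \<not> has_singleton_descent p};
      C = {\<pi>. \<pi> permutes {1..n} \<and> avoids_pattern n \<pi> [3, 2, 1] \<and>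
             card (lr_maxima n \<pi>) = k \<and> lr_maxima n \<pi> \<subseteq> descents n \<pi>};
      D = {\<pi>. \<pi> permutes {1..n} \<and> avoids_pattern n \<pi> [3, 1, 2] \<and>
             card (lr_maxima n \<pi>) = k \<and> lr_maxima n \<pi> \<subseteq> descents n \<pi>};
      E = {p. riordan_path n p \<and> count_list p Down = k};
      F = {T \<in> syt_le3_same_parity n. row_length T 1 + chi T = k};
      G = {T. standard_young_tableau n T \<and> shape T = [k, k] @ replicate (n - 2 * k) 1};
      H = {\<sigma>. derangement n \<sigma> \<and> has_genus n \<sigma> 0 \<and> cyc n \<sigma> = k}
    in
      finite A \<and> finite B \<and> finite C \<and> finite D \<and> finite E \<and> finite F \<and> finite G \<and> finite H \<and>
      A \<approx> B \<and> A \<approx> C \<and> A \<approx> D \<and> A \<approx> E \<and> A \<approx> F \<and> A \<approx> G \<and> A \<approx> H"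
proof -
  define A where "A = {p. dyck_path n p \<and> num_peaks p = k \<and> \<not> has_singleton_ascent p}"
  define B where "B = {p. dyck_path n p \<and> num_peaks p = k \<and> \<not> has_singleton_descent p}"
  define C where "C = {\<pi>. \<pi> permutes {1..n} \<and> avoids_pattern n \<pi> [3, 2, 1] \<and>
    card (lr_maxima n \<pi>) = k \<and> lr_maxima n \<pi> \<subseteq> descents n \<pi>}"
  define D where "D = {\<pi>. \<pi> permutes {1..n} \<and> avoids_pattern n \<pi> [3, 1, 2] \<and>
    card (lr_maxima n \<pi>) = k \<and> lr_maxima n \<pi> \<subseteq> descents n \<pi>}"
  define E where "E = {p. riordan_path n p \<and> count_list p Down = k}"
  define F where "F = {T \<in> syt_le3_same_parity n. row_length T 1 + chi T = k}"
  define G where "G = {T. standard_young_tableau n T \<and> shape T = [k, k] @ replicate (n - 2 * k) 1}"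
  define H where "H = {\<sigma>. derangement n \<sigma> \<and> has_genus n \<sigma> 0 \<and> cyc n \<sigma> = k}"
  have B: "finite B" "int (card B) = riordan_number n k"
    unfolding B_def dyck_no_singleton_descent using finite_descent_words card_descent_words[OF assms] by simp_all
  have AB: "bij_betw mirror A B" unfolding A_def B_def by (rule bij_mirror_dyck)
  have A: "finite A" "int (card A) = riordan_number n k"
    using AB B bij_betw_finite[OF AB] bij_betw_same_card[OF AB] by simp_all
  have "bij_betw (run_maxlist n) C (maxlists n n k)" "bij_betw (run_maxlist n) D (maxlists n n k)"
    unfolding C_def D_def by (rule bij_run_maxlist, simp)+
  then have C: "finite C" "int (card C) = riordan_number n k" and D: "finite D" "int (card D) = riordan_number n k"
    using bij_betw_finite bij_betw_same_card finite_maxlists(1)[of n n k] card_maxlists[OF assms] by metis+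
  have E: "finite E" "int (card E) = riordan_number n k"
    unfolding E_def riordan_paths_eq[OF assms(2)] using finite_rprefixes card_riordan_paths[OF assms] by simp_all
  have F: "finite F" "int (card F) = riordan_number n k"
    unfolding F_def by (rule card_same_parity_tableaux[OF assms])+
  have G: "finite G" "int (card G) = riordan_number n k"
    unfolding G_def by (rule card_two_row_hooks[OF assms])+
  have n: "1 \<le> n" using assms by simp
  have "finite H" "real (card H) = riordan_number_real n k"
    unfolding H_def by (rule card_derangements_genus0[OF n])+
  then have H: "finite H" "int (card H) = riordan_number n k"
    unfolding riordan_number_real_eq[OF assms] by linarith+
  have eq: "A \<approx> X" if "finite X" "int (card X) = riordan_number n k" for X :: "'x set"
    using eqpoll_iff_card[OF A(1) that(1)] A(2) that(2) by simp
  show ?thesis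
    unfolding A_def[symmetric] B_def[symmetric] C_def[symmetric] D_def[symmetric] E_def[symmetric]
      F_def[symmetric] G_def[symmetric] H_def[symmetric] Let_def
    by (intro conjI A(1) B(1) C(1) D(1) E(1) F(1) G(1) H(1)
        eq[OF B] eq[OF C] eq[OF D] eq[OF E] eq[OF F] eq[OF G] eq[OF H])
qed

end
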